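(* Let $(L=\frac12 g,\mathcal D)$ be a purely kinetic nonholonomic system on $Q$. For $F\in C^\infty(Q)$ and a $\mathcal D$-preserving modification $\overline g$ of $g$, consider, in local frames $\{X_a,X_i\}$ with $X_a$ spanning $\mathcal D$ and $X_i$ spanning $\mathcal D^g$, and with $\theta_i=\overline g_{ai}v^a$, the conditions (for all values of $(v^a)$) $$(A')\quad g_{bd}\left(\delta_a^dX_c(F)-\delta_c^dX_a(F)\right)v^av^b+\theta_kR^k_{ac}v^a=0\quad\text{for all } c,$$ $$(B')\quad \Gamma^{nh}(\theta_i)+\lambda_i+\theta_k\left(R^k_{ia}+\delta^k_iX_a(F)\right)v^a-g_{ab}X_i(F)v^av^b=0\quad\text{for all } i.$$ 1. If $\hat g=e^{2F}\overline g$ is a Riemannian metric that is a $\mathcal D$-conformal modification of $g$ by $F$, and $(\hat g,P)$ is a projective geodesic extension of $(L,\mathcal D)$ with $P|_{\mathcal D}=X_d(F)v^d$, then the restriction $\overline g|_{\mathcal D\times\mathcal D^g}=(\overline g_{ai})$ and the function $F$ satisfy $(A')$ and $(B')$. 2. If $\overline g$ is a pseudo-Riemannian metric that is a $\mathcal D$-preserving modification of $g$ and its restriction $\overline g|_{\mathcal D\times\mathcal D^g}=(\overline g_{ai})$, together with a function $F\in C^\infty(Q)$, satisfies $(A')$ and $(B')$, then there exists a projective geodesic extension $(\hat g,P)$ of $(L,\mathcal D)$ in which $\hat g$ is a Riemannian metric that is a $\mathcal D$-conformal modification of $g$ by $F$ and $P|_{\mathcal D}=X_d(F)v^d$.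
   Context: Setting: $Q$ is an $n$-dimensional manifold with Riemannian metric $g$; $\mathcal D\subset TQ$ is a distribution of rank $m$; $L(v)=\frac12 g(v,v)$; $\mathcal D^g$ is the $g$-orthogonal complement of $\mathcal D$. Indices: $a,b,c,d=1,\dots,m$; $i,j,k=1,\dots,n-m$; Greek indices run over both. Summation convention is used. In a local frame $\{X_\alpha\}=\{X_a,X_i\}$ with $X_a$ spanning $\mathcal D$ and $X_i$ spanning $\mathcal D^g$, write $[X_\alpha,X_\beta]=R^\gamma_{\alpha\beta}X_\gamma$, $g_{ab}=g(X_a,X_b)$, $g_{ij}=g(X_i,X_j)$ (and $g(X_a,X_i)=0$), $\overline g_{ai}=\overline g(X_a,X_i)$. Any tangent vector is $v=v^aX_a+v^iX_i$, and the $v^\alpha$ are its quasi-velocities; $\mathcal D$ is given by $v^i=0$. With $\nabla$ the Levi-Civita connection of $g$, write $\nabla_{X_a}X_b=\Gamma^c_{ab}X_c+\Gamma^i_{ab}X_i$. The nonholonomic vector field $\Gamma^{nh}$ is the vector field on the manifold $\mathcal D$ whose integral curves satisfy $\dot q=v^aX_a(q)$, $\dot v^d=-\Gamma^d_{ab}v^av^b$ (Lagrange–d'Alembert equations); for $\theta=\theta_b(q)v^b$ on $\mathcal D$, $\Gamma^{nh}(\theta)=(X_a(\theta_b)-\theta_d\Gamma^d_{ab})v^av^b$. The Lagrange multipliers are $\lambda_i=g_{ki}\Gamma^k_{ab}v^av^b$. A symmetric $(0,2)$-tensor field $\overline g$ is a $\mathcal D$-preserving modification of $g$ if $\overline g|_{\mathcal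 D\times\mathcal D}=g|_{\mathcal D\times\mathcal D}$. A symmetric $(0,2)$-tensor field $\hat g$ is a $\mathcal D$-conformal modification of $g$ (by $F$) if $\hat g=e^{2F}\overline g$ with $F\in C^\infty(Q)$ and $\overline g$ a $\mathcal D$-preserving modification of $g$. A projective geodesic extension of $(L,\mathcal D)$ is a Riemannian metric $\hat g$ on $Q$ together with a smooth fibrewise linear function $P$ on $TQ$ such that $\Gamma^{nh}=(\Gamma_{\hat g}+P\Delta)|_{\mathcal D}$, where $\Gamma_{\hat g}$ is the geodesic spray of $\hat g$ and $\Delta$ is the Liouville vector field of $TQ$ (so the nonholonomic trajectories are geodesics of $\hat g$ after a reparametrization). *)

theory Defs
  imports "HOL-Analysis.Analysis" "HOL-Library.Function_Algebras"
begin

text \<open>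
  Tangent vectors will be functionals on functions, so functionals need their pointwise
  real vector space structure.
\<close>

instantiation "fun" :: (type, real_vector) real_vector
begin

definition scaleR_fun :: "real \<Rightarrow> ('a \<Rightarrow> 'b) \<Rightarrow> 'a \<Rightarrow> 'b" where
  "scaleR_fun c f = (\<lambda>x. c *\<^sub>R f x)"

instance
  by standard (auto simp: scaleR_fun_def fun_eq_iff scaleR_add_right scaleR_add_left)

end

text \<open>\<open>Ck_on\<close> is meant for open sets.\<close>

primrec Ck_on :: "nat \<Rightarrow> 'e::euclidean_space set \<Rightarrow> ('e \<Rightarrow> 'b::real_normed_vector) \<Rightarrow> bool" where
  "Ck_on 0 S f \<longleftrightarrow> continuous_on S f"
| "Ck_on (Suc k) S f \<longleftrightarrow>
     (\<forall>x\<in>S. f differentiable (at x)) \<and> (\<forall>u. Ck_on k S (\<lambda>x. frechet_derivative f (at x) u))"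

definition smooth_on :: "'e::euclidean_space set \<Rightarrow> ('e \<Rightarrow> 'b::real_normed_vector) \<Rightarrow> bool" where
  "smooth_on S f \<longleftrightarrow> (\<forall>k. Ck_on k S f)"

text \<open>
  A chart is a domain together with a coordinate map; only the values of the map on the domain
  matter. The topology of a manifold is the one induced by its atlas.
\<close>

type_synonym ('q, 'e) atlas = "('q set \<times> ('q \<Rightarrow> 'e)) set"

definition points :: "('q, 'e) atlas \<Rightarrow> 'q set" where
  "points Q = (\<Union>(U, \<phi>)\<in>Q. U)"

definition atlas_topology :: "('q, 'e::euclidean_space) atlas \<Rightarrow> 'q topology" where
  "atlas_topology Q =
     topology (\<lambda>W. W \<subseteq> points Q \<and> (\<forall>(U, \<phi>)\<in>Q. open (\<phi> ` (U \<inter> W))))"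

definition smooth_manifold :: "('q, 'e::euclidean_space) atlas \<Rightarrow> bool" where
  "smooth_manifold Q \<longleftrightarrow>
     (\<forall>(U, \<phi>)\<in>Q. inj_on \<phi> U \<and> open (\<phi> ` U)) \<and>
     (\<forall>(U, \<phi>)\<in>Q. \<forall>(V, \<psi>)\<in>Q. open (\<phi> ` (U \<inter> V)) \<and>
        smooth_on (\<phi> ` (U \<inter> V)) (\<psi> \<circ> inv_into U \<phi>)) \<and>
     Hausdorff_space (atlas_topology Q) \<and> second_countable (atlas_topology Q)"

text \<open>For open \<open>W\<close>: the restriction of \<open>f\<close> to \<open>W\<close> is smooth. Values of \<open>f\<close> outside \<open>W\<close>
  are irrelevant.\<close>

definition smooth_fun :: "('q, 'e::euclidean_space) atlas \<Rightarrow> 'q set \<Rightarrow> ('q \<Rightarrow> real) \<Rightarrow> bool" where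
  "smooth_fun Q W f \<longleftrightarrow> (\<forall>(U, \<phi>)\<in>Q. smooth_on (\<phi> ` (U \<inter> W)) (f \<circ> inv_into U \<phi>))"

definition smooth_near :: "('q, 'e::euclidean_space) atlas \<Rightarrow> 'q \<Rightarrow> ('q \<Rightarrow> real) \<Rightarrow> bool" where
  "smooth_near Q q f \<longleftrightarrow> (\<exists>W. openin (atlas_topology Q) W \<and> q \<in> W \<and> smooth_fun Q W f)"

text \<open>
  A tangent vector at \<open>q\<close> is a directional derivative in a chart, acting on the functions that
  are smooth near \<open>q\<close>. It is set to \<open>0\<close> on all other functions, so that equality of tangent
  vectors is equality of functionals, and \<open>v f\<close> is the derivative of \<open>f\<close> along \<open>v\<close>.
\<close>

type_synonym 'q tvec = "('q \<Rightarrow> real) \<Rightarrow> real"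

definition chart_vector ::
  "('q, 'e::euclidean_space) atlas \<Rightarrow> 'q set \<times> ('q \<Rightarrow> 'e) \<Rightarrow> 'q \<Rightarrow> 'e \<Rightarrow> 'q tvec" where
  "chart_vector Q c q u = (\<lambda>f. if smooth_near Q q f
     then frechet_derivative (f \<circ> inv_into (fst c) (snd c)) (at (snd c q)) u else 0)"

definition tangent_space :: "('q, 'e::euclidean_space) atlas \<Rightarrow> 'q \<Rightarrow> 'q tvec set" where
  "tangent_space Q q = {v. \<exists>c\<in>Q. q \<in> fst c \<and> (\<exists>u. v = chart_vector Q c q u)}"

definition vector_field ::
  "('q, 'e::euclidean_space) atlas \<Rightarrow> 'q set \<Rightarrow> ('q \<Rightarrow> 'q tvec) \<Rightarrow> bool" where
  "vector_field Q U X \<longleftrightarrow> openin (atlas_topology Q) U \<and> (\<forall>q\<in>U. X q \<in> tangent_space Q q) \<and>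
     (\<forall>V f. openin (atlas_topology Q) V \<and> V \<subseteq> U \<and> smooth_fun Q V f \<longrightarrow>
        smooth_fun Q V (\<lambda>q. X q f))"

definition lie_bracket ::
  "('q, 'e::euclidean_space) atlas \<Rightarrow> ('q \<Rightarrow> 'q tvec) \<Rightarrow> ('q \<Rightarrow> 'q tvec) \<Rightarrow> 'q \<Rightarrow> 'q tvec" where
  "lie_bracket Q X Y q = (\<lambda>f. if smooth_near Q q f
     then X q (\<lambda>p. Y p f) - Y q (\<lambda>p. X p f) else 0)"

text \<open>
  Points of \<open>TQ\<close> are pairs \<open>(q, v)\<close>. The chart of \<open>TQ\<close> induced by \<open>(U, \<phi>)\<close> sends \<open>(q, v)\<close> to
  \<open>\<phi> q\<close> and the coordinate vector of \<open>v\<close>, whose components are the derivatives along \<open>v\<close> of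
  the coordinate functions. Tangent vectors to \<open>TQ\<close> are elements of
  \<open>tangent_space (tangent_bundle Q) (q, v)\<close>.
\<close>

definition tangent_bundle ::
  "('q, 'e::euclidean_space) atlas \<Rightarrow> ('q \<times> 'q tvec, 'e \<times> 'e) atlas" where
  "tangent_bundle Q =
     (\<lambda>(U, \<phi>). (Sigma U (tangent_space Q),
                \<lambda>(q, v). (\<phi> q, \<Sum>b\<in>Basis. v (\<lambda>p. \<phi> p \<bullet> b) *\<^sub>R b))) ` Q"

definition liouville ::
  "('q, 'e::euclidean_space) atlas \<Rightarrow> 'q \<times> 'q tvec \<Rightarrow> ('q \<times> 'q tvec) tvec" where
  "liouville Q w = (\<lambda>G. if smooth_near (tangent_bundle Q) w G
     then deriv (\<lambda>t. G (fst w, exp t *\<^sub>R snd w)) 0 else 0)"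

definition smooth_fibrewise_linear ::
  "('q, 'e::euclidean_space) atlas \<Rightarrow> ('q \<times> 'q tvec \<Rightarrow> real) \<Rightarrow> bool" where
  "smooth_fibrewise_linear Q P \<longleftrightarrow>
     smooth_fun (tangent_bundle Q) (points (tangent_bundle Q)) P \<and>
     (\<forall>q\<in>points Q. \<forall>v\<in>tangent_space Q q. \<forall>w\<in>tangent_space Q q. \<forall>c.
        P (q, v + w) = P (q, v) + P (q, w) \<and> P (q, c *\<^sub>R v) = c * P (q, v))"

definition basis_of :: "nat set \<Rightarrow> (nat \<Rightarrow> 'v::real_vector) \<Rightarrow> 'v set \<Rightarrow> bool" where
  "basis_of I Y V \<longleftrightarrow> inj_on Y I \<and> independent (Y ` I) \<and> span (Y ` I) = V"

definition local_frame ::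
  "('q, 'e::euclidean_space) atlas \<Rightarrow> 'q set \<Rightarrow> (nat \<Rightarrow> 'q \<Rightarrow> 'q tvec) \<Rightarrow> bool" where
  "local_frame Q U X \<longleftrightarrow> openin (atlas_topology Q) U \<and>
     (\<forall>\<alpha><DIM('e). vector_field Q U (X \<alpha>)) \<and>
     (\<forall>q\<in>U. basis_of {..<DIM('e)} (\<lambda>\<alpha>. X \<alpha> q) (tangent_space Q q))"

text \<open>The quasi-velocity \<open>v\<^sup>\<gamma>\<close> with respect to the \<open>n\<close> frame fields \<open>X 0, \<dots>, X (n - 1)\<close>, as a
  function on \<open>TQ\<close>.\<close>

definition quasi_velocity ::
  "nat \<Rightarrow> (nat \<Rightarrow> 'q \<Rightarrow> 'q tvec) \<Rightarrow> nat \<Rightarrow> 'q \<times> 'q tvec \<Rightarrow> real" where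
  "quasi_velocity n X \<gamma> w =
     representation ((\<lambda>\<beta>. X \<beta> (fst w)) ` {..<n}) (snd w) (X \<gamma> (fst w))"

text \<open>\<open>structure_fun Q X \<gamma> \<alpha> \<beta>\<close> is \<open>R\<^sup>\<gamma>\<close> with lower indices \<open>\<alpha>, \<beta>\<close>.\<close>

definition structure_fun ::
  "('q, 'e::euclidean_space) atlas \<Rightarrow> (nat \<Rightarrow> 'q \<Rightarrow> 'q tvec) \<Rightarrow>
     nat \<Rightarrow> nat \<Rightarrow> nat \<Rightarrow> 'q \<Rightarrow> real" where
  "structure_fun Q X \<gamma> \<alpha> \<beta> q =
     quasi_velocity DIM('e) X \<gamma> (q, lie_bracket Q (X \<alpha>) (X \<beta>) q)"

type_synonym 'q tensor2 = "'q \<Rightarrow> 'q tvec \<Rightarrow> 'q tvec \<Rightarrow> real"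

definition symmetric_tensor :: "('q, 'e::euclidean_space) atlas \<Rightarrow> 'q tensor2 \<Rightarrow> bool" where
  "symmetric_tensor Q h \<longleftrightarrow>
     (\<forall>q\<in>points Q. \<forall>u\<in>tangent_space Q q. \<forall>v\<in>tangent_space Q q. \<forall>w\<in>tangent_space Q q. \<forall>c.
        h q u v = h q v u \<and> h q (u + v) w = h q u w + h q v w \<and>
        h q (c *\<^sub>R u) v = c * h q u v) \<and>
     (\<forall>U X Y. vector_field Q U X \<and> vector_field Q U Y \<longrightarrow>
        smooth_fun Q U (\<lambda>q. h q (X q) (Y q)))"

definition pseudo_riemannian_metric :: "('q, 'e::euclidean_space) atlas \<Rightarrow> 'q tensor2 \<Rightarrow> bool" where
  "pseudo_riemannian_metric Q h \<longleftrightarrow> symmetric_tensor Q h \<and>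
     (\<forall>q\<in>points Q. \<forall>v\<in>tangent_space Q q. (\<forall>w\<in>tangent_space Q q. h q v w = 0) \<longrightarrow> v = 0)"

definition riemannian_metric :: "('q, 'e::euclidean_space) atlas \<Rightarrow> 'q tensor2 \<Rightarrow> bool" where
  "riemannian_metric Q h \<longleftrightarrow> symmetric_tensor Q h \<and>
     (\<forall>q\<in>points Q. \<forall>v\<in>tangent_space Q q. v \<noteq> 0 \<longrightarrow> h q v v > 0)"

text \<open>
  Local frames are defined on open subsets only, so an affine connection is an operator on the
  vector fields over every open set, compatible with restriction.
\<close>

definition affine_connection ::
  "('q, 'e::euclidean_space) atlas \<Rightarrow>
     (('q \<Rightarrow> 'q tvec) \<Rightarrow> ('q \<Rightarrow> 'q tvec) \<Rightarrow> 'q \<Rightarrow> 'q tvec) \<Rightarrow> bool" where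
  "affine_connection Q N \<longleftrightarrow>
     (\<forall>U X Y. vector_field Q U X \<and> vector_field Q U Y \<longrightarrow> vector_field Q U (N X Y)) \<and>
     (\<forall>U X X' Y Y'. vector_field Q U X \<and> vector_field Q U X' \<and>
        vector_field Q U Y \<and> vector_field Q U Y' \<and>
        (\<forall>q\<in>U. X q = X' q \<and> Y q = Y' q) \<longrightarrow> (\<forall>q\<in>U. N X Y q = N X' Y' q)) \<and>
     (\<forall>U X X' Y f. vector_field Q U X \<and> vector_field Q U X' \<and> vector_field Q U Y \<and>
        smooth_fun Q U f \<longrightarrow>
        (\<forall>q\<in>U. N (\<lambda>p. X p + X' p) Y q = N X Y q + N X' Y q \<and>
               N (\<lambda>p. f p *\<^sub>R X p) Y q = f q *\<^sub>R N X Y q)) \<and>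
     (\<forall>U X Y Y' f. vector_field Q U X \<and> vector_field Q U Y \<and> vector_field Q U Y' \<and>
        smooth_fun Q U f \<longrightarrow>
        (\<forall>q\<in>U. N X (\<lambda>p. Y p + Y' p) q = N X Y q + N X Y' q \<and>
               N X (\<lambda>p. f p *\<^sub>R Y p) q = X q f *\<^sub>R Y q + f q *\<^sub>R N X Y q))"

text \<open>The torsion-free metric connection is unique on vector fields; the choice operator only
  leaves open its irrelevant values on arguments that are not smooth vector fields.\<close>

definition levi_civita ::
  "('q, 'e::euclidean_space) atlas \<Rightarrow> 'q tensor2 \<Rightarrow>
     ('q \<Rightarrow> 'q tvec) \<Rightarrow> ('q \<Rightarrow> 'q tvec) \<Rightarrow> 'q \<Rightarrow> 'q tvec" where
  "levi_civita Q h = (SOME N. affine_connection Q N \<and>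
     (\<forall>U X Y. vector_field Q U X \<and> vector_field Q U Y \<longrightarrow>
        (\<forall>q\<in>U. N X Y q - N Y X q = lie_bracket Q X Y q)) \<and>
     (\<forall>U X Y Z. vector_field Q U X \<and> vector_field Q U Y \<and> vector_field Q U Z \<longrightarrow>
        (\<forall>q\<in>U. X q (\<lambda>p. h p (Y p) (Z p)) = h q (N X Y q) (Z q) + h q (Y q) (N X Z q))))"

text \<open>\<open>connection_coeff Q h X \<gamma> \<alpha> \<beta>\<close> is the \<open>\<gamma>\<close>-component of \<open>\<nabla>\<close> of \<open>X \<beta>\<close> along \<open>X \<alpha>\<close>.\<close>

definition connection_coeff ::
  "('q, 'e::euclidean_space) atlas \<Rightarrow> 'q tensor2 \<Rightarrow> (nat \<Rightarrow> 'q \<Rightarrow> 'q tvec) \<Rightarrow>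
     nat \<Rightarrow> nat \<Rightarrow> nat \<Rightarrow> 'q \<Rightarrow> real" where
  "connection_coeff Q h X \<gamma> \<alpha> \<beta> q =
     quasi_velocity DIM('e) X \<gamma> (q, levi_civita Q h (X \<alpha>) (X \<beta>) q)"

text \<open>The equation \<open>dq/dt = v\<close> for a vector \<open>W\<close> tangent to \<open>TQ\<close> at \<open>w = (q, v)\<close>.\<close>

definition second_order_vector ::
  "('q, 'e::euclidean_space) atlas \<Rightarrow> 'q \<times> 'q tvec \<Rightarrow> ('q \<times> 'q tvec) tvec \<Rightarrow> bool" where
  "second_order_vector Q w W \<longleftrightarrow> W \<in> tangent_space (tangent_bundle Q) w \<and>
     (\<forall>f. smooth_near Q (fst w) f \<longrightarrow> W (f \<circ> fst) = snd w f)"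

text \<open>
  The vector field on \<open>TQ\<close> whose integral curves satisfy the geodesic equations, written in
  quasi-velocities of arbitrary local frames (coordinate frames included).
\<close>

definition geodesic_spray ::
  "('q, 'e::euclidean_space) atlas \<Rightarrow> 'q tensor2 \<Rightarrow> 'q \<times> 'q tvec \<Rightarrow> ('q \<times> 'q tvec) tvec" where
  "geodesic_spray Q h w = (THE W. second_order_vector Q w W \<and>
     (\<forall>U X. local_frame Q U X \<and> fst w \<in> U \<longrightarrow>
        (\<forall>\<gamma><DIM('e). W (quasi_velocity DIM('e) X \<gamma>) =
           - (\<Sum>\<alpha><DIM('e). \<Sum>\<beta><DIM('e). connection_coeff Q h X \<gamma> \<alpha> \<beta> (fst w) *
                quasi_velocity DIM('e) X \<alpha> w * quasi_velocity DIM('e) X \<beta> w))))"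

definition distribution ::
  "('q, 'e::euclidean_space) atlas \<Rightarrow> nat \<Rightarrow> ('q \<Rightarrow> 'q tvec set) \<Rightarrow> bool" where
  "distribution Q m D \<longleftrightarrow>
     (\<forall>q\<in>points Q. D q \<subseteq> tangent_space Q q) \<and>
     (\<forall>q\<in>points Q. \<exists>U X. openin (atlas_topology Q) U \<and> q \<in> U \<and>
        (\<forall>a<m. vector_field Q U (X a)) \<and>
        (\<forall>p\<in>U. basis_of {..<m} (\<lambda>a. X a p) (D p)))"

definition orthogonal_distribution ::
  "('q, 'e::euclidean_space) atlas \<Rightarrow> 'q tensor2 \<Rightarrow> ('q \<Rightarrow> 'q tvec set) \<Rightarrow> 'q \<Rightarrow> 'q tvec set" where
  "orthogonal_distribution Q g D q = {v \<in> tangent_space Q q. \<forall>w\<in>D q. g q v w = 0}"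

text \<open>
  Indices are shifted to start at \<open>0\<close>: with \<open>n = DIM('e)\<close>, indices \<open>a, b, c, d\<close> run over
  \<open>{..<m}\<close> and \<open>i, k\<close> over \<open>{m..<n}\<close>.
\<close>

definition adapted_frame ::
  "('q, 'e::euclidean_space) atlas \<Rightarrow> 'q tensor2 \<Rightarrow> nat \<Rightarrow> ('q \<Rightarrow> 'q tvec set) \<Rightarrow>
     'q set \<Rightarrow> (nat \<Rightarrow> 'q \<Rightarrow> 'q tvec) \<Rightarrow> bool" where
  "adapted_frame Q g m D U X \<longleftrightarrow> local_frame Q U X \<and>
     (\<forall>q\<in>U. span ((\<lambda>a. X a q) ` {..<m}) = D q \<and>
            span ((\<lambda>i. X i q) ` {m..<DIM('e)}) = orthogonal_distribution Q g D q)"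

text \<open>
  The nonholonomic vector field at a point \<open>w = (q, v)\<close> with \<open>v \<in> D q\<close>. A vector field on the
  submanifold \<open>D\<close>, given by \<open>v\<^sup>i = 0\<close>, is regarded as a field of vectors of \<open>TQ\<close> along \<open>D\<close> that
  annihilate the functions \<open>v\<^sup>i\<close>; its action on a function on \<open>D\<close> is the action on any smooth
  extension of that function to \<open>TQ\<close>. The values at points outside \<open>D\<close> are meaningless.
\<close>

definition nonholonomic_field ::
  "('q, 'e::euclidean_space) atlas \<Rightarrow> 'q tensor2 \<Rightarrow> nat \<Rightarrow> ('q \<Rightarrow> 'q tvec set) \<Rightarrow>
     'q \<times> 'q tvec \<Rightarrow> ('q \<times> 'q tvec) tvec" where
  "nonholonomic_field Q g m D w = (THE W. second_order_vector Q w W \<and>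
     (\<forall>U X. adapted_frame Q g m D U X \<and> fst w \<in> U \<longrightarrow>
        (\<forall>d<m. W (quasi_velocity DIM('e) X d) =
           - (\<Sum>a<m. \<Sum>b<m. connection_coeff Q g X d a b (fst w) *
                quasi_velocity DIM('e) X a w * quasi_velocity DIM('e) X b w)) \<and>
        (\<forall>i\<in>{m..<DIM('e)}. W (quasi_velocity DIM('e) X i) = 0)))"

definition lagrange_multiplier ::
  "('q, 'e::euclidean_space) atlas \<Rightarrow> 'q tensor2 \<Rightarrow> nat \<Rightarrow> (nat \<Rightarrow> 'q \<Rightarrow> 'q tvec) \<Rightarrow>
     nat \<Rightarrow> 'q \<times> 'q tvec \<Rightarrow> real" where
  "lagrange_multiplier Q g m X i w =
     (\<Sum>k\<in>{m..<DIM('e)}. g (fst w) (X k (fst w)) (X i (fst w)) *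
        (\<Sum>a<m. \<Sum>b<m. connection_coeff Q g X k a b (fst w) *
           quasi_velocity DIM('e) X a w * quasi_velocity DIM('e) X b w))"

definition preserving_modification ::
  "('q, 'e::euclidean_space) atlas \<Rightarrow> 'q tensor2 \<Rightarrow> ('q \<Rightarrow> 'q tvec set) \<Rightarrow> 'q tensor2 \<Rightarrow> bool" where
  "preserving_modification Q g D gbar \<longleftrightarrow> symmetric_tensor Q gbar \<and>
     (\<forall>q\<in>points Q. \<forall>v\<in>D q. \<forall>w\<in>D q. gbar q v w = g q v w)"

definition conformal_rescaling ::
  "('q, 'e::euclidean_space) atlas \<Rightarrow> ('q \<Rightarrow> real) \<Rightarrow> 'q tensor2 \<Rightarrow> 'q tensor2 \<Rightarrow> bool" where
  "conformal_rescaling Q F h h' \<longleftrightarrow>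
     (\<forall>q\<in>points Q. \<forall>v\<in>tangent_space Q q. \<forall>w\<in>tangent_space Q q.
        h' q v w = exp (2 * F q) * h q v w)"

definition conformal_modification ::
  "('q, 'e::euclidean_space) atlas \<Rightarrow> 'q tensor2 \<Rightarrow> ('q \<Rightarrow> 'q tvec set) \<Rightarrow> ('q \<Rightarrow> real) \<Rightarrow>
     'q tensor2 \<Rightarrow> bool" where
  "conformal_modification Q g D F ghat \<longleftrightarrow> symmetric_tensor Q ghat \<and>
     (\<exists>gbar. preserving_modification Q g D gbar \<and> conformal_rescaling Q F gbar ghat)"

definition projective_geodesic_extension ::
  "('q, 'e::euclidean_space) atlas \<Rightarrow> 'q tensor2 \<Rightarrow> nat \<Rightarrow> ('q \<Rightarrow> 'q tvec set) \<Rightarrow>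
     'q tensor2 \<Rightarrow> ('q \<times> 'q tvec \<Rightarrow> real) \<Rightarrow> bool" where
  "projective_geodesic_extension Q g m D ghat P \<longleftrightarrow>
     riemannian_metric Q ghat \<and> smooth_fibrewise_linear Q P \<and>
     (\<forall>q\<in>points Q. \<forall>v\<in>D q.
        nonholonomic_field Q g m D (q, v) =
        geodesic_spray Q ghat (q, v) + P (q, v) *\<^sub>R liouville Q (q, v))"

definition restricts_to_differential ::
  "('q, 'e::euclidean_space) atlas \<Rightarrow> 'q tensor2 \<Rightarrow> nat \<Rightarrow> ('q \<Rightarrow> 'q tvec set) \<Rightarrow>
     ('q \<Rightarrow> real) \<Rightarrow> ('q \<times> 'q tvec \<Rightarrow> real) \<Rightarrow> bool" where
  "restricts_to_differential Q g m D F P \<longleftrightarrow>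
     (\<forall>U X. adapted_frame Q g m D U X \<longrightarrow> (\<forall>q\<in>U. \<forall>v\<in>D q.
        P (q, v) = (\<Sum>d<m. X d q F * quasi_velocity DIM('e) X d (q, v))))"

text \<open>\<open>\<theta>\<^sub>i\<close>, extended from \<open>D\<close> to \<open>TQ\<close> by the same formula.\<close>

definition theta ::
  "('q, 'e::euclidean_space) atlas \<Rightarrow> nat \<Rightarrow> 'q tensor2 \<Rightarrow> (nat \<Rightarrow> 'q \<Rightarrow> 'q tvec) \<Rightarrow>
     nat \<Rightarrow> 'q \<times> 'q tvec \<Rightarrow> real" where
  "theta Q m gbar X i w =
     (\<Sum>a<m. gbar (fst w) (X a (fst w)) (X i (fst w)) * quasi_velocity DIM('e) X a w)"

definition condition_A ::
  "('q, 'e::euclidean_space) atlas \<Rightarrow> 'q tensor2 \<Rightarrow> nat \<Rightarrow> ('q \<Rightarrow> 'q tvec set) \<Rightarrow>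
     ('q \<Rightarrow> real) \<Rightarrow> 'q tensor2 \<Rightarrow> bool" where
  "condition_A Q g m D F gbar \<longleftrightarrow>
     (\<forall>U X. adapted_frame Q g m D U X \<longrightarrow> (\<forall>q\<in>U. \<forall>v\<in>D q. \<forall>c<m.
        (\<Sum>a<m. \<Sum>b<m. \<Sum>d<m.
           g q (X b q) (X d q) * (of_bool (d = a) * X c q F - of_bool (d = c) * X a q F) *
           quasi_velocity DIM('e) X a (q, v) * quasi_velocity DIM('e) X b (q, v)) +
        (\<Sum>k\<in>{m..<DIM('e)}. \<Sum>a<m.
           theta Q m gbar X k (q, v) * structure_fun Q X k a c q *
           quasi_velocity DIM('e) X a (q, v)) = 0))"

definition condition_B ::
  "('q, 'e::euclidean_space) atlas \<Rightarrow> 'q tensor2 \<Rightarrow> nat \<Rightarrow> ('q \<Rightarrow> 'q tvec set) \<Rightarrow>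
     ('q \<Rightarrow> real) \<Rightarrow> 'q tensor2 \<Rightarrow> bool" where
  "condition_B Q g m D F gbar \<longleftrightarrow>
     (\<forall>U X. adapted_frame Q g m D U X \<longrightarrow> (\<forall>q\<in>U. \<forall>v\<in>D q. \<forall>i\<in>{m..<DIM('e)}.
        nonholonomic_field Q g m D (q, v) (theta Q m gbar X i) +
        lagrange_multiplier Q g m X i (q, v) +
        (\<Sum>k\<in>{m..<DIM('e)}. \<Sum>a<m.
           theta Q m gbar X k (q, v) *
           (structure_fun Q X k i a q + of_bool (k = i) * X a q F) *
           quasi_velocity DIM('e) X a (q, v)) -
        (\<Sum>a<m. \<Sum>b<m.
           g q (X a q) (X b q) * X i q F *
           quasi_velocity DIM('e) X a (q, v) * quasi_velocity DIM('e) X b (q, v)) = 0))"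

end

theory Submission
  imports Defs "Jordan_Normal_Form.Determinant"
begin

text \<open>
  Extend \<open>v \<in> D q\<close> to a section \<open>V\<close> of \<open>D\<close>. The geodesic spray of a metric at \<open>v\<close> is the
  push-forward of \<open>v\<close> along \<open>V\<close> minus the vertical lift of \<open>\<nabla>\<^sub>V V\<close>; the nonholonomic field is the
  push-forward minus the vertical lift of the \<open>g\<close>-orthogonal projection of \<open>\<nabla>\<^sub>V V\<close> to \<open>D\<close>; the
  Liouville field is the vertical lift of \<open>v\<close>. The projective equation at \<open>v\<close> is therefore an
  equation between tangent vectors of \<open>Q\<close>, which needs no frame. Pairing it by \<open>ghat\<close> with the fields
  \<open>X c\<close> of an adapted frame and evaluating both connections by Koszul's formula gives (A'), and pairing
  it with the fields \<open>X i\<close> gives (B'). Conversely, (A') and (B') only see \<open>gbar\<close> on \<open>D \<times> TQ\<close>, and the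
  remaining part of \<open>gbar\<close> can be chosen so that the tensor becomes positive definite.
\<close>

text \<open>Both vector fields on \<open>TQ\<close> are definite descriptions quantified over all
  frames, and the Levi-Civita connection is a choice, so existence and uniqueness must be proved
  before anything can be computed. Second-order vectors at one point differ by a vertical vector,
  hence the quasi-velocities of one frame decide uniqueness. The section V is given constant
  coefficients in an adapted frame. Then [V, X_c] is linear in v, its normal components are the
  R^k_{ac} v^a, and pairing them with theta_k yields gbar(v, .) - g(v, .), because both tensors
  agree on D. This turns the index expressions of (A') and (B') into pairings. The weight e^{2F}
  contributes 2 v(F) gbar(v, Z) to Koszul's formula. The Liouville term with P = dF takes away half
  of it, and the rest is the v(F) of (A') and (B'). For the converse, positive definiteness comes
  from completing the square: with the mixed part fixed, the normal block is chosen as g_ij +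
  gbar_ai g^{ab} gbar_bj, whose Schur complement is g_ij. The tensor \<open>gmod\<close> is the
  frame-free form of this.\<close>

no_notation Matrix.scalar_prod (infix "\<bullet>" 70)

section \<open>Smooth functions on open sets\<close>

text \<open>A derivative at a point sees a whole neighbourhood, so openness of \<open>S\<close> is
  what carries equality on \<open>S\<close> through the recursion.\<close>

lemma Ck_on_cong:
  assumes "open S" "\<And>x. x \<in> S \<Longrightarrow> f x = g x" "Ck_on k S f"
  shows "Ck_on k S g"
  using assms
proof (induction k arbitrary: f g)
  case 0
  then show ?case by (metis Ck_on.simps(1) continuous_on_cong)
next
  case (Suc k)
  have d: "f differentiable (at x)" if "x \<in> S" for x
    using Suc.prems(3) that by simp
  have eq: "frechet_derivative f (at x) = frechet_derivative g (at x)" if "x \<in> S" for x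
    using frechet_derivative_transform_within_open[OF d[OF that] Suc.prems(1) that] Suc.prems(2) by blast
  have "g differentiable (at x)" if "x \<in> S" for x
    using d[OF that] Suc.prems(1,2) that
    by (metis differentiable_def has_derivative_transform_within_open)
  moreover have "Ck_on k S (\<lambda>x. frechet_derivative g (at x) u)" for u
    by (rule Suc.IH[of "\<lambda>x. frechet_derivative f (at x) u"]) (use Suc.prems eq in auto)
  ultimately show ?case by simp
qed

text \<open>Replaces the choice term \<open>frechet_derivative\<close> by any explicit derivative
  formula; all the closure properties below are inductions through this rule.\<close>

lemma Ck_onI:
  assumes "open S" "\<And>x. x \<in> S \<Longrightarrow> (f has_derivative f' x) (at x)" "\<And>u. Ck_on k S (\<lambda>x. f' x u)"
  shows "Ck_on (Suc k) S f"
proof -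
  have "f' x = frechet_derivative f (at x)" if "x \<in> S" for x
    using frechet_derivative_at assms(2)[OF that] by blast
  then have "Ck_on k S (\<lambda>x. frechet_derivative f (at x) u)" for u
    by (intro Ck_on_cong[OF assms(1) _ assms(3)[of u]]) simp
  moreover have "f differentiable at x" if "x \<in> S" for x
    using assms(2)[OF that] by (auto simp: differentiable_def)
  ultimately show ?thesis by simp
qed

lemma Ck_on_SucD:
  assumes "Ck_on (Suc k) S f" "x \<in> S"
  shows "(f has_derivative frechet_derivative f (at x)) (at x)"
  using assms frechet_derivative_works by auto

lemma Ck_on_Suc_imp: "Ck_on (Suc k) S f \<Longrightarrow> Ck_on k S f"
proof (induction k arbitrary: f)
  case 0
  then show ?case
    by (auto intro!: differentiable_imp_continuous_on differentiable_at_imp_differentiable_on)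
next
  case (Suc k)
  then show ?case by (metis Ck_on.simps(2))
qed

lemma Ck_on_subset: "Ck_on k S f \<Longrightarrow> T \<subseteq> S \<Longrightarrow> Ck_on k T f"
  by (induction k arbitrary: f) (auto intro: continuous_on_subset)

lemma Ck_on_const: "open S \<Longrightarrow> Ck_on k S (\<lambda>x. c)"
  by (induction k arbitrary: c) (auto simp: frechet_derivative_const)

lemma Ck_on_bounded_linear:
  assumes "bounded_linear h" "open S" "Ck_on k S f"
  shows "Ck_on k S (\<lambda>x. h (f x))"
  using assms(3)
proof (induction k arbitrary: f)
  case 0
  then show ?case using assms(1) by (simp add: linear_continuous_on_compose bounded_linear.continuous_on)
next
  case (Suc k)
  show ?case
  proof (rule Ck_onI[OF assms(2)])
    show "((\<lambda>x. h (f x)) has_derivative (\<lambda>u. h (frechet_derivative f (at x) u))) (at x)" if "x \<in> S" for x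
      using bounded_linear.has_derivative[OF assms(1) Ck_on_SucD[OF Suc.prems that]] .
    show "Ck_on k S (\<lambda>x. h (frechet_derivative f (at x) u))" for u
      using Suc by simp
  qed
qed

lemma Ck_on_id: "open S \<Longrightarrow> Ck_on k S (\<lambda>x. x)"
  by (cases k) (auto simp: Ck_on_const)

lemma Ck_on_add:
  assumes "open S" "Ck_on k S f" "Ck_on k S g"
  shows "Ck_on k S (\<lambda>x. f x + g x)"
  using assms(2,3)
proof (induction k arbitrary: f g)
  case 0
  then show ?case by (simp add: continuous_on_add)
next
  case (Suc k)
  show ?case
    by (rule Ck_onI[OF assms(1) has_derivative_add[OF Ck_on_SucD[OF Suc.prems(1)] Ck_on_SucD[OF Suc.prems(2)]]])
       (use Suc in auto)
qed

lemma Ck_on_sum: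
  assumes "open S" "\<And>i. i \<in> I \<Longrightarrow> Ck_on k S (f i)"
  shows "Ck_on k S (\<lambda>x. \<Sum>i\<in>I. f i x)"
  using assms(2)
  by (induction I rule: infinite_finite_induct) (auto intro: Ck_on_add Ck_on_const assms(1))

lemma Ck_on_bounded_bilinear:
  assumes h: "bounded_bilinear h" and "open S" "Ck_on k S f" "Ck_on k S g"
  shows "Ck_on k S (\<lambda>x. h (f x) (g x))"
  using assms(3,4)
proof (induction k arbitrary: f g)
  case 0
  then show ?case using h by (simp add: bounded_bilinear.continuous_on)
next
  case (Suc k)
  show ?case
  proof (rule Ck_onI[OF assms(2) bounded_bilinear.FDERIV[OF h Ck_on_SucD[OF Suc.prems(1)] Ck_on_SucD[OF Suc.prems(2)]]])
    show "Ck_on k S (\<lambda>x. h (f x) (frechet_derivative g (at x) u) + h (frechet_derivative f (at x) u) (g x))" for u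
      \<comment> \<open>In each product one factor is undifferentiated and has one order to spare,
        so \<open>Ck_on_Suc_imp\<close> lowers it to order \<open>k\<close> before the induction
        hypothesis is applied.\<close>
      using Suc.prems by (intro Ck_on_add[OF assms(2)] Suc.IH Ck_on_Suc_imp[OF Suc.prems(1)]
          Ck_on_Suc_imp[OF Suc.prems(2)]) auto
  qed auto
qed

lemma Ck_on_compose:
  fixes f :: "'a::euclidean_space \<Rightarrow> 'b::euclidean_space" and g :: "'b \<Rightarrow> 'c::real_normed_vector"
  assumes "open S" "open T" "f ` S \<subseteq> T" "Ck_on k S f" "Ck_on k T g"
  shows "Ck_on k S (g \<circ> f)"
  using assms(4,5)
proof (induction k arbitrary: g)
  case 0
  then show ?case using assms(3) continuous_on_compose continuous_on_subset unfolding Ck_on.simps(1) by blast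
next
  case (Suc k)
  \<comment> \<open>\<open>Ck_on\<close> only controls derivatives in a fixed direction, but in the
    chain rule the outer derivative is taken in a direction that moves with \<open>x\<close>.
    Expanding that direction over \<open>Basis\<close> leaves a sum of products of functions covered
    by the induction hypothesis.\<close>
  let ?D = "\<lambda>x u. \<Sum>b\<in>Basis. (frechet_derivative f (at x) u \<bullet> b) *\<^sub>R frechet_derivative g (at (f x)) b"
  show ?case
  proof (rule Ck_onI[OF assms(1)])
    show "((g \<circ> f) has_derivative ?D x) (at x)" if x: "x \<in> S" for x
    proof -
      have g: "(g has_derivative frechet_derivative g (at (f x))) (at (f x))"
        using Ck_on_SucD[OF Suc.prems(2)] assms(3) x by blast
      then interpret g: linear "frechet_derivative g (at (f x))"
        using has_derivative_linear by blast
      have "frechet_derivative g (at (f x)) (frechet_derivative f (at x) u) = ?D x u" for u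
        by (subst (1) euclidean_representation[symmetric]) (simp add: g.sum g.scaleR)
      then have "frechet_derivative g (at (f x)) \<circ> frechet_derivative f (at x) = ?D x"
        by auto
      then show ?thesis
        using diff_chain_at[OF Ck_on_SucD[OF Suc.prems(1) x] g] by simp
    qed
    have fk: "Ck_on k S f" using Suc.prems(1) by (rule Ck_on_Suc_imp)
    have "Ck_on k S (\<lambda>x. frechet_derivative g (at (f x)) b)" for b
      using Suc.IH[OF fk, of "\<lambda>y. frechet_derivative g (at y) b"] Suc.prems(2) by (simp add: o_def)
    moreover have "Ck_on k S (\<lambda>x. frechet_derivative f (at x) u \<bullet> b)" for u b
      using Suc.prems(1) by (intro Ck_on_bounded_linear[OF bounded_linear_inner_left assms(1)]) simp
    ultimately show "Ck_on k S (\<lambda>x. ?D x u)" for u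
      by (intro Ck_on_sum Ck_on_bounded_bilinear[OF bounded_bilinear_scaleR] assms(1))
  qed
qed

lemma Ck_on_inverse:
  fixes f :: "'a::euclidean_space \<Rightarrow> real"
  assumes "open S" "\<And>x. x \<in> S \<Longrightarrow> f x \<noteq> 0" "Ck_on k S f"
  shows "Ck_on k S (\<lambda>x. inverse (f x))"
  using assms(3)
proof (induction k)
  case 0
  then show ?case using assms(2) by (auto intro: continuous_on_inverse)
next
  case (Suc k)
  note mult = Ck_on_bounded_bilinear[OF bounded_bilinear_mult assms(1)]
  \<comment> \<open>The derivative of the reciprocal contains the reciprocal itself, which is
    available one order lower by induction.\<close>
  have "Ck_on k S (\<lambda>x. inverse (f x))" using Suc.IH Suc.prems Ck_on_Suc_imp by blast
  then have "Ck_on k S (\<lambda>x. - (inverse (f x) * frechet_derivative f (at x) u * inverse (f x)))" for u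
    using Suc.prems by (intro Ck_on_bounded_linear[OF bounded_linear_minus[OF bounded_linear_ident]] assms(1) mult) auto
  then show ?case
    by (intro Ck_onI[OF assms(1) Deriv.has_derivative_inverse[OF assms(2) Ck_on_SucD[OF Suc.prems]]]) auto
qed

lemma Ck_on_exp: "Ck_on k UNIV (exp :: real \<Rightarrow> real)"
proof (induction k)
  case (Suc k)
  have "((exp::real\<Rightarrow>real) has_derivative (\<lambda>u. exp x * u)) (at x)" for x
    using DERIV_exp[of x] by (simp add: has_field_derivative_def)
  moreover have "Ck_on k UNIV (\<lambda>x::real. exp x * u)" for u
    by (intro Ck_on_bounded_bilinear[OF bounded_bilinear_mult] Suc Ck_on_const open_UNIV)
  ultimately show ?case by (intro Ck_onI) auto
qed (auto intro: continuous_intros)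

lemma Ck_on_local:
  assumes "\<And>x. x \<in> S \<Longrightarrow> \<exists>T. open T \<and> x \<in> T \<and> Ck_on k T f"
  shows "Ck_on k S f"
  using assms
proof (induction k arbitrary: f)
  case 0
  then show ?case
    by (metis Ck_on.simps(1) continuous_at_imp_continuous_on continuous_on_eq_continuous_at)
next
  case (Suc k)
  have "Ck_on k S (\<lambda>x. frechet_derivative f (at x) u)" for u
    by (rule Suc.IH) (use Suc.prems in fastforce)
  moreover have "f differentiable at x" if "x \<in> S" for x using Suc.prems[OF that] by auto
  ultimately show ?case by simp
qed

lemma smooth_on_cong: "open S \<Longrightarrow> (\<And>x. x \<in> S \<Longrightarrow> f x = g x) \<Longrightarrow> smooth_on S f \<Longrightarrow> smooth_on S g"
  unfolding smooth_on_def using Ck_on_cong by blast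

lemma smooth_on_subset: "smooth_on S f \<Longrightarrow> T \<subseteq> S \<Longrightarrow> smooth_on T f"
  unfolding smooth_on_def using Ck_on_subset by blast

lemma smooth_on_const: "open S \<Longrightarrow> smooth_on S (\<lambda>x. c)"
  unfolding smooth_on_def using Ck_on_const by blast

lemma smooth_on_id: "open S \<Longrightarrow> smooth_on S (\<lambda>x. x)"
  unfolding smooth_on_def using Ck_on_id by blast

lemma smooth_on_bounded_linear:
  "bounded_linear h \<Longrightarrow> open S \<Longrightarrow> smooth_on S f \<Longrightarrow> smooth_on S (\<lambda>x. h (f x))"
  unfolding smooth_on_def using Ck_on_bounded_linear by blast

lemma smooth_on_add:
  "open S \<Longrightarrow> smooth_on S f \<Longrightarrow> smooth_on S g \<Longrightarrow> smooth_on S (\<lambda>x. f x + g x)"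
  unfolding smooth_on_def using Ck_on_add by blast

lemma smooth_on_sum:
  "open S \<Longrightarrow> (\<And>i. i \<in> I \<Longrightarrow> smooth_on S (f i)) \<Longrightarrow> smooth_on S (\<lambda>x. \<Sum>i\<in>I. f i x)"
  unfolding smooth_on_def by (blast intro: Ck_on_sum)

lemma smooth_on_bounded_bilinear:
  "bounded_bilinear h \<Longrightarrow> open S \<Longrightarrow> smooth_on S f \<Longrightarrow> smooth_on S g \<Longrightarrow> smooth_on S (\<lambda>x. h (f x) (g x))"
  unfolding smooth_on_def by (blast intro: Ck_on_bounded_bilinear)

lemmas smooth_on_scaleR = smooth_on_bounded_bilinear[OF bounded_bilinear_scaleR]
lemmas smooth_on_mult = smooth_on_bounded_bilinear[OF bounded_bilinear_mult]

lemma smooth_on_compose: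
  fixes f :: "'a::euclidean_space \<Rightarrow> 'b::euclidean_space" and g :: "'b \<Rightarrow> 'c::real_normed_vector"
  shows "open S \<Longrightarrow> open T \<Longrightarrow> f ` S \<subseteq> T \<Longrightarrow> smooth_on S f \<Longrightarrow> smooth_on T g \<Longrightarrow> smooth_on S (g \<circ> f)"
  unfolding smooth_on_def using Ck_on_compose by blast

lemma smooth_on_inverse:
  fixes f :: "'a::euclidean_space \<Rightarrow> real"
  shows "open S \<Longrightarrow> (\<And>x. x \<in> S \<Longrightarrow> f x \<noteq> 0) \<Longrightarrow> smooth_on S f \<Longrightarrow> smooth_on S (\<lambda>x. inverse (f x))"
  unfolding smooth_on_def using Ck_on_inverse by blast

lemma smooth_on_exp: "smooth_on UNIV (exp :: real \<Rightarrow> real)"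
  unfolding smooth_on_def using Ck_on_exp by blast

lemma smooth_on_local: "(\<And>x. x \<in> S \<Longrightarrow> \<exists>T. open T \<and> x \<in> T \<and> smooth_on T f) \<Longrightarrow> smooth_on S f"
  unfolding smooth_on_def by (meson Ck_on_local)

lemma smooth_on_has_derivative:
  "smooth_on S f \<Longrightarrow> x \<in> S \<Longrightarrow> (f has_derivative frechet_derivative f (at x)) (at x)"
  unfolding smooth_on_def using Ck_on_SucD by blast

lemma smooth_on_frechet_derivative: "smooth_on S f \<Longrightarrow> smooth_on S (\<lambda>x. frechet_derivative f (at x) u)"
  unfolding smooth_on_def using Ck_on.simps(2) by blast

lemma smooth_on_continuous: "smooth_on S f \<Longrightarrow> continuous_on S f"
  unfolding smooth_on_def by (meson Ck_on.simps(1))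

lemma smooth_on_Pair:
  fixes f :: "'a::euclidean_space \<Rightarrow> 'b::real_normed_vector" and g :: "'a \<Rightarrow> 'c::real_normed_vector"
  assumes "open S" "smooth_on S f" "smooth_on S g"
  shows "smooth_on S (\<lambda>x. (f x, g x))"
proof -
  have "bounded_linear (\<lambda>x::'b. (x, 0::'c))" "bounded_linear (\<lambda>x::'c. (0::'b, x))"
    by (intro bounded_linear_Pair bounded_linear_ident bounded_linear_zero)+
  from smooth_on_add[OF assms(1) smooth_on_bounded_linear[OF this(1) assms(1,2)]
      smooth_on_bounded_linear[OF this(2) assms(1,3)]]
  show ?thesis by simp
qed

lemma bounded_linear_frechet_derivative:
  "smooth_on S f \<Longrightarrow> x \<in> S \<Longrightarrow> bounded_linear (frechet_derivative f (at x))"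
  using smooth_on_has_derivative has_derivative_bounded_linear by blast

section \<open>Symmetry of mixed second derivatives\<close>

text \<open>The second difference of \<open>f\<close> over a parallelogram is symmetric in its sides, and the mean
  value theorem applied twice turns it into a mixed second derivative.\<close>

lemma second_difference_mean_value:
  fixes f :: "'a::euclidean_space \<Rightarrow> real"
  assumes f: "smooth_on S f" and t: "0 < t"
    and par: "\<And>r s. 0 \<le> r \<Longrightarrow> r \<le> t \<Longrightarrow> 0 \<le> s \<Longrightarrow> s \<le> t \<Longrightarrow> x + r *\<^sub>R a + s *\<^sub>R b \<in> S"
  obtains r s where "0 < r" "r < t" "0 < s" "s < t"
    "f (x + t *\<^sub>R a + t *\<^sub>R b) - f (x + t *\<^sub>R a) - f (x + t *\<^sub>R b) + f x =
      t * t * frechet_derivative (\<lambda>y. frechet_derivative f (at y) a) (at (x + r *\<^sub>R a + s *\<^sub>R b)) b"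
proof -
  let ?f' = "\<lambda>y. frechet_derivative f (at y) a"
  have lin: "linear (frechet_derivative f (at y))" if "y \<in> S" for y
    using bounded_linear_frechet_derivative[OF f that] bounded_linear.linear by blast
  have f': "smooth_on S ?f'" using f by (rule smooth_on_frechet_derivative)
  have lin': "linear (frechet_derivative ?f' (at y))" if "y \<in> S" for y
    using bounded_linear_frechet_derivative[OF f' that] bounded_linear.linear by blast
  define \<phi> where "\<phi> r = f (x + r *\<^sub>R a + t *\<^sub>R b) - f (x + r *\<^sub>R a + 0 *\<^sub>R b)" for r
  have "\<exists>r. r > 0 \<and> r < t \<and> \<phi> t - \<phi> 0 = (t - 0) * (?f' (x + r *\<^sub>R a + t *\<^sub>R b) - ?f' (x + r *\<^sub>R a + 0 *\<^sub>R b))"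
  proof (rule MVT2[OF t])
    fix r assume r: "0 \<le> r" "r \<le> t"
    have d: "((\<lambda>r. f (x + r *\<^sub>R a + s *\<^sub>R b)) has_real_derivative ?f' (x + r *\<^sub>R a + s *\<^sub>R b)) (at r)"
      if s: "0 \<le> s" "s \<le> t" for s
    proof -
      have "((\<lambda>r. x + r *\<^sub>R a + s *\<^sub>R b) has_derivative (\<lambda>h. h *\<^sub>R a)) (at r)"
        by (auto intro!: derivative_eq_intros)
      from diff_chain_at[OF this smooth_on_has_derivative[OF f par[OF r s]]]
      show ?thesis
        using linear_scale[OF lin[OF par[OF r s]]]
        by (simp add: has_field_derivative_def o_def mult_commute_abs)
    qed
    show "(\<phi> has_real_derivative ?f' (x + r *\<^sub>R a + t *\<^sub>R b) - ?f' (x + r *\<^sub>R a + 0 *\<^sub>R b)) (at r)"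
      unfolding \<phi>_def using d[of t] d[of 0] t by (intro DERIV_diff) auto
  qed
  then obtain r where r: "0 < r" "r < t"
    "\<phi> t - \<phi> 0 = t * (?f' (x + r *\<^sub>R a + t *\<^sub>R b) - ?f' (x + r *\<^sub>R a + 0 *\<^sub>R b))" by auto
  have "\<exists>s. s > 0 \<and> s < t \<and> ?f' (x + r *\<^sub>R a + t *\<^sub>R b) - ?f' (x + r *\<^sub>R a + 0 *\<^sub>R b) =
      (t - 0) * frechet_derivative ?f' (at (x + r *\<^sub>R a + s *\<^sub>R b)) b"
  proof (rule MVT2[OF t])
    fix s assume s: "0 \<le> s" "s \<le> t"
    have S: "x + r *\<^sub>R a + s *\<^sub>R b \<in> S" using par r s by auto
    have "((\<lambda>s. x + r *\<^sub>R a + s *\<^sub>R b) has_derivative (\<lambda>h. h *\<^sub>R b)) (at s)"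
      by (auto intro!: derivative_eq_intros)
    from diff_chain_at[OF this smooth_on_has_derivative[OF f' S]]
    show "((\<lambda>s. ?f' (x + r *\<^sub>R a + s *\<^sub>R b)) has_real_derivative
        frechet_derivative ?f' (at (x + r *\<^sub>R a + s *\<^sub>R b)) b) (at s)"
      using linear_scale[OF lin'[OF S]]
      by (simp add: has_field_derivative_def o_def mult_commute_abs)
  qed
  then obtain s where "0 < s" "s < t"
    "\<phi> t - \<phi> 0 = t * t * frechet_derivative ?f' (at (x + r *\<^sub>R a + s *\<^sub>R b)) b"
    using r by auto
  then show ?thesis using that[of r s] r by (simp add: \<phi>_def algebra_simps)
qed

lemma second_derivative_symmetric:
  fixes f :: "'a::euclidean_space \<Rightarrow> real"
  assumes S: "open S" and f: "smooth_on S f" and x: "x \<in> S"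
  shows "frechet_derivative (\<lambda>y. frechet_derivative f (at y) a) (at x) b =
         frechet_derivative (\<lambda>y. frechet_derivative f (at y) b) (at x) a"
proof (rule ccontr)
  let ?A = "\<lambda>y. frechet_derivative (\<lambda>y. frechet_derivative f (at y) a) (at y) b"
  let ?B = "\<lambda>y. frechet_derivative (\<lambda>y. frechet_derivative f (at y) b) (at y) a"
  assume ne: "?A x \<noteq> ?B x"
  \<comment> \<open>Half the gap: a number closer than \<open>e\<close> to \<open>?A x\<close>
    cannot also be closer than \<open>e\<close> to \<open>?B x\<close>.\<close>
  define e where "e = \<bar>?A x - ?B x\<bar> / 2"
  have e: "e > 0" using ne by (simp add: e_def)
  have "continuous_on S ?A" "continuous_on S ?B"
    by (intro smooth_on_continuous smooth_on_frechet_derivative f)+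
  then have cont: "continuous (at x) ?A" "continuous (at x) ?B"
    using S x continuous_on_eq_continuous_at by blast+
  obtain d1 where d1: "d1 > 0" "\<And>y. dist y x < d1 \<Longrightarrow> dist (?A y) (?A x) < e"
    using cont(1)[unfolded continuous_at_eps_delta, rule_format, OF e] by auto
  obtain d2 where d2: "d2 > 0" "\<And>y. dist y x < d2 \<Longrightarrow> dist (?B y) (?B x) < e"
    using cont(2)[unfolded continuous_at_eps_delta, rule_format, OF e] by auto
  obtain d3 where d3: "d3 > 0" "\<And>y. dist y x < d3 \<Longrightarrow> y \<in> S"
    using S x unfolding open_dist by blast
  define d where "d = min d1 (min d2 d3)"
  have d: "d > 0" "\<And>y. dist y x < d \<Longrightarrow> y \<in> S \<and> dist (?A y) (?A x) < e \<and> dist (?B y) (?B x) < e"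
    using d1 d2 d3 by (auto simp: d_def)
  \<comment> \<open>Chosen so that the parallelogram with sides \<open>t\<close> times
    \<open>a\<close> and \<open>t\<close> times \<open>b\<close> stays within distance
    \<open>d\<close> of \<open>x\<close>; the summand 1 keeps the denominator positive when both
    vectors vanish.\<close>
  define t where "t = d / (2 * (norm a + norm b + 1))"
  have t: "t > 0" using d(1) by (auto simp: t_def intro!: divide_pos_pos add_nonneg_pos)
  have near: "dist (x + r *\<^sub>R a + s *\<^sub>R b) x < d" if "0 \<le> r" "r \<le> t" "0 \<le> s" "s \<le> t" for r s
  proof -
    have "dist (x + r *\<^sub>R a + s *\<^sub>R b) x \<le> r * norm a + s * norm b"
      using norm_triangle_ineq[of "r *\<^sub>R a" "s *\<^sub>R b"] that by (simp add: dist_norm add.assoc)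
    also have "\<dots> \<le> t * norm a + t * norm b" using that by (intro add_mono mult_right_mono) auto
    also have "\<dots> = d * ((norm a + norm b) / (2 * (norm a + norm b + 1)))"
      by (simp add: t_def add_divide_distrib distrib_left)
    also have "\<dots> < d * 1"
    proof (rule mult_strict_left_mono[OF _ d(1)])
      have *: "norm a + norm b < 2 * (norm a + norm b + 1)" "0 < 2 * (norm a + norm b + 1)"
        using norm_ge_zero[of a] norm_ge_zero[of b] by (simp_all add: add_nonneg_pos)
      then show "(norm a + norm b) / (2 * (norm a + norm b + 1)) < 1"
        by (metis divide_less_eq_1_pos)
    qed
    finally show ?thesis by simp
  qed
  have near': "dist (x + r *\<^sub>R b + s *\<^sub>R a) x < d" if "0 \<le> r" "r \<le> t" "0 \<le> s" "s \<le> t" for r s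
    using near[OF that(3,4,1,2)] by (simp add: add_ac)
  obtain r s where rs: "0 < r" "r < t" "0 < s" "s < t"
    "f (x + t *\<^sub>R a + t *\<^sub>R b) - f (x + t *\<^sub>R a) - f (x + t *\<^sub>R b) + f x = t * t * ?A (x + r *\<^sub>R a + s *\<^sub>R b)"
    by (rule second_difference_mean_value[OF f t]) (use d(2) near in blast, blast)
  obtain r' s' where rs': "0 < r'" "r' < t" "0 < s'" "s' < t"
    "f (x + t *\<^sub>R b + t *\<^sub>R a) - f (x + t *\<^sub>R b) - f (x + t *\<^sub>R a) + f x = t * t * ?B (x + r' *\<^sub>R b + s' *\<^sub>R a)"
    by (rule second_difference_mean_value[OF f t]) (use d(2) near' in blast, blast)
  \<comment> \<open>The second difference does not change when \<open>a\<close> and \<open>b\<close>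
    are exchanged, so the two mean values coincide.\<close>
  have "t * t * ?A (x + r *\<^sub>R a + s *\<^sub>R b) = t * t * ?B (x + r' *\<^sub>R b + s' *\<^sub>R a)"
    using rs(5) rs'(5) by (simp add: algebra_simps)
  then have "?A (x + r *\<^sub>R a + s *\<^sub>R b) = ?B (x + r' *\<^sub>R b + s' *\<^sub>R a)" using t by simp
  moreover have "dist (?A (x + r *\<^sub>R a + s *\<^sub>R b)) (?A x) < e" "dist (?B (x + r' *\<^sub>R b + s' *\<^sub>R a)) (?B x) < e"
    using d(2) near near' rs rs' by (meson less_imp_le)+
  ultimately have "\<bar>?A x - ?B x\<bar> < 2 * e" by (simp add: dist_real_def)
  then show False by (simp add: e_def)
qed

section \<open>Atlases and tangent vectors\<close>

lemma sum_fun_apply: "(\<Sum>i\<in>I. f i) x = (\<Sum>i\<in>I. f i x :: 'b::comm_monoid_add)"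
  by (induction I rule: infinite_finite_induct) (auto simp: zero_fun_def plus_fun_def)

text \<open>Stated so that the tangent bundle is again an instance: the lemmas of this locale are
  reused for functions and vectors on \<open>TQ\<close> under the prefix \<open>TB\<close>.\<close>

locale smooth_atlas =
  fixes Q :: "('q, 'e::euclidean_space) atlas"
  assumes inj_chart: "c \<in> Q \<Longrightarrow> inj_on (snd c) (fst c)"
    and open_overlap: "c \<in> Q \<Longrightarrow> d \<in> Q \<Longrightarrow> open (snd c ` (fst c \<inter> fst d))"
    and smooth_transition: "c \<in> Q \<Longrightarrow> d \<in> Q \<Longrightarrow>
      smooth_on (snd c ` (fst c \<inter> fst d)) (snd d \<circ> inv_into (fst c) (snd c))"

lemma smooth_manifold_imp_smooth_atlas: "smooth_manifold Q \<Longrightarrow> smooth_atlas Q"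
  unfolding smooth_manifold_def smooth_atlas_def by fastforce

context smooth_atlas
begin

abbreviation opn :: "'q set \<Rightarrow> bool" where "opn \<equiv> openin (atlas_topology Q)"
abbreviation T :: "'q \<Rightarrow> 'q tvec set" where "T \<equiv> tangent_space Q"

lemma inv_chart [simp]: "c \<in> Q \<Longrightarrow> q \<in> fst c \<Longrightarrow> inv_into (fst c) (snd c) (snd c q) = q"
  using inj_chart by (simp add: inv_into_f_f)

lemma inv_chart_pair [simp]: "(U, \<phi>) \<in> Q \<Longrightarrow> q \<in> U \<Longrightarrow> inv_into U \<phi> (\<phi> q) = q"
  using inv_chart[of "(U, \<phi>)"] by simp

lemma opn_iff: "opn W \<longleftrightarrow> W \<subseteq> points Q \<and> (\<forall>c\<in>Q. open (snd c ` (fst c \<inter> W)))"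
proof -
  have "istopology (\<lambda>W. W \<subseteq> points Q \<and> (\<forall>(U, \<phi>)\<in>Q. open (\<phi> ` (U \<inter> W))))"
    unfolding istopology_def
  proof (intro conjI allI impI)
    fix S S' assume *: "S \<subseteq> points Q \<and> (\<forall>(U, \<phi>)\<in>Q. open (\<phi> ` (U \<inter> S)))"
      "S' \<subseteq> points Q \<and> (\<forall>(U, \<phi>)\<in>Q. open (\<phi> ` (U \<inter> S')))"
    have "open (\<phi> ` (U \<inter> (S \<inter> S')))" if c: "(U, \<phi>) \<in> Q" for U \<phi>
    proof -
      \<comment> \<open>Images commute with intersections here because charts are injective.\<close>
      have "\<phi> ` (U \<inter> (S \<inter> S')) = \<phi> ` (U \<inter> S) \<inter> \<phi> ` (U \<inter> S')"
        using inj_chart[OF c] by (auto simp: inj_on_def)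
      then show ?thesis using * c by auto
    qed
    then show "S \<inter> S' \<subseteq> points Q" "\<forall>(U, \<phi>)\<in>Q. open (\<phi> ` (U \<inter> (S \<inter> S')))" using * by auto
  next
    fix K assume *: "\<forall>S\<in>K. S \<subseteq> points Q \<and> (\<forall>(U, \<phi>)\<in>Q. open (\<phi> ` (U \<inter> S)))"
    have "\<phi> ` (U \<inter> \<Union>K) = (\<Union>S\<in>K. \<phi> ` (U \<inter> S))" for U and \<phi> :: "'q \<Rightarrow> 'e" by auto
    then show "\<Union>K \<subseteq> points Q" "\<forall>(U, \<phi>)\<in>Q. open (\<phi> ` (U \<inter> \<Union>K))"
      using * by (auto intro!: open_UN)
  qed
  from topology_inverse'[OF this] show ?thesis
    unfolding atlas_topology_def by (auto simp: case_prod_beta)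
qed

lemma opn_image: "opn W \<Longrightarrow> c \<in> Q \<Longrightarrow> open (snd c ` (fst c \<inter> W))"
  by (simp add: opn_iff)

lemma opn_image_pair: "opn W \<Longrightarrow> (U, \<phi>) \<in> Q \<Longrightarrow> open (\<phi> ` (U \<inter> W))"
  using opn_image[of W "(U, \<phi>)"] by simp

lemma opn_points: "opn W \<Longrightarrow> q \<in> W \<Longrightarrow> q \<in> points Q"
  by (auto simp: opn_iff)

lemma opn_chart: "c \<in> Q \<Longrightarrow> opn (fst c)"
  unfolding opn_iff points_def using open_overlap by (auto simp: Int_commute)

lemma points_eq: "points Q = (\<Union>c\<in>Q. fst c)"
  by (simp add: points_def case_prod_beta)

lemma chart_ex: "q \<in> points Q \<Longrightarrow> \<exists>c\<in>Q. q \<in> fst c"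
  unfolding points_eq by blast

lemma chart_points: "c \<in> Q \<Longrightarrow> q \<in> fst c \<Longrightarrow> q \<in> points Q"
  unfolding points_eq by blast

lemma open_image: "c \<in> Q \<Longrightarrow> open (snd c ` fst c)"
  using open_overlap[of c c] by simp

subsection \<open>Smooth functions\<close>

lemma smooth_funD: "smooth_fun Q W f \<Longrightarrow> c \<in> Q \<Longrightarrow>
    smooth_on (snd c ` (fst c \<inter> W)) (f \<circ> inv_into (fst c) (snd c))"
  by (auto simp: smooth_fun_def)

lemma smooth_funI: "(\<And>c. c \<in> Q \<Longrightarrow> smooth_on (snd c ` (fst c \<inter> W)) (f \<circ> inv_into (fst c) (snd c)))
    \<Longrightarrow> smooth_fun Q W f"
  by (auto simp: smooth_fun_def)

lemma smooth_fun_cong: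
  assumes "opn W" "\<And>q. q \<in> W \<Longrightarrow> f q = g q" "smooth_fun Q W f"
  shows "smooth_fun Q W g"
  by (intro smooth_funI smooth_on_cong[OF opn_image[OF assms(1)] _ smooth_funD[OF assms(3)]])
     (auto simp: assms(2))

lemma smooth_fun_subset: "smooth_fun Q W f \<Longrightarrow> V \<subseteq> W \<Longrightarrow> smooth_fun Q V f"
  by (intro smooth_funI) (rule smooth_on_subset[OF smooth_funD], auto)

lemma smooth_fun_const: "opn W \<Longrightarrow> smooth_fun Q W (\<lambda>q. a)"
  by (auto intro!: smooth_funI simp: o_def smooth_on_const opn_image_pair)

lemma smooth_fun_add: "opn W \<Longrightarrow> smooth_fun Q W f \<Longrightarrow> smooth_fun Q W g \<Longrightarrow> smooth_fun Q W (\<lambda>q. f q + g q)"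
  by (intro smooth_funI) (auto dest!: smooth_funD intro!: smooth_on_add simp: o_def opn_image_pair)

lemma smooth_fun_mult: "opn W \<Longrightarrow> smooth_fun Q W f \<Longrightarrow> smooth_fun Q W g \<Longrightarrow> smooth_fun Q W (\<lambda>q. f q * g q)"
  by (intro smooth_funI) (auto dest!: smooth_funD intro!: smooth_on_mult simp: o_def opn_image_pair)

lemma smooth_fun_cmult: "opn W \<Longrightarrow> smooth_fun Q W f \<Longrightarrow> smooth_fun Q W (\<lambda>q. a * f q)"
  by (intro smooth_fun_mult smooth_fun_const)

lemma smooth_fun_uminus: "opn W \<Longrightarrow> smooth_fun Q W f \<Longrightarrow> smooth_fun Q W (\<lambda>q. - f q)"
  using smooth_fun_cmult[of W f "-1"] by simp

lemma smooth_fun_diff: "opn W \<Longrightarrow> smooth_fun Q W f \<Longrightarrow> smooth_fun Q W g \<Longrightarrow> smooth_fun Q W (\<lambda>q. f q - g q)"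
  using smooth_fun_add[of W f "\<lambda>q. - g q"] smooth_fun_uminus by simp

lemma smooth_fun_sum:
  "opn W \<Longrightarrow> (\<And>i. i \<in> I \<Longrightarrow> smooth_fun Q W (f i)) \<Longrightarrow> smooth_fun Q W (\<lambda>q. \<Sum>i\<in>I. f i q)"
  by (induction I rule: infinite_finite_induct) (auto intro: smooth_fun_const smooth_fun_add)

lemma smooth_fun_prod:
  "opn W \<Longrightarrow> (\<And>i. i \<in> I \<Longrightarrow> smooth_fun Q W (f i)) \<Longrightarrow> smooth_fun Q W (\<lambda>q. \<Prod>i\<in>I. f i q)"
  by (induction I rule: infinite_finite_induct) (auto intro: smooth_fun_const smooth_fun_mult)

lemma smooth_fun_inverse:
  "opn W \<Longrightarrow> (\<And>q. q \<in> W \<Longrightarrow> f q \<noteq> 0) \<Longrightarrow> smooth_fun Q W f \<Longrightarrow> smooth_fun Q W (\<lambda>q. inverse (f q))"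
  by (intro smooth_funI) (auto dest!: smooth_funD intro!: smooth_on_inverse simp: o_def opn_image_pair)

lemma smooth_fun_divide:
  "opn W \<Longrightarrow> (\<And>q. q \<in> W \<Longrightarrow> g q \<noteq> 0) \<Longrightarrow> smooth_fun Q W f \<Longrightarrow> smooth_fun Q W g \<Longrightarrow>
    smooth_fun Q W (\<lambda>q. f q / g q)"
  unfolding divide_inverse by (intro smooth_fun_mult smooth_fun_inverse)

lemma smooth_fun_exp: "opn W \<Longrightarrow> smooth_fun Q W f \<Longrightarrow> smooth_fun Q W (\<lambda>q. exp (f q))"
proof (rule smooth_funI)
  fix c assume *: "opn W" "smooth_fun Q W f" "c \<in> Q"
  have "smooth_on (snd c ` (fst c \<inter> W)) (exp \<circ> (f \<circ> inv_into (fst c) (snd c)))"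
    by (rule smooth_on_compose[OF opn_image[OF *(1,3)] open_UNIV _ smooth_funD[OF *(2,3)] smooth_on_exp]) simp
  then show "smooth_on (snd c ` (fst c \<inter> W)) ((\<lambda>q. exp (f q)) \<circ> inv_into (fst c) (snd c))"
    by (simp add: o_def)
qed

lemma smooth_fun_local:
  assumes "\<And>q. q \<in> W \<Longrightarrow> \<exists>V. opn V \<and> q \<in> V \<and> smooth_fun Q V f"
  shows "smooth_fun Q W f"
proof (rule smooth_funI, rule smooth_on_local)
  fix c x assume c: "c \<in> Q" and "x \<in> snd c ` (fst c \<inter> W)"
  then obtain q where q: "q \<in> fst c" "q \<in> W" "x = snd c q" by auto
  then obtain V where "opn V" "q \<in> V" "smooth_fun Q V f" using assms by blast
  then show "\<exists>S. open S \<and> x \<in> S \<and> smooth_on S (f \<circ> inv_into (fst c) (snd c))"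
    using q c opn_image smooth_funD by (intro exI[of _ "snd c ` (fst c \<inter> V)"]) auto
qed

text \<open>One chart suffices: in any other chart the coordinate expression is the given one
  composed with a smooth transition map.\<close>

lemma smooth_fun_chartI:
  assumes c: "c \<in> Q" and W: "W \<subseteq> fst c" "opn W"
    and f: "smooth_on (snd c ` W) (f \<circ> inv_into (fst c) (snd c))"
  shows "smooth_fun Q W f"
proof (rule smooth_funI)
  fix d assume d: "d \<in> Q"
  have o: "open (snd d ` (fst d \<inter> W))" "open (snd c ` W)"
    using opn_image[OF W(2) d] opn_image[OF W(2) c] W(1) by (simp_all add: Int_absorb1)
  have tr: "smooth_on (snd d ` (fst d \<inter> W)) (snd c \<circ> inv_into (fst d) (snd d))"
    by (rule smooth_on_subset[OF smooth_transition[OF d c]]) (use W in auto)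
  have "smooth_on (snd d ` (fst d \<inter> W))
      ((f \<circ> inv_into (fst c) (snd c)) \<circ> (snd c \<circ> inv_into (fst d) (snd d)))"
    by (rule smooth_on_compose[OF o _ tr f]) (use d in auto)
  then show "smooth_on (snd d ` (fst d \<inter> W)) (f \<circ> inv_into (fst d) (snd d))"
    by (rule smooth_on_cong[OF o(1), rotated]) (use d c W in auto)
qed

lemma smooth_chart_coordinate: "c \<in> Q \<Longrightarrow> smooth_fun Q (fst c) (\<lambda>q. snd c q \<bullet> b)"
proof (rule smooth_fun_chartI)
  assume c: "c \<in> Q"
  have "smooth_on (snd c ` fst c) (\<lambda>x. x \<bullet> b)"
    by (intro smooth_on_bounded_linear[OF bounded_linear_inner_left] open_image smooth_on_id c)
  then show "smooth_on (snd c ` fst c) ((\<lambda>q. snd c q \<bullet> b) \<circ> inv_into (fst c) (snd c))"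
    by (rule smooth_on_cong[OF open_image[OF c], rotated]) (use c in auto)
qed (auto simp: opn_chart)

text \<open>Serves to show that the set where a determinant of smooth functions does not vanish is
  open.\<close>

lemma opn_smooth_preimage:
  assumes f: "smooth_fun Q W f" and W: "opn W" and S: "open S"
  shows "opn {q \<in> W. f q \<in> S}"
  unfolding opn_iff
proof (intro conjI ballI)
  show "{q \<in> W. f q \<in> S} \<subseteq> points Q" using W opn_points by auto
  fix c assume c: "c \<in> Q"
  have "open ((f \<circ> inv_into (fst c) (snd c)) -` S \<inter> snd c ` (fst c \<inter> W))"
    using continuous_on_open_vimage[OF opn_image[OF W c]] smooth_on_continuous[OF smooth_funD[OF f c]] S
    by blast
  also have "(f \<circ> inv_into (fst c) (snd c)) -` S \<inter> snd c ` (fst c \<inter> W) = snd c ` (fst c \<inter> {q \<in> W. f q \<in> S})"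
    using c by auto
  finally show "open (snd c ` (fst c \<inter> {q \<in> W. f q \<in> S}))" .
qed

lemma smooth_nearI: "opn W \<Longrightarrow> q \<in> W \<Longrightarrow> smooth_fun Q W f \<Longrightarrow> smooth_near Q q f"
  by (auto simp: smooth_near_def)

lemma smooth_near_common:
  assumes "smooth_near Q q f" "smooth_near Q q g"
  obtains W where "opn W" "q \<in> W" "smooth_fun Q W f" "smooth_fun Q W g"
proof -
  obtain V V' where "opn V" "q \<in> V" "smooth_fun Q V f" "opn V'" "q \<in> V'" "smooth_fun Q V' g"
    using assms by (auto simp: smooth_near_def)
  then show ?thesis
    using that[of "V \<inter> V'"] by (auto intro: smooth_fun_subset)
qed

lemma smooth_near_add: "smooth_near Q q f \<Longrightarrow> smooth_near Q q g \<Longrightarrow> smooth_near Q q (\<lambda>p. f p + g p)"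
  by (erule (1) smooth_near_common) (auto intro!: smooth_nearI smooth_fun_add)

lemma smooth_near_mult: "smooth_near Q q f \<Longrightarrow> smooth_near Q q g \<Longrightarrow> smooth_near Q q (\<lambda>p. f p * g p)"
  by (erule (1) smooth_near_common) (auto intro!: smooth_nearI smooth_fun_mult)

lemma smooth_near_const: "q \<in> points Q \<Longrightarrow> smooth_near Q q (\<lambda>p. a)"
  by (metis chart_ex opn_chart smooth_fun_const smooth_nearI)

lemma smooth_near_sum:
  "q \<in> points Q \<Longrightarrow> (\<And>i. i \<in> I \<Longrightarrow> smooth_near Q q (f i)) \<Longrightarrow> smooth_near Q q (\<lambda>p. \<Sum>i\<in>I. f i p)"
  by (induction I rule: infinite_finite_induct) (auto intro: smooth_near_const smooth_near_add)

lemma smooth_near_cong: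
  assumes "opn W" "q \<in> W" "\<And>p. p \<in> W \<Longrightarrow> f p = g p"
  shows "smooth_near Q q f = smooth_near Q q g"
proof -
  have "smooth_near Q q g" if "smooth_near Q q f" "\<And>p. p \<in> W \<Longrightarrow> f p = g p" for f g
  proof -
    obtain V where V: "opn V" "q \<in> V" "smooth_fun Q V f" using \<open>smooth_near Q q f\<close> by (auto simp: smooth_near_def)
    have o: "opn (V \<inter> W)" using V assms by blast
    have "smooth_fun Q (V \<inter> W) g"
      by (rule smooth_fun_cong[OF o _ smooth_fun_subset[OF V(3)]]) (use that in auto)
    then show ?thesis using o V assms by (auto intro: smooth_nearI)
  qed
  from this[of f g] this[of g f] show ?thesis using assms(3) by auto
qed

subsection \<open>Tangent vectors\<close>

lemma near_has_derivative:
  assumes "smooth_near Q q f" "c \<in> Q" "q \<in> fst c"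
  shows "(f \<circ> inv_into (fst c) (snd c) has_derivative
     frechet_derivative (f \<circ> inv_into (fst c) (snd c)) (at (snd c q))) (at (snd c q))"
proof -
  obtain W where W: "opn W" "q \<in> W" "smooth_fun Q W f" using assms(1) by (auto simp: smooth_near_def)
  then show ?thesis using assms(2,3) by (intro smooth_on_has_derivative[OF smooth_funD[OF W(3)]]) auto
qed

lemma chart_vector_apply:
  "smooth_near Q q f \<Longrightarrow>
    chart_vector Q c q u f = frechet_derivative (f \<circ> inv_into (fst c) (snd c)) (at (snd c q)) u"
  by (simp add: chart_vector_def)

lemma chart_vectorI:
  assumes "smooth_near Q q f" "(f \<circ> inv_into (fst c) (snd c) has_derivative f') (at (snd c q))"
  shows "chart_vector Q c q u f = f' u"
  using assms chart_vector_apply frechet_derivative_at by metis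

text \<open>The chain rule: a change of chart transforms the coordinate vector by the derivative of
  the transition map. Functions that are not smooth near \<open>q\<close> give the default
  \<open>0\<close> on both sides.\<close>

lemma chart_vector_change:
  assumes c: "c \<in> Q" "q \<in> fst c" and d: "d \<in> Q" "q \<in> fst d"
  shows "chart_vector Q d q u =
    chart_vector Q c q (frechet_derivative (snd c \<circ> inv_into (fst d) (snd d)) (at (snd d q)) u)"
proof
  fix f
  let ?t = "snd c \<circ> inv_into (fst d) (snd d)"
  have t: "(?t has_derivative frechet_derivative ?t (at (snd d q))) (at (snd d q))"
    by (rule smooth_on_has_derivative[OF smooth_transition[OF d(1) c(1)]]) (use c d in auto)
  show "chart_vector Q d q u f = chart_vector Q c q (frechet_derivative ?t (at (snd d q)) u) f"
  proof (cases "smooth_near Q q f")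
    case True
    have tq: "?t (snd d q) = snd c q" using c d by simp
    have "((f \<circ> inv_into (fst c) (snd c)) \<circ> ?t has_derivative
       frechet_derivative (f \<circ> inv_into (fst c) (snd c)) (at (snd c q)) \<circ> frechet_derivative ?t (at (snd d q)))
       (at (snd d q))"
      using diff_chain_at[OF t] near_has_derivative[OF True c] tq by metis
    then have "(f \<circ> inv_into (fst d) (snd d) has_derivative
       frechet_derivative (f \<circ> inv_into (fst c) (snd c)) (at (snd c q)) \<circ> frechet_derivative ?t (at (snd d q)))
       (at (snd d q))"
      by (rule has_derivative_transform_within_open[OF _ open_overlap[OF d(1) c(1)]]) (use c d in auto)
    from chart_vectorI[OF True this] chart_vector_apply[OF True] show ?thesis by simp
  qed (simp add: chart_vector_def)
qed

lemma tangent_space_chart: "c \<in> Q \<Longrightarrow> q \<in> fst c \<Longrightarrow> T q = range (chart_vector Q c q)"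
proof -
  assume c: "c \<in> Q" "q \<in> fst c"
  have "v \<in> range (chart_vector Q c q)" if v: "v \<in> T q" for v
  proof -
    obtain d u where d: "d \<in> Q" "q \<in> fst d" "v = chart_vector Q d q u"
      using v unfolding tangent_space_def by blast
    show ?thesis unfolding d(3) chart_vector_change[OF c d(1,2)] by (rule rangeI)
  qed
  then show "T q = range (chart_vector Q c q)"
    unfolding tangent_space_def using c by blast
qed

lemma linear_chart_vector:
  assumes "c \<in> Q" "q \<in> fst c"
  shows "linear (chart_vector Q c q)"
proof
  have lin: "linear (frechet_derivative (f \<circ> inv_into (fst c) (snd c)) (at (snd c q)))" if "smooth_near Q q f" for f
    using near_has_derivative[OF that assms] has_derivative_linear by blast
  show "chart_vector Q c q (u + v) = chart_vector Q c q u + chart_vector Q c q v" for u v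
    using lin by (auto simp: chart_vector_def plus_fun_def linear_add)
  show "chart_vector Q c q (r *\<^sub>R u) = r *\<^sub>R chart_vector Q c q u" for u r
    using lin by (auto simp: chart_vector_def scaleR_fun_def linear_scale)
qed

lemma smooth_near_coordinate: "c \<in> Q \<Longrightarrow> q \<in> fst c \<Longrightarrow> smooth_near Q q (\<lambda>p. snd c p \<bullet> b)"
  by (rule smooth_nearI[OF opn_chart _ smooth_chart_coordinate])

text \<open>Applied to coordinate functions, a tangent vector returns its components. Injectivity of
  \<open>chart_vector\<close>, \<open>tangent_eqI\<close> and \<open>tangent_expand\<close> all rest
  on this.\<close>

lemma chart_vector_coordinate:
  assumes "c \<in> Q" "q \<in> fst c"
  shows "chart_vector Q c q u (\<lambda>p. snd c p \<bullet> b) = u \<bullet> b"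
proof (rule chart_vectorI[OF smooth_near_coordinate[OF assms]])
  have "((\<lambda>x. x \<bullet> b) has_derivative (\<lambda>u. u \<bullet> b)) (at (snd c q))"
    by (auto intro!: derivative_eq_intros)
  then show "((\<lambda>p. snd c p \<bullet> b) \<circ> inv_into (fst c) (snd c) has_derivative (\<lambda>u. u \<bullet> b)) (at (snd c q))"
    by (rule has_derivative_transform_within_open[OF _ open_image[OF assms(1)]]) (use assms in auto)
qed

lemma inj_chart_vector: "c \<in> Q \<Longrightarrow> q \<in> fst c \<Longrightarrow> inj (chart_vector Q c q)"
proof (rule injI)
  fix x y assume c: "c \<in> Q" "q \<in> fst c" and eq: "chart_vector Q c q x = chart_vector Q c q y"
  show "x = y"
  proof (rule euclidean_eqI)
    show "x \<bullet> b = y \<bullet> b" for b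
      using chart_vector_coordinate[OF c, of x b] chart_vector_coordinate[OF c, of y b] eq by simp
  qed
qed

lemma subspace_tangent: "q \<in> points Q \<Longrightarrow> subspace (T q)"
  using chart_ex[of q] linear_subspace_image[OF linear_chart_vector subspace_UNIV] tangent_space_chart
  by auto

lemma tangent_eqI:
  assumes "c \<in> Q" "q \<in> fst c" "v \<in> T q" "w \<in> T q"
    "\<And>b. b \<in> Basis \<Longrightarrow> v (\<lambda>p. snd c p \<bullet> b) = w (\<lambda>p. snd c p \<bullet> b)"
  shows "v = w"
proof -
  obtain x y where v: "v = chart_vector Q c q x" and w: "w = chart_vector Q c q y"
    using assms(3,4) tangent_space_chart[OF assms(1,2)] by auto
  have "x = y"
    by (rule euclidean_eqI) (use assms(5) v w chart_vector_coordinate[OF assms(1,2)] in simp)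
  then show ?thesis by (simp add: v w)
qed

lemma tangent_expand:
  assumes "c \<in> Q" "q \<in> fst c" "v \<in> T q"
  shows "v = (\<Sum>b\<in>Basis. v (\<lambda>p. snd c p \<bullet> b) *\<^sub>R chart_vector Q c q b)"
proof -
  obtain u where u: "v = chart_vector Q c q u" using assms tangent_space_chart by auto
  have "v (\<lambda>p. snd c p \<bullet> b) = u \<bullet> b" for b
    unfolding u by (rule chart_vector_coordinate[OF assms(1,2)])
  moreover have "v = chart_vector Q c q (\<Sum>b\<in>Basis. (u \<bullet> b) *\<^sub>R b)"
    by (simp add: u euclidean_representation)
  ultimately show ?thesis
    using linear_chart_vector[OF assms(1,2)] by (simp add: linear_sum linear_scale)
qed

lemma tangent_local:
  assumes "v \<in> T q" "opn W" "q \<in> W" "\<And>p. p \<in> W \<Longrightarrow> f p = g p"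
  shows "v f = v g"
proof -
  obtain c u where c: "c \<in> Q" "q \<in> fst c" "v = chart_vector Q c q u"
    using assms(1) by (auto simp: tangent_space_def)
  show ?thesis
  proof (cases "smooth_near Q q f")
    case True
    then have g: "smooth_near Q q g" using smooth_near_cong[OF assms(2,3), of f g] assms(4) by blast
    have "(g \<circ> inv_into (fst c) (snd c) has_derivative
     frechet_derivative (f \<circ> inv_into (fst c) (snd c)) (at (snd c q))) (at (snd c q))"
      by (rule has_derivative_transform_within_open[OF near_has_derivative[OF True c(1,2)]
            opn_image[OF assms(2) c(1)]]) (use assms c in auto)
    from chart_vectorI[OF g this] show ?thesis using chart_vector_apply[OF True] c by simp
  next
    \<comment> \<open>Neither function is smooth near \<open>q\<close>, so both values are the
      default \<open>0\<close>.\<close>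
    case False
    then have "\<not> smooth_near Q q g" using smooth_near_cong[OF assms(2,3), of f g] assms(4) by blast
    then show ?thesis using False c by (simp add: chart_vector_def)
  qed
qed

lemma tangent_not_smooth: "v \<in> T q \<Longrightarrow> \<not> smooth_near Q q f \<Longrightarrow> v f = 0"
  by (auto simp: tangent_space_def chart_vector_def)

lemma tangent_points: "v \<in> T q \<Longrightarrow> q \<in> points Q"
  using chart_points unfolding tangent_space_def by blast

lemma tangent_add:
  assumes "v \<in> T q" "smooth_near Q q f" "smooth_near Q q g"
  shows "v (\<lambda>p. f p + g p) = v f + v g"
proof -
  obtain c u where c: "c \<in> Q" "q \<in> fst c" "v = chart_vector Q c q u"
    using assms(1) by (auto simp: tangent_space_def)
  from has_derivative_add[OF near_has_derivative[OF assms(2) c(1,2)] near_has_derivative[OF assms(3) c(1,2)]]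
  show ?thesis using assms c
    by (simp add: chart_vectorI[OF smooth_near_add[OF assms(2,3)]] chart_vector_apply o_def)
qed

lemma tangent_mult:
  assumes "v \<in> T q" "smooth_near Q q f" "smooth_near Q q g"
  shows "v (\<lambda>p. f p * g p) = f q * v g + g q * v f"
proof -
  obtain c u where c: "c \<in> Q" "q \<in> fst c" "v = chart_vector Q c q u"
    using assms(1) by (auto simp: tangent_space_def)
  from has_derivative_mult[OF near_has_derivative[OF assms(2) c(1,2)] near_has_derivative[OF assms(3) c(1,2)]]
  show ?thesis using assms c
    by (simp add: chart_vectorI[OF smooth_near_mult[OF assms(2,3)]] chart_vector_apply o_def mult.commute)
qed

lemma tangent_const: "v \<in> T q \<Longrightarrow> v (\<lambda>p. a) = 0"
proof -
  assume v: "v \<in> T q"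
  then obtain c u where c: "c \<in> Q" "q \<in> fst c" "v = chart_vector Q c q u"
    by (auto simp: tangent_space_def)
  show ?thesis using chart_vectorI[OF smooth_near_const[OF tangent_points[OF v]], of a c "\<lambda>_. 0"] c
    by (simp add: o_def)
qed

lemma tangent_cmult:
  "v \<in> T q \<Longrightarrow> smooth_near Q q f \<Longrightarrow> v (\<lambda>p. a * f p) = a * v f"
  using tangent_mult[of v q "\<lambda>_. a" f] smooth_near_const[OF tangent_points, of v q a] tangent_const[of v q a] by simp

lemma tangent_sum:
  "v \<in> T q \<Longrightarrow> (\<And>i. i \<in> I \<Longrightarrow> smooth_near Q q (f i)) \<Longrightarrow> v (\<lambda>p. \<Sum>i\<in>I. f i p) = (\<Sum>i\<in>I. v (f i))"
proof (induction I rule: infinite_finite_induct)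
  case (insert x F)
  then show ?case using tangent_add[OF insert(4), of "f x" "\<lambda>p. \<Sum>i\<in>F. f i p"]
    by (simp add: smooth_near_sum[OF tangent_points])
qed (auto simp: tangent_const)

lemma tangent_exp:
  assumes "v \<in> T q" "smooth_near Q q f"
  shows "v (\<lambda>p. exp (f p)) = exp (f q) * v f"
proof -
  obtain c u where c: "c \<in> Q" "q \<in> fst c" "v = chart_vector Q c q u"
    using assms(1) by (auto simp: tangent_space_def)
  obtain W where "opn W" "q \<in> W" "smooth_fun Q W f" using assms(2) by (auto simp: smooth_near_def)
  then have n: "smooth_near Q q (\<lambda>p. exp (f p))" by (intro smooth_nearI smooth_fun_exp)
  from has_derivative_exp[OF near_has_derivative[OF assms(2) c(1,2)]]
  show ?thesis using assms c
    by (simp add: chart_vectorI[OF n] chart_vector_apply o_def mult.commute)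
qed

lemma chart_vector_in_T: "c \<in> Q \<Longrightarrow> q \<in> fst c \<Longrightarrow> chart_vector Q c q u \<in> T q"
  unfolding tangent_space_def by blast

end

section \<open>Vector fields and frames\<close>

context smooth_atlas
begin

section \<open>Linear systems with smooth coefficients\<close>

lemma smooth_fun_det:
  assumes "opn W" "\<And>i j. i < n \<Longrightarrow> j < n \<Longrightarrow> smooth_fun Q W (\<lambda>q. a q (i, j))"
  shows "smooth_fun Q W (\<lambda>q. Determinant.det (Matrix.mat n n (a q)))"
proof -
  have "smooth_fun Q W (\<lambda>q. \<Sum>p | p permutes {0..<n}. signof p * (\<Prod>i = 0..<n. a q (i, p i)))"
    by (intro smooth_fun_sum smooth_fun_mult smooth_fun_const smooth_fun_prod assms)
       (auto dest: permutes_in_image)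
  moreover have "(\<Sum>p | p permutes {0..<n}. signof p * (\<Prod>i = 0..<n. a q (i, p i))) =
      Determinant.det (Matrix.mat n n (a q))" for q
    unfolding det_def'[OF mat_carrier]
    by (intro sum.cong refl arg_cong2[where f = "(*)"] prod.cong)
       (auto dest: permutes_in_image)
  ultimately show ?thesis by simp
qed

lemma det_nonzero_iff:
  fixes a :: "nat \<times> nat \<Rightarrow> real"
  shows "Determinant.det (Matrix.mat n n a) \<noteq> 0 \<longleftrightarrow>
    (\<forall>y. (\<forall>i<n. (\<Sum>j<n. a (i, j) * y j) = 0) \<longrightarrow> (\<forall>j<n. y j = 0))"
proof -
  have mult: "vec_index (Matrix.mat n n a *\<^sub>v v) i = (\<Sum>j<n. a (i, j) * vec_index v j)" if "i < n" "v \<in> carrier_vec n" for i v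
    using that by (auto simp: scalar_prod_def atLeast0LessThan)
  show ?thesis
  proof
    assume d: "Determinant.det (Matrix.mat n n a) \<noteq> 0"
    show "\<forall>y. (\<forall>i<n. (\<Sum>j<n. a (i, j) * y j) = 0) \<longrightarrow> (\<forall>j<n. y j = 0)"
    proof (intro allI impI)
      fix y j assume y: "\<forall>i<n. (\<Sum>j<n. a (i, j) * y j) = 0" and j: "j < n"
      let ?v = "Matrix.vec n y"
      have "Matrix.mat n n a *\<^sub>v ?v = 0\<^sub>v n"
        by (rule eq_vecI) (use y mult[of _ ?v] in auto)
      then have "?v = 0\<^sub>v n"
        using d det_0_iff_vec_prod_zero_field[of "Matrix.mat n n a" n] vec_carrier[of n y] mat_carrier[of n n a] by blast
      then show "y j = 0" using j by (metis index_vec index_zero_vec(1))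
    qed
  next
    assume *: "\<forall>y. (\<forall>i<n. (\<Sum>j<n. a (i, j) * y j) = 0) \<longrightarrow> (\<forall>j<n. y j = 0)"
    show "Determinant.det (Matrix.mat n n a) \<noteq> 0"
    proof
      assume "Determinant.det (Matrix.mat n n a) = 0"
      then obtain v where v: "v \<in> carrier_vec n" "v \<noteq> 0\<^sub>v n" "Matrix.mat n n a *\<^sub>v v = 0\<^sub>v n"
        using det_0_iff_vec_prod_zero_field[of "Matrix.mat n n a" n] by auto
      have "\<forall>i<n. (\<Sum>j<n. a (i, j) * vec_index v j) = 0" using mult v by (metis index_zero_vec(1))
      then have "v = 0\<^sub>v n" using * v(1) by (intro eq_vecI) auto
      then show False using v by simp
    qed
  qed
qed

text \<open>By Cramer's rule each unknown is a quotient of determinants, which are polynomials in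
  smooth entries. This is where the smoothness of quasi-velocities, of the Levi-Civita derivative
  and of the maps \<open>riesz\<close> comes from.\<close>

lemma smooth_fun_solve:
  fixes a :: "'q \<Rightarrow> nat \<times> nat \<Rightarrow> real"
  assumes W: "opn W"
    and a: "\<And>i j. i < n \<Longrightarrow> j < n \<Longrightarrow> smooth_fun Q W (\<lambda>q. a q (i, j))"
    and b: "\<And>i. i < n \<Longrightarrow> smooth_fun Q W (b i)"
    and eq: "\<And>q i. q \<in> W \<Longrightarrow> i < n \<Longrightarrow> (\<Sum>j<n. a q (i, j) * x j q) = b i q"
    and inj: "\<And>q y. q \<in> W \<Longrightarrow> \<forall>i<n. (\<Sum>j<n. a q (i, j) * y j) = 0 \<Longrightarrow> \<forall>j<n. y j = 0"
    and k: "k < n"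
  shows "smooth_fun Q W (x k)"
proof -
  let ?A = "\<lambda>q. Matrix.mat n n (a q)"
  \<comment> \<open>The matrix \<open>?A\<close> with column \<open>k\<close> replaced by the
    right-hand side, as in Cramer's rule.\<close>
  let ?B = "\<lambda>q. Matrix.mat n n (\<lambda>ij. if snd ij = k then b (fst ij) q else a q ij)"
  have A: "Determinant.det (?A q) \<noteq> 0" if "q \<in> W" for q
    using det_nonzero_iff inj[OF that] by blast
  have "x k q = Determinant.det (?B q) / Determinant.det (?A q)" if "q \<in> W" for q
  proof -
    let ?x = "Matrix.vec n (\<lambda>j. x j q)"
    have "?A q *\<^sub>v ?x = Matrix.vec n (\<lambda>i. b i q)"
      by (rule eq_vecI) (use eq[OF that] in \<open>auto simp: scalar_prod_def atLeast0LessThan\<close>)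
    then have "replace_col (?A q) (?A q *\<^sub>v ?x) k = ?B q"
      by (intro eq_matI) (auto simp: replace_col_def)
    then show ?thesis
      using cramer_lemma_mat[of "?A q" n ?x k] k A[OF that] by simp
  qed
  moreover have "smooth_fun Q W (\<lambda>q. Determinant.det (?B q))"
  proof (rule smooth_fun_det[OF W])
    fix i j assume "i < n" "j < n"
    then show "smooth_fun Q W (\<lambda>q. if snd (i, j) = k then b (fst (i, j)) q else a q (i, j))"
      using a b by (cases "j = k") auto
  qed
  ultimately show ?thesis
    by (intro smooth_fun_cong[OF W _ smooth_fun_divide[OF W A _ smooth_fun_det[where a = a, OF W a]],
          of "\<lambda>q. Determinant.det (?B q)" "x k"]) auto
qed

subsection \<open>Vector fields\<close>

lemma vf_opn: "vector_field Q U X \<Longrightarrow> opn U"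
  by (simp add: vector_field_def)

lemma vf_T: "vector_field Q U X \<Longrightarrow> q \<in> U \<Longrightarrow> X q \<in> T q"
  by (simp add: vector_field_def)

lemma vf_smooth: "vector_field Q U X \<Longrightarrow> opn V \<Longrightarrow> V \<subseteq> U \<Longrightarrow> smooth_fun Q V f \<Longrightarrow> smooth_fun Q V (\<lambda>q. X q f)"
  by (simp add: vector_field_def)

lemma vf_smooth_same: "vector_field Q U X \<Longrightarrow> smooth_fun Q U f \<Longrightarrow> smooth_fun Q U (\<lambda>q. X q f)"
  using vf_smooth vf_opn by blast

lemma vf_subset: "vector_field Q U X \<Longrightarrow> opn V \<Longrightarrow> V \<subseteq> U \<Longrightarrow> vector_field Q V X"
  unfolding vector_field_def by (metis subset_eq)

lemma vf_smooth_near: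
  assumes "vector_field Q U X" "q \<in> U" "smooth_near Q q f"
  shows "smooth_near Q q (\<lambda>p. X p f)"
proof -
  obtain W where W: "opn W" "q \<in> W" "smooth_fun Q W f" using assms(3) by (auto simp: smooth_near_def)
  have o: "opn (W \<inter> U)" using W(1) vf_opn[OF assms(1)] by blast
  show ?thesis
    by (rule smooth_nearI[OF o _ vf_smooth[OF assms(1) o _ smooth_fun_subset[OF W(3)]]]) (use W assms in auto)
qed

lemma vf_cong:
  assumes "vector_field Q U X" "\<And>q. q \<in> U \<Longrightarrow> X q = Y q"
  shows "vector_field Q U Y"
  unfolding vector_field_def
proof (intro conjI allI impI ballI; (elim conjE)?)
  show "opn U" using assms vf_opn by blast
  show "Y q \<in> T q" if "q \<in> U" for q using assms vf_T that by metis
  fix V f assume V: "opn V" "V \<subseteq> U" "smooth_fun Q V f"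
  show "smooth_fun Q V (\<lambda>q. Y q f)"
    by (rule smooth_fun_cong[OF V(1) _ vf_smooth[OF assms(1) V]]) (use assms(2) V(2) in auto)
qed

lemma vf_local:
  assumes "opn U" "\<And>q. q \<in> U \<Longrightarrow> \<exists>V. q \<in> V \<and> vector_field Q V X"
  shows "vector_field Q U X"
  unfolding vector_field_def
proof (intro conjI allI impI ballI; (elim conjE)?)
  show "X q \<in> T q" if "q \<in> U" for q using assms(2) vf_T that by metis
  fix V f assume V: "opn V" "V \<subseteq> U" "smooth_fun Q V f"
  show "smooth_fun Q V (\<lambda>q. X q f)"
  proof (rule smooth_fun_local)
    fix q assume q: "q \<in> V"
    obtain W where W: "q \<in> W" "vector_field Q W X" using assms(2) q V by blast
    have o: "opn (V \<inter> W)" using V(1) vf_opn[OF W(2)] by blast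
    show "\<exists>V. opn V \<and> q \<in> V \<and> smooth_fun Q V (\<lambda>q. X q f)"
      by (rule exI[of _ "V \<inter> W"])
         (use q W o vf_smooth[OF W(2) o _ smooth_fun_subset[OF V(3)]] in auto)
  qed
qed (rule assms(1))

lemma vf_add:
  assumes "vector_field Q U X" "vector_field Q U Y"
  shows "vector_field Q U (\<lambda>p. X p + Y p)"
  unfolding vector_field_def
proof (intro conjI allI impI ballI; (elim conjE)?)
  show "opn U" using assms vf_opn by blast
  show "X q + Y q \<in> T q" if "q \<in> U" for q
    using vf_T[OF assms(1) that] vf_T[OF assms(2) that] subspace_tangent tangent_points subspace_add by blast
  fix V f assume V: "opn V" "V \<subseteq> U" "smooth_fun Q V f"
  show "smooth_fun Q V (\<lambda>q. (X q + Y q) f)"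
    unfolding plus_fun_def by (intro smooth_fun_add V vf_smooth[OF assms(1)] vf_smooth[OF assms(2)])
qed

lemma vf_scale:
  assumes "vector_field Q U X" "smooth_fun Q U h"
  shows "vector_field Q U (\<lambda>p. h p *\<^sub>R X p)"
  unfolding vector_field_def
proof (intro conjI allI impI ballI; (elim conjE)?)
  show "opn U" using assms vf_opn by blast
  show "h q *\<^sub>R X q \<in> T q" if "q \<in> U" for q
    using vf_T[OF assms(1) that] subspace_tangent tangent_points subspace_scale by blast
  fix V f assume V: "opn V" "V \<subseteq> U" "smooth_fun Q V f"
  show "smooth_fun Q V (\<lambda>q. (h q *\<^sub>R X q) f)"
    unfolding scaleR_fun_def real_scaleR_def
    by (intro smooth_fun_mult V vf_smooth[OF assms(1)] smooth_fun_subset[OF assms(2)])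
qed

lemma T_zero: "q \<in> points Q \<Longrightarrow> 0 \<in> T q"
  using subspace_tangent subspace_0 by blast

lemma T_add: "v \<in> T q \<Longrightarrow> w \<in> T q \<Longrightarrow> v + w \<in> T q"
  using subspace_tangent subspace_add tangent_points by blast

lemma T_scale: "v \<in> T q \<Longrightarrow> r *\<^sub>R v \<in> T q"
  using subspace_tangent subspace_scale tangent_points by blast

lemma T_diff: "v \<in> T q \<Longrightarrow> w \<in> T q \<Longrightarrow> v - w \<in> T q"
  using subspace_tangent subspace_diff tangent_points by blast

lemma T_sum: "q \<in> points Q \<Longrightarrow> (\<And>i. i \<in> I \<Longrightarrow> v i \<in> T q) \<Longrightarrow> (\<Sum>i\<in>I. v i) \<in> T q"
  using subspace_tangent subspace_sum by blast

lemma vf_zero: "opn U \<Longrightarrow> vector_field Q U (\<lambda>p. 0)"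
  unfolding vector_field_def using T_zero opn_points
  by (auto simp: zero_fun_def smooth_fun_const)

lemma vf_sum: "opn U \<Longrightarrow> (\<And>i. i \<in> I \<Longrightarrow> vector_field Q U (X i)) \<Longrightarrow> vector_field Q U (\<lambda>p. \<Sum>i\<in>I. X i p)"
  by (induction I rule: infinite_finite_induct) (auto intro: vf_zero vf_add)

lemma vf_lincomb:
  "opn U \<Longrightarrow> (\<And>i. i \<in> I \<Longrightarrow> vector_field Q U (X i)) \<Longrightarrow> (\<And>i. i \<in> I \<Longrightarrow> smooth_fun Q U (h i)) \<Longrightarrow>
    vector_field Q U (\<lambda>p. \<Sum>i\<in>I. h i p *\<^sub>R X i p)"
  by (intro vf_sum vf_scale)

lemma vf_cscale: "vector_field Q U X \<Longrightarrow> vector_field Q U (\<lambda>p. r *\<^sub>R X p)"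
  using vf_scale[OF _ smooth_fun_const] vf_opn by blast

lemma vf_diff: "vector_field Q U X \<Longrightarrow> vector_field Q U Y \<Longrightarrow> vector_field Q U (\<lambda>p. X p - Y p)"
  using vf_add[OF _ vf_cscale[of U Y "-1"], of X] by simp

lemma chart_derivative_on:
  assumes "c \<in> Q" "W \<subseteq> fst c" "opn W" "smooth_fun Q W f" "p \<in> W"
  shows "chart_vector Q c p u f = frechet_derivative (f \<circ> inv_into (fst c) (snd c)) (at (snd c p)) u"
  using chart_vector_apply smooth_nearI assms by blast

lemma vf_chart:
  assumes c: "c \<in> Q"
  shows "vector_field Q (fst c) (\<lambda>p. chart_vector Q c p u)"
  unfolding vector_field_def
proof (intro conjI allI impI ballI; (elim conjE)?)
  show "opn (fst c)" using c by (rule opn_chart)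
  show "chart_vector Q c q u \<in> T q" if "q \<in> fst c" for q using c that by (rule chart_vector_in_T)
  fix V f assume V: "opn V" "V \<subseteq> fst c" "smooth_fun Q V f"
  have im: "snd c ` (fst c \<inter> V) = snd c ` V" using V(2) by (auto simp: Int_absorb1)
  show "smooth_fun Q V (\<lambda>q. chart_vector Q c q u f)"
  proof (rule smooth_fun_chartI[OF c V(2,1)])
    have "smooth_on (snd c ` V) (\<lambda>x. frechet_derivative (f \<circ> inv_into (fst c) (snd c)) (at x) u)"
      using smooth_on_frechet_derivative smooth_funD[OF V(3) c] unfolding im by blast
    then show "smooth_on (snd c ` V) ((\<lambda>q. chart_vector Q c q u f) \<circ> inv_into (fst c) (snd c))"
      by (rule smooth_on_cong[rotated 2])
         (use opn_image[OF V(1) c] im c V chart_derivative_on[OF c V(2,1,3)] in auto)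
  qed
qed

lemma chart_expand_field:
  assumes c: "c \<in> Q" and X: "vector_field Q U X" and p: "p \<in> U" "p \<in> fst c"
  shows "X p = (\<Sum>b\<in>Basis. X p (\<lambda>p. snd c p \<bullet> b) *\<^sub>R chart_vector Q c p b)"
  using tangent_expand c p vf_T[OF X] by blast

subsection \<open>The Lie bracket\<close>

text \<open>Coordinate fields commute because, read in the chart, this is the symmetry of second
  derivatives.\<close>

lemma chart_fields_commute:
  assumes c: "c \<in> Q" "q \<in> fst c" and f: "smooth_near Q q f"
  shows "chart_vector Q c q a (\<lambda>p. chart_vector Q c p b f) = chart_vector Q c q b (\<lambda>p. chart_vector Q c p a f)"
proof -
  obtain W0 where W0: "opn W0" "q \<in> W0" "smooth_fun Q W0 f" using f by (auto simp: smooth_near_def)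
  define W where "W = fst c \<inter> W0"
  have W: "opn W" "q \<in> W" "W \<subseteq> fst c" "smooth_fun Q W f"
    using W0 c opn_chart[OF c(1)] smooth_fun_subset by (auto simp: W_def)
  let ?f = "f \<circ> inv_into (fst c) (snd c)"
  have im: "fst c \<inter> W = W" using W(3) by blast
  have o: "open (snd c ` W)" and s: "smooth_on (snd c ` W) ?f" and q: "snd c q \<in> snd c ` W"
    using opn_image[OF W(1) c(1)] smooth_funD[OF W(4) c(1)] W(2) unfolding im by blast+
  have "chart_vector Q c q a (\<lambda>p. chart_vector Q c p b f) =
      frechet_derivative (\<lambda>x. frechet_derivative ?f (at x) b) (at (snd c q)) a" for a b
  proof (rule chart_vectorI)
    show "smooth_near Q q (\<lambda>p. chart_vector Q c p b f)"
      using vf_smooth_near[OF vf_chart[OF c(1)] c(2) f] .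
    show "((\<lambda>p. chart_vector Q c p b f) \<circ> inv_into (fst c) (snd c) has_derivative
      frechet_derivative (\<lambda>x. frechet_derivative ?f (at x) b) (at (snd c q))) (at (snd c q))"
      by (rule has_derivative_transform_within_open[OF
            smooth_on_has_derivative[OF smooth_on_frechet_derivative[OF s] q] o q])
         (use c W chart_derivative_on[OF c(1) W(3,1,4)] in auto)
  qed
  then show ?thesis using second_derivative_symmetric[OF o s q, of b a] by simp
qed

text \<open>The commutator looks like a second-order operator. Its second-order part is symmetric in
  the two fields and cancels, which leaves a tangent vector given by its components in the
  chart.\<close>

lemma lie_bracket_expand:
  assumes X: "vector_field Q U X" and Y: "vector_field Q U Y" and q: "q \<in> U" and c: "c \<in> Q" "q \<in> fst c"
  shows "lie_bracket Q X Y q =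
    (\<Sum>b\<in>Basis. (X q (\<lambda>p. Y p (\<lambda>p. snd c p \<bullet> b)) - Y q (\<lambda>p. X p (\<lambda>p. snd c p \<bullet> b))) *\<^sub>R chart_vector Q c q b)"
proof
  fix f
  let ?x = "\<lambda>b p. snd c p \<bullet> b"
  let ?E = "\<lambda>b p. chart_vector Q c p b"
  show "lie_bracket Q X Y q f = (\<Sum>b\<in>Basis. (X q (\<lambda>p. Y p (?x b)) - Y q (\<lambda>p. X p (?x b))) *\<^sub>R ?E b q) f"
  proof (cases "smooth_near Q q f")
    case True
    have qp: "q \<in> points Q" using c chart_points by blast
    have Ef: "smooth_near Q q (\<lambda>p. ?E b p f)" for b
      using vf_smooth_near[OF vf_chart[OF c(1)] c(2) True] .
    have o: "opn (U \<inter> fst c)" using vf_opn[OF X] opn_chart[OF c(1)] by blast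
    \<comment> \<open>The first sum is the first-order part; the double sum is the second-order
      part, which the exchange of \<open>X\<close> and \<open>Y\<close> leaves unchanged.\<close>
    have main: "X q (\<lambda>p. Y p f) = (\<Sum>b\<in>Basis. X q (\<lambda>p. Y p (?x b)) * ?E b q f) +
       (\<Sum>b\<in>Basis. \<Sum>a\<in>Basis. Y q (?x b) * X q (?x a) * ?E a q (\<lambda>p. ?E b p f))"
      if X: "vector_field Q U X" and Y: "vector_field Q U Y" for X Y
    proof -
      have Yx: "smooth_near Q q (\<lambda>p. Y p (?x b))" for b
        using vf_smooth_near[OF Y q smooth_near_coordinate[OF c]] .
      have XE: "X q (\<lambda>p. ?E b p f) = (\<Sum>a\<in>Basis. X q (?x a) * ?E a q (\<lambda>p. ?E b p f))" for b
        using arg_cong[OF chart_expand_field[OF c(1) X q c(2)], of "\<lambda>v. v (\<lambda>p. ?E b p f)"]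
        by (simp add: sum_fun_apply scaleR_fun_def)
      have "Y p f = (\<Sum>b\<in>Basis. Y p (?x b) * ?E b p f)" if "p \<in> U \<inter> fst c" for p
        using arg_cong[OF chart_expand_field[OF c(1) Y, of p], of "\<lambda>v. v f"] that
        by (simp add: sum_fun_apply scaleR_fun_def)
      then have "X q (\<lambda>p. Y p f) = X q (\<lambda>p. \<Sum>b\<in>Basis. Y p (?x b) * ?E b p f)"
        by (intro tangent_local[OF vf_T[OF X q] o]) (use q c in auto)
      also have "\<dots> = (\<Sum>b\<in>Basis. Y q (?x b) * X q (\<lambda>p. ?E b p f) + ?E b q f * X q (\<lambda>p. Y p (?x b)))"
        by (subst tangent_sum[OF vf_T[OF X q]])
           (auto intro!: sum.cong smooth_near_mult Yx Ef tangent_mult[OF vf_T[OF X q]])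
      also have "\<dots> = (\<Sum>b\<in>Basis. X q (\<lambda>p. Y p (?x b)) * ?E b q f +
          Y q (?x b) * (\<Sum>a\<in>Basis. X q (?x a) * ?E a q (\<lambda>p. ?E b p f)))"
        using XE by (intro sum.cong) simp_all
      finally show ?thesis
        by (simp add: sum.distrib sum_distrib_left mult.assoc)
    qed
    have "(\<Sum>b\<in>Basis. \<Sum>a\<in>Basis. Y q (?x b) * X q (?x a) * ?E a q (\<lambda>p. ?E b p f)) =
          (\<Sum>a\<in>Basis. \<Sum>b\<in>Basis. Y q (?x b) * X q (?x a) * ?E b q (\<lambda>p. ?E a p f))"
      using chart_fields_commute[OF c True] by (subst sum.swap) simp
    then have "(\<Sum>b\<in>Basis. \<Sum>a\<in>Basis. Y q (?x b) * X q (?x a) * ?E a q (\<lambda>p. ?E b p f)) =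
          (\<Sum>b\<in>Basis. \<Sum>a\<in>Basis. X q (?x b) * Y q (?x a) * ?E a q (\<lambda>p. ?E b p f))"
      by (simp add: mult.commute mult.left_commute)
    then show ?thesis
      using True main[OF X Y] main[OF Y X]
      by (simp add: lie_bracket_def sum_fun_apply scaleR_fun_def left_diff_distrib sum_subtractf)
  next
    case False
    then show ?thesis
      by (simp add: lie_bracket_def sum_fun_apply scaleR_fun_def chart_vector_def)
  qed
qed

lemma vf_bracket:
  assumes X: "vector_field Q U X" and Y: "vector_field Q U Y"
  shows "vector_field Q U (lie_bracket Q X Y)"
proof (rule vf_local[OF vf_opn[OF X]])
  fix q assume q: "q \<in> U"
  obtain c where c: "c \<in> Q" "q \<in> fst c" using chart_ex opn_points[OF vf_opn[OF X] q] by blast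
  let ?V = "U \<inter> fst c"
  have o: "opn ?V" using vf_opn[OF X] opn_chart[OF c(1)] by blast
  have X': "vector_field Q ?V X" and Y': "vector_field Q ?V Y" using X Y vf_subset o by blast+
  have s: "smooth_fun Q ?V (\<lambda>p. snd c p \<bullet> b)" for b
    using smooth_chart_coordinate[OF c(1)] smooth_fun_subset by blast
  have "vector_field Q ?V (\<lambda>q. \<Sum>b\<in>Basis. (X q (\<lambda>p. Y p (\<lambda>p. snd c p \<bullet> b)) - Y q (\<lambda>p. X p (\<lambda>p. snd c p \<bullet> b))) *\<^sub>R chart_vector Q c q b)"
    by (intro vf_lincomb o smooth_fun_diff vf_smooth_same[OF X'] vf_smooth_same[OF Y'] s
        vf_subset[OF vf_chart[OF c(1)] o]) auto
  then have "vector_field Q ?V (lie_bracket Q X Y)"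
    by (rule vf_cong) (use lie_bracket_expand[OF X Y _ c(1)] in auto)
  then show "\<exists>V. q \<in> V \<and> vector_field Q V (lie_bracket Q X Y)" using q c by blast
qed

lemma lie_bracket_antisym: "lie_bracket Q X Y q = - lie_bracket Q Y X q"
  by (auto simp: lie_bracket_def fun_eq_iff)

lemma lie_bracket_local:
  assumes X: "vector_field Q U X" and Y: "vector_field Q U Y" and V: "opn V" "q \<in> V" "q \<in> U"
    and eq: "\<And>p. p \<in> V \<Longrightarrow> X p = X' p" "\<And>p. p \<in> V \<Longrightarrow> Y p = Y' p"
  shows "lie_bracket Q X Y q = lie_bracket Q X' Y' q"
proof
  fix f
  have "X q (\<lambda>p. Y p f) = X q (\<lambda>p. Y' p f)" "Y q (\<lambda>p. X p f) = Y q (\<lambda>p. X' p f)"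
    by (rule tangent_local[OF vf_T[OF X V(3)] V(1,2)], use eq in simp)
       (rule tangent_local[OF vf_T[OF Y V(3)] V(1,2)], use eq in simp)
  then show "lie_bracket Q X Y q f = lie_bracket Q X' Y' q f"
    using eq[OF V(2)] by (simp add: lie_bracket_def)
qed

lemma lie_bracket_add:
  assumes X: "vector_field Q U X" and X': "vector_field Q U X'" and Y: "vector_field Q U Y" and q: "q \<in> U"
  shows "lie_bracket Q (\<lambda>p. X p + X' p) Y q = lie_bracket Q X Y q + lie_bracket Q X' Y q"
proof
  fix f
  show "lie_bracket Q (\<lambda>p. X p + X' p) Y q f = (lie_bracket Q X Y q + lie_bracket Q X' Y q) f"
    using tangent_add[OF vf_T[OF Y q] vf_smooth_near[OF X q] vf_smooth_near[OF X' q], of f f]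
    by (simp add: lie_bracket_def plus_fun_def)
qed

lemma lie_bracket_scale:
  assumes X: "vector_field Q U X" and Y: "vector_field Q U Y" and h: "smooth_fun Q U h" and q: "q \<in> U"
  shows "lie_bracket Q (\<lambda>p. h p *\<^sub>R X p) Y q = h q *\<^sub>R lie_bracket Q X Y q - Y q h *\<^sub>R X q"
proof
  fix f
  have h': "smooth_near Q q h" using h q vf_opn[OF X] smooth_nearI by blast
  show "lie_bracket Q (\<lambda>p. h p *\<^sub>R X p) Y q f = (h q *\<^sub>R lie_bracket Q X Y q - Y q h *\<^sub>R X q) f"
  proof (cases "smooth_near Q q f")
    case True
    then show ?thesis
      using tangent_mult[OF vf_T[OF Y q] h' vf_smooth_near[OF X q True]]
      by (simp add: lie_bracket_def plus_fun_def scaleR_fun_def fun_diff_def algebra_simps)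
  next
    case False
    then show ?thesis
      by (simp add: lie_bracket_def scaleR_fun_def fun_diff_def tangent_not_smooth[OF vf_T[OF X q]])
  qed
qed

subsection \<open>Quasi-velocities\<close>

lemma lf_opn: "local_frame Q U X \<Longrightarrow> opn U"
  and lf_vf: "local_frame Q U X \<Longrightarrow> \<alpha> < DIM('e) \<Longrightarrow> vector_field Q U (X \<alpha>)"
  by (auto simp: local_frame_def)

lemma lf_T: "local_frame Q U X \<Longrightarrow> \<alpha> < DIM('e) \<Longrightarrow> q \<in> U \<Longrightarrow> X \<alpha> q \<in> T q"
  using lf_vf vf_T by blast

lemma lf_basis:
  assumes "local_frame Q U X" "q \<in> U"
  shows "inj_on (\<lambda>\<alpha>. X \<alpha> q) {..<DIM('e)}" "independent ((\<lambda>\<alpha>. X \<alpha> q) ` {..<DIM('e)})"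
    "span ((\<lambda>\<alpha>. X \<alpha> q) ` {..<DIM('e)}) = T q"
  using assms by (auto simp: local_frame_def basis_of_def)

lemma qv_expand:
  assumes "local_frame Q U X" "q \<in> U" "v \<in> T q"
  shows "(\<Sum>\<gamma><DIM('e). quasi_velocity DIM('e) X \<gamma> (q, v) *\<^sub>R X \<gamma> q) = v"
proof -
  note B = lf_basis[OF assms(1,2)]
  have "(\<Sum>x\<in>(\<lambda>\<alpha>. X \<alpha> q) ` {..<DIM('e)}. representation ((\<lambda>\<alpha>. X \<alpha> q) ` {..<DIM('e)}) v x *\<^sub>R x) = v"
    using real_vector.sum_representation_eq[OF B(2)] B(3) assms(3) by auto
  then show ?thesis unfolding sum.reindex[OF B(1)] by (simp add: quasi_velocity_def)
qed

lemma frame_independent: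
  assumes X: "local_frame Q U X" "q \<in> U" and eq: "(\<Sum>\<gamma><DIM('e). c \<gamma> *\<^sub>R X \<gamma> q) = (\<Sum>\<gamma><DIM('e). d \<gamma> *\<^sub>R X \<gamma> q)"
    and \<gamma>: "\<gamma> < DIM('e)"
  shows "c \<gamma> = d \<gamma>"
proof -
  note B = lf_basis[OF X]
  let ?i = "the_inv_into {..<DIM('e)} (\<lambda>\<alpha>. X \<alpha> q)"
  have i: "?i (X \<alpha> q) = \<alpha>" if "\<alpha> < DIM('e)" for \<alpha>
    using the_inv_into_f_f[OF B(1)] that by auto
  have "(\<Sum>\<gamma><DIM('e). (c \<gamma> - d \<gamma>) *\<^sub>R X \<gamma> q) = 0"
    using eq by (simp add: scaleR_left_diff_distrib sum_subtractf)
  then have "(\<Sum>x\<in>(\<lambda>\<alpha>. X \<alpha> q) ` {..<DIM('e)}. (c (?i x) - d (?i x)) *\<^sub>R x) = 0"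
    unfolding sum.reindex[OF B(1)] using i by simp
  then have "c (?i (X \<gamma> q)) - d (?i (X \<gamma> q)) = 0"
    using real_vector.independentD[OF B(2), of "(\<lambda>\<alpha>. X \<alpha> q) ` {..<DIM('e)}" "\<lambda>x. c (?i x) - d (?i x)" "X \<gamma> q"] \<gamma>
    by auto
  then show ?thesis using i[OF \<gamma>] by simp
qed

lemma qv_sum:
  assumes X: "local_frame Q U X" "q \<in> U" and \<gamma>: "\<gamma> < DIM('e)"
  shows "quasi_velocity DIM('e) X \<gamma> (q, \<Sum>\<alpha><DIM('e). c \<alpha> *\<^sub>R X \<alpha> q) = c \<gamma>"
proof -
  have "(\<Sum>\<alpha><DIM('e). c \<alpha> *\<^sub>R X \<alpha> q) \<in> T q"
    using X lf_opn opn_points lf_T by (intro T_sum T_scale) auto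
  from frame_independent[OF X qv_expand[OF X this] \<gamma>] show ?thesis .
qed

lemma qv_add:
  assumes X: "local_frame Q U X" "q \<in> U" and \<gamma>: "\<gamma> < DIM('e)" and v: "v \<in> T q" "w \<in> T q"
  shows "quasi_velocity DIM('e) X \<gamma> (q, v + w) = quasi_velocity DIM('e) X \<gamma> (q, v) + quasi_velocity DIM('e) X \<gamma> (q, w)"
proof -
  have "v + w = (\<Sum>\<alpha><DIM('e). (quasi_velocity DIM('e) X \<alpha> (q, v) + quasi_velocity DIM('e) X \<alpha> (q, w)) *\<^sub>R X \<alpha> q)"
    by (simp add: scaleR_left_distrib sum.distrib qv_expand[OF X] v)
  then show ?thesis using qv_sum[OF X \<gamma>, of "\<lambda>\<alpha>. quasi_velocity DIM('e) X \<alpha> (q, v) + quasi_velocity DIM('e) X \<alpha> (q, w)"] by simp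
qed

lemma qv_scale:
  assumes X: "local_frame Q U X" "q \<in> U" and \<gamma>: "\<gamma> < DIM('e)" and v: "v \<in> T q"
  shows "quasi_velocity DIM('e) X \<gamma> (q, r *\<^sub>R v) = r * quasi_velocity DIM('e) X \<gamma> (q, v)"
proof -
  have "r *\<^sub>R v = (\<Sum>\<alpha><DIM('e). (r * quasi_velocity DIM('e) X \<alpha> (q, v)) *\<^sub>R X \<alpha> q)"
    using qv_expand[OF X v] by (simp add: scaleR_sum_right[symmetric] flip: scaleR_scaleR)
  then show ?thesis using qv_sum[OF X \<gamma>, of "\<lambda>\<alpha>. r * quasi_velocity DIM('e) X \<alpha> (q, v)"] by simp
qed

lemma qv_eqI:
  assumes X: "local_frame Q U X" "q \<in> U" and v: "v \<in> T q" "w \<in> T q"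
    and eq: "\<And>\<gamma>. \<gamma> < DIM('e) \<Longrightarrow> quasi_velocity DIM('e) X \<gamma> (q, v) = quasi_velocity DIM('e) X \<gamma> (q, w)"
  shows "v = w"
proof -
  have "(\<Sum>\<gamma><DIM('e). quasi_velocity DIM('e) X \<gamma> (q, v) *\<^sub>R X \<gamma> q) = (\<Sum>\<gamma><DIM('e). quasi_velocity DIM('e) X \<gamma> (q, w) *\<^sub>R X \<gamma> q)"
    by (rule sum.cong) (simp_all add: eq)
  then show ?thesis unfolding qv_expand[OF X v(1)] qv_expand[OF X v(2)] .
qed

text \<open>Independence of the frame, phrased as the trivial kernel of its matrix of coordinate
  components. This is the form that \<open>smooth_fun_solve\<close> asks for.\<close>

lemma frame_coordinate_kernel:
  assumes X: "local_frame Q U X" "q \<in> U" and c: "c \<in> Q" "q \<in> fst c"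
    and 0: "\<And>b. b \<in> Basis \<Longrightarrow> (\<Sum>\<gamma><DIM('e). X \<gamma> q (\<lambda>p. snd c p \<bullet> b) * y \<gamma>) = 0" and \<gamma>: "\<gamma> < DIM('e)"
  shows "y \<gamma> = 0"
proof -
  have p: "q \<in> points Q" using c chart_points by blast
  have "(\<Sum>\<gamma><DIM('e). y \<gamma> *\<^sub>R X \<gamma> q) = 0"
    by (rule tangent_eqI[OF c])
       (use 0 in \<open>auto intro!: T_sum T_scale T_zero p lf_T[OF X(1) _ X(2)]
          simp: sum_fun_apply mult.commute scaleR_fun_def[THEN fun_cong, of _ _ "\<lambda>p. snd c p \<bullet> _"]\<close>)
  then show ?thesis using frame_independent[OF X, of y "\<lambda>_. 0"] \<gamma> by simp
qed

lemma ex_basis_enum: "\<exists>\<beta>. bij_betw \<beta> {..<DIM('e)} (Basis :: 'e set)"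
  using ex_bij_betw_nat_finite[of "Basis :: 'e set"] by (auto simp: atLeast0LessThan)

text \<open>The components of \<open>Z\<close> solve the linear system obtained by applying the
  frame expansion of \<open>Z\<close> to the coordinate functions.\<close>

lemma smooth_qv_field:
  assumes X: "local_frame Q U X" and Z: "vector_field Q V Z" and V: "V \<subseteq> U" and \<gamma>: "\<gamma> < DIM('e)"
  shows "smooth_fun Q V (\<lambda>p. quasi_velocity DIM('e) X \<gamma> (p, Z p))"
proof (rule smooth_fun_local)
  fix q assume q: "q \<in> V"
  obtain \<beta> where \<beta>: "bij_betw \<beta> {..<DIM('e)} (Basis :: 'e set)" using ex_basis_enum by blast
  obtain c where c: "c \<in> Q" "q \<in> fst c" using chart_ex opn_points[OF vf_opn[OF Z] q] by blast
  let ?W = "V \<inter> fst c"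
  have o: "opn ?W" using vf_opn[OF Z] opn_chart[OF c(1)] by blast
  have s: "smooth_fun Q ?W (\<lambda>p. snd c p \<bullet> b)" for b
    using smooth_chart_coordinate[OF c(1)] smooth_fun_subset by blast
  let ?x = "\<lambda>i p. snd c p \<bullet> \<beta> i"
  have "smooth_fun Q ?W (\<lambda>p. quasi_velocity DIM('e) X \<gamma> (p, Z p))"
  proof (rule smooth_fun_solve[where a = "\<lambda>p (i, j). X j p (?x i)" and b = "\<lambda>i p. Z p (?x i)"
        and x = "\<lambda>j p. quasi_velocity DIM('e) X j (p, Z p)", OF o _ _ _ _ \<gamma>])
    show "smooth_fun Q ?W (\<lambda>p. case (i, j) of (i, j) \<Rightarrow> X j p (?x i))" if "j < DIM('e)" for i j
      using vf_smooth[OF lf_vf[OF X that] o _ s] V by auto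
    show "smooth_fun Q ?W (\<lambda>p. Z p (?x i))" for i
      using vf_smooth[OF Z o _ s] by auto
    show "(\<Sum>j<DIM('e). (case (i, j) of (i, j) \<Rightarrow> X j p (?x i)) * quasi_velocity DIM('e) X j (p, Z p)) = Z p (?x i)"
      if "p \<in> ?W" for p i
    proof -
      have "p \<in> U" "Z p \<in> T p" using that V vf_T[OF Z] by auto
      from arg_cong[OF qv_expand[OF X this], of "\<lambda>v. v (?x i)"] show ?thesis
        by (simp add: sum_fun_apply scaleR_fun_def mult.commute)
    qed
    show "\<forall>j<DIM('e). y j = 0"
      if p: "p \<in> ?W" and y: "\<forall>i<DIM('e). (\<Sum>j<DIM('e). (case (i, j) of (i, j) \<Rightarrow> X j p (?x i)) * y j) = 0" for p y
    proof (intro allI impI)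
      fix j assume j: "j < DIM('e)"
      have "(\<Sum>\<gamma><DIM('e). X \<gamma> p (\<lambda>p. snd c p \<bullet> b) * y \<gamma>) = 0" if "b \<in> Basis" for b
      proof -
        have "b \<in> \<beta> ` {..<DIM('e)}" using bij_betw_imp_surj_on[OF \<beta>] that by simp
        then obtain i where "i < DIM('e)" "b = \<beta> i" by auto
        then show ?thesis using y by auto
      qed
      then show "y j = 0" using frame_coordinate_kernel[OF X _ c(1), of p y j] p j V by auto
    qed
  qed
  then show "\<exists>V. opn V \<and> q \<in> V \<and> smooth_fun Q V (\<lambda>p. quasi_velocity DIM('e) X \<gamma> (p, Z p))" using o q c by blast
qed

lemma chart_local_frame:
  assumes c: "c \<in> Q"
  shows "\<exists>\<beta>. bij_betw \<beta> {..<DIM('e)} (Basis :: 'e set) \<and>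
    local_frame Q (fst c) (\<lambda>i p. chart_vector Q c p (\<beta> i))"
proof -
  obtain \<beta> where \<beta>: "bij_betw \<beta> {..<DIM('e)} (Basis :: 'e set)" using ex_basis_enum by blast
  have "basis_of {..<DIM('e)} (\<lambda>i. chart_vector Q c q (\<beta> i)) (T q)" if q: "q \<in> fst c" for q
  proof -
    note lin = linear_chart_vector[OF c q] and inj = inj_chart_vector[OF c q]
    have im: "(\<lambda>i. chart_vector Q c q (\<beta> i)) ` {..<DIM('e)} = chart_vector Q c q ` Basis"
      using bij_betw_imp_surj_on[OF \<beta>] by (simp add: image_image[symmetric])
    have "inj_on (\<lambda>i. chart_vector Q c q (\<beta> i)) {..<DIM('e)}"
      using bij_betw_imp_inj_on[OF \<beta>] inj by (auto simp: inj_on_def)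
    moreover have "independent (chart_vector Q c q ` Basis)"
      using linear_independent_injective_image[OF lin independent_Basis] inj by (simp add: inj_on_subset)
    moreover have "span (chart_vector Q c q ` Basis) = T q"
      by (simp add: linear_span_image[OF lin] tangent_space_chart[OF c q])
    ultimately show ?thesis unfolding basis_of_def im by blast
  qed
  then have "local_frame Q (fst c) (\<lambda>i p. chart_vector Q c p (\<beta> i))"
    unfolding local_frame_def using opn_chart[OF c] vf_chart[OF c] by blast
  then show ?thesis using \<beta> by blast
qed

lemma local_frame_ex:
  assumes "q \<in> points Q"
  obtains U X where "local_frame Q U X" "q \<in> U"
  using chart_ex[OF assms] chart_local_frame by blast

end

section \<open>The tangent bundle\<close>

lemma smooth_on_fst: "open S \<Longrightarrow> smooth_on S fst"
  using smooth_on_bounded_linear[OF bounded_linear_fst _ smooth_on_id] .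

lemma smooth_on_snd: "open S \<Longrightarrow> smooth_on S snd"
  using smooth_on_bounded_linear[OF bounded_linear_snd _ smooth_on_id] .

text \<open>\<open>smooth_on\<close> gives smoothness in the base point for each fixed direction.
  Linearity in the direction, expanded over \<open>Basis\<close>, upgrades this to joint smoothness,
  which charts and functions on \<open>TQ\<close> require.\<close>

lemma smooth_on_derivative_pair:
  fixes h :: "'e::euclidean_space \<Rightarrow> 'b::real_normed_vector"
  assumes S: "open S" and h: "smooth_on S h"
  shows "smooth_on (S \<times> UNIV) (\<lambda>z::'e \<times> 'e. frechet_derivative h (at (fst z)) (snd z))"
proof -
  have o: "open (S \<times> (UNIV :: 'e set))" using S by (simp add: open_Times)
  note fst = smooth_on_fst[OF o] and snd = smooth_on_snd[OF o]
  have "smooth_on (S \<times> (UNIV :: 'e set)) ((\<lambda>x. frechet_derivative h (at x) b) \<circ> fst)" for b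
    by (rule smooth_on_compose[OF o S _ fst smooth_on_frechet_derivative[OF h]]) auto
  then have "smooth_on (S \<times> UNIV) (\<lambda>z::'e \<times> 'e. \<Sum>b\<in>Basis. (snd z \<bullet> b) *\<^sub>R frechet_derivative h (at (fst z)) b)"
    by (intro smooth_on_sum[OF o] smooth_on_scaleR[OF o]
        smooth_on_bounded_linear[OF bounded_linear_inner_left o snd]) (simp add: o_def)
  then show ?thesis
  proof (rule smooth_on_cong[OF o, rotated])
    fix z :: "'e \<times> 'e" assume "z \<in> S \<times> UNIV"
    then have lin: "linear (frechet_derivative h (at (fst z)))"
      by (intro has_derivative_linear[OF smooth_on_has_derivative[OF h]]) auto
    have "frechet_derivative h (at (fst z)) (\<Sum>b\<in>Basis. (snd z \<bullet> b) *\<^sub>R b) =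
        (\<Sum>b\<in>Basis. (snd z \<bullet> b) *\<^sub>R frechet_derivative h (at (fst z)) b)"
      by (simp only: linear_sum[OF lin] linear_scale[OF lin])
    then show "(\<Sum>b\<in>Basis. (snd z \<bullet> b) *\<^sub>R frechet_derivative h (at (fst z)) b) =
        frechet_derivative h (at (fst z)) (snd z)"
      by (simp add: euclidean_representation)
  qed
qed

definition tchart :: "('q, 'e::euclidean_space) atlas \<Rightarrow> 'q set \<times> ('q \<Rightarrow> 'e) \<Rightarrow>
    ('q \<times> 'q tvec) set \<times> ('q \<times> 'q tvec \<Rightarrow> 'e \<times> 'e)" where
  "tchart Q c = (Sigma (fst c) (tangent_space Q),
     \<lambda>w. (snd c (fst w), \<Sum>b\<in>Basis. snd w (\<lambda>p. snd c p \<bullet> b) *\<^sub>R b))"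

lemma fst_tchart: "fst (tchart Q c) = Sigma (fst c) (tangent_space Q)"
  by (simp add: tchart_def)

lemma tangent_bundle_eq: "tangent_bundle Q = tchart Q ` Q"
  unfolding tangent_bundle_def tchart_def by (intro image_cong refl) (auto simp: case_prod_beta fun_eq_iff)

context smooth_atlas
begin

lemma points_tangent_bundle: "points (tangent_bundle Q) = Sigma (points Q) T"
  by (fastforce simp: points_eq tangent_bundle_eq points_def fst_tchart case_prod_beta)

definition coord :: "'q set \<times> ('q \<Rightarrow> 'e) \<Rightarrow> 'q tvec \<Rightarrow> 'e" where
  "coord c v = (\<Sum>b\<in>Basis. v (\<lambda>p. snd c p \<bullet> b) *\<^sub>R b)"

lemma snd_tchart: "snd (tchart Q c) (q, v) = (snd c q, coord c v)"
  by (simp add: tchart_def coord_def)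

lemma coord_inner: "b \<in> Basis \<Longrightarrow> coord c v \<bullet> b = v (\<lambda>p. snd c p \<bullet> b)"
  by (simp add: coord_def)

lemma coord_chart_vector: "c \<in> Q \<Longrightarrow> q \<in> fst c \<Longrightarrow> coord c (chart_vector Q c q u) = u"
  by (rule euclidean_eqI) (simp add: coord_inner chart_vector_coordinate)

lemma chart_vector_coord: "c \<in> Q \<Longrightarrow> q \<in> fst c \<Longrightarrow> v \<in> T q \<Longrightarrow> chart_vector Q c q (coord c v) = v"
  using tangent_space_chart coord_chart_vector by (metis (no_types, lifting) imageE)

lemma coord_add: "coord c (v + w) = coord c v + coord c w"
  by (simp add: coord_def plus_fun_def scaleR_left_distrib sum.distrib)

lemma coord_scale: "coord c (r *\<^sub>R v) = r *\<^sub>R coord c v"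
  by (simp add: coord_def scaleR_fun_def scaleR_sum_right)

lemma tchart_image: "c \<in> Q \<Longrightarrow> snd (tchart Q c) ` (fst (tchart Q c) \<inter> Sigma W T) = (snd c ` (fst c \<inter> W)) \<times> UNIV"
proof (intro equalityI subsetI)
  fix z :: "'e \<times> 'e" assume c: "c \<in> Q" and "z \<in> (snd c ` (fst c \<inter> W)) \<times> UNIV"
  then obtain q where q: "q \<in> fst c" "q \<in> W" "fst z = snd c q" by force
  have "(q, chart_vector Q c q (snd z)) \<in> fst (tchart Q c) \<inter> Sigma W T"
    using q c chart_vector_in_T by (simp add: fst_tchart)
  moreover have "z = snd (tchart Q c) (q, chart_vector Q c q (snd z))"
    using q c by (simp add: snd_tchart coord_chart_vector prod_eq_iff)
  ultimately show "z \<in> snd (tchart Q c) ` (fst (tchart Q c) \<inter> Sigma W T)" by (rule rev_image_eqI)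
qed (auto simp: fst_tchart snd_tchart)

lemma inj_tchart:
  assumes "c \<in> Q"
  shows "inj_on (snd (tchart Q c)) (fst (tchart Q c))"
proof (rule inj_onI)
  fix w w' assume w: "w \<in> fst (tchart Q c)" "w' \<in> fst (tchart Q c)" and eq: "snd (tchart Q c) w = snd (tchart Q c) w'"
  obtain q v q' v' where ww: "w = (q, v)" "w' = (q', v')" by (cases w, cases w')
  have "q = q'" using eq w inj_chart[OF assms] by (auto simp: ww snd_tchart fst_tchart inj_on_def)
  then have "v = v'" using eq w chart_vector_coord[OF assms] by (metis fst_tchart mem_Sigma_iff prod.inject snd_tchart ww)
  then show "w = w'" using \<open>q = q'\<close> by (simp add: ww)
qed

lemma inv_tchart:
  assumes "c \<in> Q" "q \<in> fst c"
  shows "inv_into (fst (tchart Q c)) (snd (tchart Q c)) (snd c q, u) = (q, chart_vector Q c q u)"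
  by (rule inv_into_f_eq[OF inj_tchart[OF assms(1)]])
     (use assms chart_vector_in_T in \<open>simp_all add: fst_tchart snd_tchart coord_chart_vector\<close>)

text \<open>A transition map of \<open>TQ\<close> is a transition map of \<open>Q\<close> paired
  with its derivative acting on the fibre coordinate.\<close>

lemma smooth_atlas_tangent_bundle: "smooth_atlas (tangent_bundle Q)"
proof
  fix C assume "C \<in> tangent_bundle Q"
  then obtain c where c: "c \<in> Q" "C = tchart Q c" by (auto simp: tangent_bundle_eq)
  then show "inj_on (snd C) (fst C)" using inj_tchart by simp
next
  fix C D assume "C \<in> tangent_bundle Q" "D \<in> tangent_bundle Q"
  then obtain c d where c: "c \<in> Q" "C = tchart Q c" and d: "d \<in> Q" "D = tchart Q d"
    unfolding tangent_bundle_eq by blast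
  have im: "snd C ` (fst C \<inter> fst D) = (snd c ` (fst c \<inter> fst d)) \<times> UNIV"
    using tchart_image[OF c(1), of "fst d"] by (simp add: c(2) d(2) fst_tchart[of Q d])
  have o: "open (snd c ` (fst c \<inter> fst d))" using open_overlap c d by blast
  show o': "open (snd C ` (fst C \<inter> fst D))" unfolding im using o by (simp add: open_Times)
  let ?t = "snd d \<circ> inv_into (fst c) (snd c)"
  have t: "smooth_on (snd c ` (fst c \<inter> fst d)) ?t" using smooth_transition c d by blast
  have "smooth_on ((snd c ` (fst c \<inter> fst d)) \<times> UNIV) (?t \<circ> fst)"
    by (rule smooth_on_compose[OF _ o _ smooth_on_fst t]) (use o in \<open>auto simp: open_Times\<close>)
  then have "smooth_on ((snd c ` (fst c \<inter> fst d)) \<times> UNIV) (\<lambda>z. ((?t \<circ> fst) z, frechet_derivative ?t (at (fst z)) (snd z)))"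
    by (rule smooth_on_Pair[OF _ _ smooth_on_derivative_pair[OF o t], rotated]) (use o in \<open>simp add: open_Times\<close>)
  then show "smooth_on (snd C ` (fst C \<inter> fst D)) (snd D \<circ> inv_into (fst C) (snd C))"
    unfolding im
  proof (rule smooth_on_cong[rotated 2])
    show "open ((snd c ` (fst c \<inter> fst d)) \<times> (UNIV :: 'e set))" using o' im by simp
    fix z assume "z \<in> (snd c ` (fst c \<inter> fst d)) \<times> (UNIV :: 'e set)"
    then obtain q u where q: "q \<in> fst c" "q \<in> fst d" and z: "z = (snd c q, u)" by auto
    show "((?t \<circ> fst) z, frechet_derivative ?t (at (fst z)) (snd z)) = (snd D \<circ> inv_into (fst C) (snd C)) z"
      using q c(1) d(1) chart_vector_change[OF d(1) q(2) c(1) q(1)]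
      by (simp add: z c(2) d(2) inv_tchart snd_tchart coord_chart_vector)
  qed
qed

interpretation TB: smooth_atlas "tangent_bundle Q"
  by (rule smooth_atlas_tangent_bundle)

lemma tchart_in: "c \<in> Q \<Longrightarrow> tchart Q c \<in> tangent_bundle Q"
  unfolding tangent_bundle_eq by blast

lemma tb_chartE:
  assumes "C \<in> tangent_bundle Q"
  obtains c where "c \<in> Q" "C = tchart Q c"
  using assms unfolding tangent_bundle_eq by blast

lemma opn_Sigma:
  assumes "opn U"
  shows "TB.opn (Sigma U T)"
  unfolding TB.opn_iff
proof (intro conjI ballI)
  show "Sigma U T \<subseteq> points (tangent_bundle Q)"
    unfolding points_tangent_bundle using assms opn_points by blast
  fix C assume "C \<in> tangent_bundle Q"
  then obtain c where c: "c \<in> Q" "C = tchart Q c" by (rule tb_chartE)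
  show "open (snd C ` (fst C \<inter> Sigma U T))"
    using opn_image[OF assms c(1)] by (simp add: c(2) tchart_image[OF c(1)] open_Times)
qed

text \<open>Here \<open>h c\<close> is the coordinate expression of \<open>G\<close> in the chart of
  \<open>TQ\<close> induced by \<open>c\<close>.\<close>

lemma smooth_fun_SigmaI:
  assumes "opn U"
    and "\<And>c. c \<in> Q \<Longrightarrow> smooth_on ((snd c ` (fst c \<inter> U)) \<times> UNIV) (h c)"
    and "\<And>c q u. c \<in> Q \<Longrightarrow> q \<in> fst c \<Longrightarrow> q \<in> U \<Longrightarrow> h c (snd c q, u) = G (q, chart_vector Q c q u)"
  shows "smooth_fun (tangent_bundle Q) (Sigma U T) G"
proof (rule TB.smooth_funI)
  fix C assume "C \<in> tangent_bundle Q"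
  then obtain c where c: "c \<in> Q" "C = tchart Q c" by (rule tb_chartE)
  show "smooth_on (snd C ` (fst C \<inter> Sigma U T)) (G \<circ> inv_into (fst C) (snd C))"
    unfolding c(2) tchart_image[OF c(1)]
    by (rule smooth_on_cong[OF _ _ assms(2)[OF c(1)]])
       (use opn_image[OF assms(1) c(1)] c(1) in \<open>auto simp: open_Times assms(3) inv_tchart\<close>)
qed

lemma smooth_fun_fst:
  assumes "opn U" "smooth_fun Q U f"
  shows "smooth_fun (tangent_bundle Q) (Sigma U T) (f \<circ> fst)"
proof (rule smooth_fun_SigmaI[OF assms(1), of "\<lambda>c. (f \<circ> inv_into (fst c) (snd c)) \<circ> fst"])
  fix c assume c: "c \<in> Q"
  have o: "open (snd c ` (fst c \<inter> U))" using opn_image[OF assms(1) c] .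
  show "smooth_on ((snd c ` (fst c \<inter> U)) \<times> (UNIV :: 'e set)) ((f \<circ> inv_into (fst c) (snd c)) \<circ> fst)"
    by (rule smooth_on_compose[OF _ o _ smooth_on_fst smooth_funD[OF assms(2) c]])
       (use o in \<open>auto simp: open_Times\<close>)
qed simp

text \<open>The differential of \<open>f\<close>, viewed as a function on \<open>TQ\<close>. For
  \<open>f\<close> equal to \<open>F\<close> it provides the fibrewise linear function
  \<open>P\<close> of the converse implication.\<close>

lemma smooth_fun_eval:
  assumes "opn U" "smooth_fun Q U f"
  shows "smooth_fun (tangent_bundle Q) (Sigma U T) (\<lambda>w. snd w f)"
proof (rule smooth_fun_SigmaI[OF assms(1), of
      "\<lambda>c z. frechet_derivative (f \<circ> inv_into (fst c) (snd c)) (at (fst z)) (snd z)"])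
  fix c assume c: "c \<in> Q"
  show "smooth_on ((snd c ` (fst c \<inter> U)) \<times> UNIV)
    (\<lambda>z. frechet_derivative (f \<circ> inv_into (fst c) (snd c)) (at (fst z)) (snd z))"
    by (rule smooth_on_derivative_pair[OF opn_image[OF assms(1) c] smooth_funD[OF assms(2) c]])
  show "frechet_derivative (f \<circ> inv_into (fst c) (snd c)) (at (fst (snd c q, u))) (snd (snd c q, u)) =
      snd (q, chart_vector Q c q u) f" if "q \<in> U" for q u
    using chart_vector_apply[OF smooth_nearI[OF assms(1) that assms(2)]] by simp
qed

lemma smooth_qv:
  assumes X: "local_frame Q U X" and \<gamma>: "\<gamma> < DIM('e)"
  shows "smooth_fun (tangent_bundle Q) (Sigma U T) (quasi_velocity DIM('e) X \<gamma>)"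
proof (rule TB.smooth_fun_local)
  fix w assume w: "w \<in> Sigma U T"
  obtain \<beta> where \<beta>: "bij_betw \<beta> {..<DIM('e)} (Basis :: 'e set)" using ex_basis_enum by blast
  obtain c where c: "c \<in> Q" "fst w \<in> fst c" using chart_ex[of "fst w"] opn_points[OF lf_opn[OF X]] w by force
  let ?V = "U \<inter> fst c"
  have o: "opn ?V" using lf_opn[OF X] opn_chart[OF c(1)] by blast
  have s: "smooth_fun Q ?V (\<lambda>p. snd c p \<bullet> b)" for b
    using smooth_chart_coordinate[OF c(1)] smooth_fun_subset by blast
  let ?x = "\<lambda>i p. snd c p \<bullet> \<beta> i"
  have "smooth_fun (tangent_bundle Q) (Sigma ?V T) (quasi_velocity DIM('e) X \<gamma>)"
  proof (rule TB.smooth_fun_solve[where a = "\<lambda>w (i, j). X j (fst w) (?x i)" and b = "\<lambda>i w. snd w (?x i)"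
        and x = "quasi_velocity DIM('e) X", OF opn_Sigma[OF o] _ _ _ _ \<gamma>])
    show "smooth_fun (tangent_bundle Q) (Sigma ?V T) (\<lambda>w. case (i, j) of (i, j) \<Rightarrow> X j (fst w) (?x i))"
      if "j < DIM('e)" for i j
      using smooth_fun_fst[OF o vf_smooth[OF lf_vf[OF X that] o _ s]] by (simp add: o_def)
    show "smooth_fun (tangent_bundle Q) (Sigma ?V T) (\<lambda>w. snd w (?x i))" for i
      using smooth_fun_eval[OF o s] .
    show "(\<Sum>j<DIM('e). (case (i, j) of (i, j) \<Rightarrow> X j (fst w) (?x i)) * quasi_velocity DIM('e) X j w) = snd w (?x i)"
      if "w \<in> Sigma ?V T" for w i
    proof -
      have "fst w \<in> U" "snd w \<in> T (fst w)" using that by auto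
      from arg_cong[OF qv_expand[OF X this], of "\<lambda>v. v (?x i)"] show ?thesis
        by (simp add: sum_fun_apply scaleR_fun_def mult.commute)
    qed
    show "\<forall>j<DIM('e). y j = 0"
      if w: "w \<in> Sigma ?V T" and y: "\<forall>i<DIM('e). (\<Sum>j<DIM('e). (case (i, j) of (i, j) \<Rightarrow> X j (fst w) (?x i)) * y j) = 0" for w y
    proof (intro allI impI)
      fix j assume j: "j < DIM('e)"
      have "(\<Sum>\<gamma><DIM('e). X \<gamma> (fst w) (\<lambda>p. snd c p \<bullet> b) * y \<gamma>) = 0" if "b \<in> Basis" for b
      proof -
        have "b \<in> \<beta> ` {..<DIM('e)}" using bij_betw_imp_surj_on[OF \<beta>] that by simp
        then obtain i where "i < DIM('e)" "b = \<beta> i" by auto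
        then show ?thesis using y by auto
      qed
      then show "y j = 0" using frame_coordinate_kernel[OF X _ c(1), of "fst w" y j] w j by auto
    qed
  qed
  then show "\<exists>V. TB.opn V \<and> w \<in> V \<and> smooth_fun (tangent_bundle Q) V (quasi_velocity DIM('e) X \<gamma>)"
    using opn_Sigma[OF o] w c(2) by (intro exI[of _ "Sigma ?V T"]) auto
qed

lemma smooth_near_fst:
  assumes "smooth_near Q q f" "v \<in> T q"
  shows "smooth_near (tangent_bundle Q) (q, v) (f \<circ> fst)"
proof -
  obtain W where "opn W" "q \<in> W" "smooth_fun Q W f" using assms by (auto simp: smooth_near_def)
  then show ?thesis using assms(2)
    by (intro TB.smooth_nearI[OF opn_Sigma _ smooth_fun_fst]) auto
qed

lemma smooth_near_qv:
  "local_frame Q U X \<Longrightarrow> \<gamma> < DIM('e) \<Longrightarrow> q \<in> U \<Longrightarrow> v \<in> T q \<Longrightarrow>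
    smooth_near (tangent_bundle Q) (q, v) (quasi_velocity DIM('e) X \<gamma>)"
  by (rule TB.smooth_nearI[OF opn_Sigma[OF lf_opn] _ smooth_qv]) auto

subsection \<open>Push-forwards and vertical lifts\<close>

text \<open>The image of \<open>v\<close> under the differential of the section that sends
  \<open>p\<close> to \<open>(p, V p)\<close>. The default \<open>0\<close> agrees with the
  convention for tangent vectors, so that it is an element of the tangent space of \<open>TQ\<close>
  at \<open>(q, V q)\<close>.\<close>

definition pushforward :: "('q \<Rightarrow> 'q tvec) \<Rightarrow> 'q \<Rightarrow> 'q tvec \<Rightarrow> ('q \<times> 'q tvec) tvec" where
  "pushforward V q v = (\<lambda>G. if smooth_near (tangent_bundle Q) (q, V q) G then v (\<lambda>p. G (p, V p)) else 0)"

definition vlift :: "'q tvec \<Rightarrow> 'q \<times> 'q tvec \<Rightarrow> ('q \<times> 'q tvec) tvec" where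
  "vlift a w = (\<lambda>G. if smooth_near (tangent_bundle Q) w G
     then deriv (\<lambda>s. G (fst w, snd w + s *\<^sub>R a)) 0 else 0)"

lemma coord_field_smooth:
  assumes V: "vector_field Q U V" and c: "c \<in> Q"
  shows "smooth_on (snd c ` (fst c \<inter> U)) (\<lambda>x. (x, coord c (V (inv_into (fst c) (snd c) x))))"
proof -
  have o: "open (snd c ` (fst c \<inter> U))" using opn_image[OF vf_opn[OF V] c] .
  have oU: "opn (fst c \<inter> U)" using vf_opn[OF V] opn_chart[OF c] by blast
  have "smooth_fun Q (fst c \<inter> U) (\<lambda>p. V p (\<lambda>p. snd c p \<bullet> b))" for b
    by (rule vf_smooth[OF V oU _ smooth_fun_subset[OF smooth_chart_coordinate[OF c]]]) auto
  from smooth_funD[OF this c]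
  have "smooth_on (snd c ` (fst c \<inter> U)) (\<lambda>x. V (inv_into (fst c) (snd c) x) (\<lambda>p. snd c p \<bullet> b))" for b
    by (simp add: o_def)
  then show ?thesis unfolding coord_def
    by (intro smooth_on_Pair smooth_on_sum smooth_on_scaleR smooth_on_id smooth_on_const o)
qed

text \<open>Besides the chain rule this needs the section to be continuous: the points that it maps
  into the domain of \<open>G\<close> must form an open set of \<open>Q\<close>.\<close>

lemma smooth_near_field:
  assumes V: "vector_field Q U V" "q \<in> U" and G: "smooth_near (tangent_bundle Q) (q, V q) G"
  shows "smooth_near Q q (\<lambda>p. G (p, V p))"
proof -
  obtain W where W: "TB.opn W" "(q, V q) \<in> W" "smooth_fun (tangent_bundle Q) W G"
    using G by (auto simp: smooth_near_def)
  obtain c where c: "c \<in> Q" "q \<in> fst c" using chart_ex opn_points[OF vf_opn[OF V(1)] V(2)] by blast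
  let ?C = "tchart Q c"
  let ?s = "\<lambda>x. (x, coord c (V (inv_into (fst c) (snd c) x)))"
  let ?O = "snd ?C ` (fst ?C \<inter> W)"
  have s: "smooth_on (snd c ` (fst c \<inter> U)) ?s" by (rule coord_field_smooth[OF V(1) c(1)])
  have oO: "open ?O" using TB.opn_image[OF W(1) tchart_in[OF c(1)]] .
  \<comment> \<open>The preimage under the section of the set on which \<open>G\<close> is smooth,
    cut down to one chart so that its openness can be read off in coordinates.\<close>
  define N where "N = {p \<in> fst c \<inter> U. (p, V p) \<in> W}"
  have sp: "?s (snd c p) = snd ?C (p, V p)" if "p \<in> fst c" for p
    using that c(1) by (simp add: snd_tchart)
  have pC: "(p, V p) \<in> fst ?C" if "p \<in> fst c" "p \<in> U" for p
    using that vf_T[OF V(1)] by (simp add: fst_tchart)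
  have N: "snd c ` N = ?s -` ?O \<inter> snd c ` (fst c \<inter> U)"
  proof (intro equalityI subsetI)
    fix x assume "x \<in> snd c ` N"
    then obtain p where p: "x = snd c p" "p \<in> fst c" "p \<in> U" "(p, V p) \<in> W" unfolding N_def by blast
    then show "x \<in> ?s -` ?O \<inter> snd c ` (fst c \<inter> U)"
      using sp[OF p(2)] pC[OF p(2,3)] by (intro IntI vimageI2) (simp_all only:, blast+)
  next
    fix x assume "x \<in> ?s -` ?O \<inter> snd c ` (fst c \<inter> U)"
    then obtain p w where p: "x = snd c p" "p \<in> fst c" "p \<in> U" "?s x = snd ?C w" "w \<in> fst ?C" "w \<in> W" by blast
    have "w = (p, V p)"
      using inj_onD[OF inj_tchart[OF c(1)] _ p(5) pC[OF p(2,3)]] p(1,4) sp[OF p(2)] by metis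
    then show "x \<in> snd c ` N" using p N_def by blast
  qed
  have oN: "opn N"
  proof -
    have "open (snd c ` N)"
      unfolding N by (rule continuous_on_open_vimage[THEN iffD1, rule_format, OF _ smooth_on_continuous[OF s] oO])
         (rule opn_image[OF vf_opn[OF V(1)] c(1)])
    \<comment> \<open>Openness in the remaining charts follows because transition maps are
      continuous.\<close>
    moreover have "snd d ` (fst d \<inter> N) = (snd c \<circ> inv_into (fst d) (snd d)) -` (snd c ` N) \<inter> snd d ` (fst d \<inter> fst c)"
      if d: "d \<in> Q" for d
    proof (intro equalityI subsetI)
      fix y assume "y \<in> (snd c \<circ> inv_into (fst d) (snd d)) -` (snd c ` N) \<inter> snd d ` (fst d \<inter> fst c)"
      then obtain p r where p: "y = snd d p" "p \<in> fst d" "p \<in> fst c" "snd c p = snd c r" "r \<in> N"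
        using d by auto
      then have "p = r" using inj_onD[OF inj_chart[OF c(1)] p(4)] N_def by blast
      then show "y \<in> snd d ` (fst d \<inter> N)" using p by blast
    qed (use d N_def in auto)
    ultimately have "open (snd d ` (fst d \<inter> N))" if d: "d \<in> Q" for d
      using continuous_on_open_vimage[OF open_overlap[OF d c(1)]]
        smooth_on_continuous[OF smooth_transition[OF d c(1)]] d by metis
    then show ?thesis unfolding opn_iff N_def using chart_points[OF c(1)] by blast
  qed
  have im: "snd c ` N = snd c ` (fst c \<inter> N)" by (auto simp: N_def)
  have onN: "open (snd c ` N)" unfolding im using opn_image[OF oN c(1)] .
  have "smooth_on (snd c ` N) ((G \<circ> inv_into (fst ?C) (snd ?C)) \<circ> ?s)"
    by (rule smooth_on_compose[OF onN oO _ smooth_on_subset[OF s] TB.smooth_funD[OF W(3) tchart_in[OF c(1)]]])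
       (use N in blast)+
  then have "smooth_on (snd c ` N) ((\<lambda>p. G (p, V p)) \<circ> inv_into (fst c) (snd c))"
  proof (rule smooth_on_cong[OF onN, rotated])
    fix x assume "x \<in> snd c ` N"
    then obtain p where p: "x = snd c p" "p \<in> fst c" "p \<in> U" unfolding N_def by blast
    show "((G \<circ> inv_into (fst ?C) (snd ?C)) \<circ> ?s) x = ((\<lambda>p. G (p, V p)) \<circ> inv_into (fst c) (snd c)) x"
      using TB.inv_chart[OF tchart_in[OF c(1)] pC[OF p(2,3)]] sp[OF p(2)] c(1) p by (simp only: o_apply) simp
  qed
  then have "smooth_fun Q N (\<lambda>p. G (p, V p))"
    by (intro smooth_fun_chartI[OF c(1) _ oN]) (auto simp: N_def)
  moreover have "q \<in> N" using c V W by (simp add: N_def)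
  ultimately show ?thesis using oN smooth_nearI by blast
qed

lemma pushforward_tangent:
  assumes V: "vector_field Q U V" "q \<in> U" and v: "v \<in> T q"
  shows "pushforward V q v \<in> TB.T (q, V q)"
proof -
  obtain c where c: "c \<in> Q" "q \<in> fst c" using chart_ex opn_points[OF vf_opn[OF V(1)] V(2)] by blast
  obtain u where u: "v = chart_vector Q c q u" using v tangent_space_chart[OF c] by auto
  let ?C = "tchart Q c"
  let ?s = "\<lambda>x. (x, coord c (V (inv_into (fst c) (snd c) x)))"
  have s: "smooth_on (snd c ` (fst c \<inter> U)) ?s" by (rule coord_field_smooth[OF V(1) c(1)])
  have pC: "(p, V p) \<in> fst ?C" if "p \<in> fst c" "p \<in> U" for p
    using that vf_T[OF V(1)] by (simp add: fst_tchart)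
  have ds: "(?s has_derivative frechet_derivative ?s (at (snd c q))) (at (snd c q))"
    by (rule smooth_on_has_derivative[OF s]) (use c V in blast)
  have sq: "?s (snd c q) = snd ?C (q, V q)" using c by (simp add: snd_tchart)
  have "pushforward V q v = chart_vector (tangent_bundle Q) ?C (q, V q) (frechet_derivative ?s (at (snd c q)) u)"
  proof
    fix G
    show "pushforward V q v G = chart_vector (tangent_bundle Q) ?C (q, V q) (frechet_derivative ?s (at (snd c q)) u) G"
    proof (cases "smooth_near (tangent_bundle Q) (q, V q) G")
      case True
      let ?G = "G \<circ> inv_into (fst ?C) (snd ?C)"
      have "(?G \<circ> ?s has_derivative frechet_derivative ?G (at (snd ?C (q, V q))) \<circ> frechet_derivative ?s (at (snd c q))) (at (snd c q))"
        by (rule diff_chain_at[OF ds, unfolded sq,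
              OF TB.near_has_derivative[OF True tchart_in[OF c(1)] pC[OF c(2) V(2)]]])
      then have "((\<lambda>p. G (p, V p)) \<circ> inv_into (fst c) (snd c) has_derivative
          frechet_derivative ?G (at (snd ?C (q, V q))) \<circ> frechet_derivative ?s (at (snd c q))) (at (snd c q))"
      proof (rule has_derivative_transform_within_open[OF _ opn_image[OF vf_opn[OF V(1)] c(1)]])
        show "snd c q \<in> snd c ` (fst c \<inter> U)" using c V by blast
        fix x assume "x \<in> snd c ` (fst c \<inter> U)"
        then obtain p where p: "x = snd c p" "p \<in> fst c" "p \<in> U" by blast
        show "(?G \<circ> ?s) x = ((\<lambda>p. G (p, V p)) \<circ> inv_into (fst c) (snd c)) x"
          using TB.inv_chart[OF tchart_in[OF c(1)] pC[OF p(2,3)]] c(1) p by (simp add: snd_tchart)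
      qed
      from chart_vectorI[OF smooth_near_field[OF V True] this] show ?thesis
        using True by (simp add: pushforward_def u TB.chart_vector_apply)
    qed (simp add: pushforward_def chart_vector_def)
  qed
  then show ?thesis using TB.chart_vector_in_T[OF tchart_in[OF c(1)] pC[OF c(2) V(2)]] by simp
qed

text \<open>Only the velocity at 0 of a curve in the fibre matters. This treats the straight line of
  a vertical lift and the exponential curve of the Liouville field together.\<close>

lemma fibre_curve_derivative:
  assumes c: "c \<in> Q" "q \<in> fst c" and v: "v \<in> T q" and G: "smooth_near (tangent_bundle Q) (q, v) G"
    and \<gamma>: "\<And>s. \<gamma> s \<in> T q" "\<gamma> 0 = v" "((\<lambda>s. coord c (\<gamma> s)) has_derivative (\<lambda>s. s *\<^sub>R a)) (at 0)"
  shows "deriv (\<lambda>s. G (q, \<gamma> s)) 0 = chart_vector (tangent_bundle Q) (tchart Q c) (q, v) (0, a) G"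
proof -
  let ?C = "tchart Q c"
  let ?G = "G \<circ> inv_into (fst ?C) (snd ?C)"
  let ?D = "frechet_derivative ?G (at (snd ?C (q, v)))"
  have C: "?C \<in> tangent_bundle Q" "(q, v) \<in> fst ?C" using c v tchart_in by (auto simp: fst_tchart)
  have dG: "(?G has_derivative ?D) (at (snd ?C (q, v)))" using TB.near_has_derivative[OF G C] .
  have "((\<lambda>s. (snd c q, coord c (\<gamma> s))) has_derivative (\<lambda>s. (0, s *\<^sub>R a))) (at 0)"
    by (intro has_derivative_Pair has_derivative_const \<gamma>(3))
  from diff_chain_at[OF this, of ?G ?D] dG \<gamma>(2)
  have "(?G \<circ> (\<lambda>s. (snd c q, coord c (\<gamma> s))) has_derivative ?D \<circ> (\<lambda>s. (0, s *\<^sub>R a))) (at 0)"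
    by (simp add: snd_tchart)
  moreover have "?G \<circ> (\<lambda>s. (snd c q, coord c (\<gamma> s))) = (\<lambda>s. G (q, \<gamma> s))"
    using inv_tchart[OF c] chart_vector_coord[OF c \<gamma>(1)] by (simp add: o_def)
  moreover have "?D \<circ> (\<lambda>s. (0, s *\<^sub>R a)) = (*) (?D (0, a))"
  proof
    fix s
    have "?D (s *\<^sub>R (0, a)) = s *\<^sub>R ?D (0, a)" using dG has_derivative_linear linear_scale by blast
    then show "(?D \<circ> (\<lambda>s. (0, s *\<^sub>R a))) s = ?D (0, a) * s" by (simp add: mult.commute)
  qed
  ultimately have "((\<lambda>s. G (q, \<gamma> s)) has_field_derivative ?D (0, a)) (at 0)"
    by (simp add: has_field_derivative_def)
  then show ?thesis using TB.chart_vector_apply[OF G] by (simp add: DERIV_imp_deriv)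
qed

lemma vlift_chart:
  assumes c: "c \<in> Q" "q \<in> fst c" and v: "v \<in> T q" and a: "a \<in> T q"
  shows "vlift a (q, v) = chart_vector (tangent_bundle Q) (tchart Q c) (q, v) (0, coord c a)"
proof
  fix G
  show "vlift a (q, v) G = chart_vector (tangent_bundle Q) (tchart Q c) (q, v) (0, coord c a) G"
  proof (cases "smooth_near (tangent_bundle Q) (q, v) G")
    case True
    have "((\<lambda>s. coord c (v + s *\<^sub>R a)) has_derivative (\<lambda>s. s *\<^sub>R coord c a)) (at 0)"
      unfolding coord_add coord_scale by (auto intro!: derivative_eq_intros)
    from fibre_curve_derivative[OF c v True _ _ this] show ?thesis
      using True T_add[OF v T_scale[OF a]] by (simp add: vlift_def)
  qed (simp add: vlift_def chart_vector_def)
qed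

text \<open>The curve \<open>exp t\<close> times \<open>v\<close> has velocity \<open>v\<close> at
  0, just like the line through \<open>v\<close> in direction \<open>v\<close>.\<close>

lemma liouville_eq_vlift:
  assumes v: "v \<in> T q"
  shows "liouville Q (q, v) = vlift v (q, v)"
proof -
  obtain c where c: "c \<in> Q" "q \<in> fst c" using chart_ex tangent_points[OF v] by blast
  show ?thesis unfolding vlift_chart[OF c v v]
  proof
    fix G
    show "liouville Q (q, v) G = chart_vector (tangent_bundle Q) (tchart Q c) (q, v) (0, coord c v) G"
    proof (cases "smooth_near (tangent_bundle Q) (q, v) G")
      case True
      have "((\<lambda>s. coord c (exp s *\<^sub>R v)) has_derivative (\<lambda>s. s *\<^sub>R coord c v)) (at 0)"
        unfolding coord_scale by (auto intro!: derivative_eq_intros)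
      from fibre_curve_derivative[OF c v True _ _ this] show ?thesis
        using True T_scale[OF v] by (simp add: liouville_def)
    qed (simp add: liouville_def chart_vector_def)
  qed
qed

lemma vlift_tangent: "v \<in> T q \<Longrightarrow> a \<in> T q \<Longrightarrow> vlift a (q, v) \<in> TB.T (q, v)"
  using chart_ex[of q] tangent_points vlift_chart TB.chart_vector_in_T[OF tchart_in]
  by (metis fst_tchart mem_Sigma_iff)

lemma vlift_add:
  assumes "v \<in> T q" "a \<in> T q" "b \<in> T q"
  shows "vlift (a + b) (q, v) = vlift a (q, v) + vlift b (q, v)"
proof -
  obtain c where c: "c \<in> Q" "q \<in> fst c" using chart_ex tangent_points[OF assms(1)] by blast
  have C: "tchart Q c \<in> tangent_bundle Q" "(q, v) \<in> fst (tchart Q c)" using c assms tchart_in by (auto simp: fst_tchart)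
  show ?thesis
    using linear_add[OF TB.linear_chart_vector[OF C], of "(0, coord c a)" "(0, coord c b)"]
    by (simp add: vlift_chart[OF c] assms T_add coord_add)
qed

lemma vlift_scale:
  assumes "v \<in> T q" "a \<in> T q"
  shows "vlift (r *\<^sub>R a) (q, v) = r *\<^sub>R vlift a (q, v)"
proof -
  obtain c where c: "c \<in> Q" "q \<in> fst c" using chart_ex tangent_points[OF assms(1)] by blast
  have C: "tchart Q c \<in> tangent_bundle Q" "(q, v) \<in> fst (tchart Q c)" using c assms tchart_in by (auto simp: fst_tchart)
  show ?thesis
    using linear_scale[OF TB.linear_chart_vector[OF C], of r "(0, coord c a)"]
    by (simp add: vlift_chart[OF c] assms T_scale coord_scale)
qed

text \<open>Quasi-velocities, and \<open>theta\<close> built from them, are linear on fibres, so a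
  vertical lift acts on them by evaluation at the lifted vector.\<close>

lemma vlift_linear:
  assumes "smooth_near (tangent_bundle Q) (q, v) G" "\<And>s. G (q, v + s *\<^sub>R a) = G (q, v) + s * G (q, a)"
  shows "vlift a (q, v) G = G (q, a)"
proof -
  have "((\<lambda>s. G (q, v) + s * G (q, a)) has_field_derivative G (q, a)) (at 0)"
    by (auto intro!: derivative_eq_intros)
  then show ?thesis using assms by (simp add: vlift_def DERIV_imp_deriv)
qed

lemma vlift_qv:
  assumes X: "local_frame Q U X" "q \<in> U" and \<gamma>: "\<gamma> < DIM('e)" and v: "v \<in> T q" and a: "a \<in> T q"
  shows "vlift a (q, v) (quasi_velocity DIM('e) X \<gamma>) = quasi_velocity DIM('e) X \<gamma> (q, a)"
  by (rule vlift_linear[OF smooth_near_qv[OF X(1) \<gamma> X(2) v]])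
     (simp add: qv_add[OF X \<gamma> v T_scale[OF a]] qv_scale[OF X \<gamma> a])

lemma vlift_inj:
  assumes v: "v \<in> T q" and a: "a \<in> T q" and b: "b \<in> T q" and eq: "vlift a (q, v) = vlift b (q, v)"
  shows "a = b"
proof -
  obtain U X where X: "local_frame Q U X" "q \<in> U" using local_frame_ex[OF tangent_points[OF v]] .
  show ?thesis by (rule qv_eqI[OF X a b]) (use vlift_qv[OF X _ v] a b eq in metis)
qed

text \<open>The differential of a section projects to the vector that was pushed forward, and a
  vertical lift annihilates functions pulled back from \<open>Q\<close>. Hence \<open>a\<close> may
  be chosen freely to match the prescribed derivatives of the quasi-velocities.\<close>

lemma second_order_push_vlift:
  assumes V: "vector_field Q U V" "q \<in> U" and a: "a \<in> T q"
  shows "second_order_vector Q (q, V q) (pushforward V q (V q) - vlift a (q, V q))"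
  unfolding second_order_vector_def
proof (intro conjI allI impI)
  have v: "V q \<in> T q" using vf_T V by blast
  show "pushforward V q (V q) - vlift a (q, V q) \<in> TB.T (q, V q)"
    by (intro TB.T_diff pushforward_tangent[OF V v] vlift_tangent v a)
  fix f assume "smooth_near Q (fst (q, V q)) f"
  then have n: "smooth_near (tangent_bundle Q) (q, V q) (f \<circ> fst)" using smooth_near_fst v by simp
  have "vlift a (q, V q) (f \<circ> fst) = 0" using n by (simp add: vlift_def)
  then show "(pushforward V q (V q) - vlift a (q, V q)) (f \<circ> fst) = snd (q, V q) f"
    using n by (simp add: pushforward_def fun_diff_def)
qed

text \<open>The second-order condition fixes the base components. The fibre coordinates are
  combinations of quasi-velocities with coefficients from the base, so the remaining components are
  fixed too. This supplies uniqueness for both definite descriptions.\<close>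

lemma second_order_unique:
  assumes X: "local_frame Q U X" "q \<in> U" and v: "v \<in> T q"
    and W: "second_order_vector Q (q, v) W" "second_order_vector Q (q, v) W'"
    and eq: "\<And>\<gamma>. \<gamma> < DIM('e) \<Longrightarrow> W (quasi_velocity DIM('e) X \<gamma>) = W' (quasi_velocity DIM('e) X \<gamma>)"
  shows "W = W'"
proof -
  obtain c where c: "c \<in> Q" "q \<in> fst c" using chart_ex tangent_points[OF v] by blast
  have C: "tchart Q c \<in> tangent_bundle Q" "(q, v) \<in> fst (tchart Q c)" using c v tchart_in by (auto simp: fst_tchart)
  have WT: "W \<in> TB.T (q, v)" "W' \<in> TB.T (q, v)" using W by (auto simp: second_order_vector_def)
  show ?thesis
  proof (rule TB.tangent_eqI[OF C WT])
    fix b :: "'e \<times> 'e" assume "b \<in> Basis"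
    then consider b' where "b = (b', 0)" "b' \<in> Basis" | b' where "b = (0, b')" "b' \<in> Basis"
      unfolding Basis_prod_def by blast
    then show "W (\<lambda>w. snd (tchart Q c) w \<bullet> b) = W' (\<lambda>w. snd (tchart Q c) w \<bullet> b)"
    proof cases
      case 1
      have "(\<lambda>w. snd (tchart Q c) w \<bullet> b) = (\<lambda>p. snd c p \<bullet> b') \<circ> fst"
        by (auto simp: snd_tchart 1 fun_eq_iff)
      then show ?thesis using W smooth_near_coordinate[OF c, of b'] by (simp add: second_order_vector_def)
    next
      case 2
      let ?x = "\<lambda>p. snd c p \<bullet> b'"
      \<comment> \<open>The fibre coordinate in direction \<open>b'\<close>, written through the
        quasi-velocities of the frame; its coefficients are functions on \<open>Q\<close>, on which
        the second-order condition applies.\<close>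
      let ?h = "\<lambda>w. \<Sum>\<gamma><DIM('e). quasi_velocity DIM('e) X \<gamma> w * ((\<lambda>p. X \<gamma> p ?x) \<circ> fst) w"
      have h: "snd (tchart Q c) w \<bullet> b = ?h w" if w: "w \<in> Sigma U T" for w
      proof -
        have "fst w \<in> U" "snd w \<in> T (fst w)" using w by auto
        from arg_cong[OF qv_expand[OF X(1) this], of "\<lambda>v. v ?x"] show ?thesis
          using snd_tchart[of c "fst w" "snd w"] by (simp add: sum_fun_apply scaleR_fun_def 2 coord_inner)
      qed
      have Xx: "smooth_near Q q (\<lambda>p. X \<gamma> p ?x)" if "\<gamma> < DIM('e)" for \<gamma>
        using vf_smooth_near[OF lf_vf[OF X(1) that] X(2) smooth_near_coordinate[OF c]] .
      have key: "Z (\<lambda>w. snd (tchart Q c) w \<bullet> b) = (\<Sum>\<gamma><DIM('e). quasi_velocity DIM('e) X \<gamma> (q, v) * v (\<lambda>p. X \<gamma> p ?x) +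
          X \<gamma> q ?x * Z (quasi_velocity DIM('e) X \<gamma>))" if Z: "second_order_vector Q (q, v) Z" for Z
      proof -
        have ZT: "Z \<in> TB.T (q, v)" using Z by (simp add: second_order_vector_def)
        have "Z (\<lambda>w. snd (tchart Q c) w \<bullet> b) = Z ?h"
          by (rule TB.tangent_local[OF ZT opn_Sigma[OF lf_opn[OF X(1)]] _ h]) (use X v in auto)
        also have "\<dots> = (\<Sum>\<gamma><DIM('e). Z (\<lambda>w. quasi_velocity DIM('e) X \<gamma> w * ((\<lambda>p. X \<gamma> p ?x) \<circ> fst) w))"
          by (rule TB.tangent_sum[OF ZT TB.smooth_near_mult[OF smooth_near_qv[OF X(1) _ X(2) v]
                smooth_near_fst[OF Xx v]]]) auto
        also have "\<dots> = (\<Sum>\<gamma><DIM('e). quasi_velocity DIM('e) X \<gamma> (q, v) * Z ((\<lambda>p. X \<gamma> p ?x) \<circ> fst) +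
          X \<gamma> q ?x * Z (quasi_velocity DIM('e) X \<gamma>))"
        proof (rule sum.cong[OF refl])
          fix \<gamma> assume "\<gamma> \<in> {..<DIM('e)}"
          then have \<gamma>: "\<gamma> < DIM('e)" by simp
          show "Z (\<lambda>w. quasi_velocity DIM('e) X \<gamma> w * ((\<lambda>p. X \<gamma> p ?x) \<circ> fst) w) =
              quasi_velocity DIM('e) X \<gamma> (q, v) * Z ((\<lambda>p. X \<gamma> p ?x) \<circ> fst) +
              X \<gamma> q ?x * Z (quasi_velocity DIM('e) X \<gamma>)"
            using TB.tangent_mult[OF ZT smooth_near_qv[OF X(1) \<gamma> X(2) v] smooth_near_fst[OF Xx[OF \<gamma>] v]] by simp
        qed
        also have "\<dots> = (\<Sum>\<gamma><DIM('e). quasi_velocity DIM('e) X \<gamma> (q, v) * v (\<lambda>p. X \<gamma> p ?x) +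
          X \<gamma> q ?x * Z (quasi_velocity DIM('e) X \<gamma>))"
          using Z Xx by (intro sum.cong) (auto simp: second_order_vector_def)
        finally show ?thesis .
      qed
      show ?thesis unfolding key[OF W(1)] key[OF W(2)] using eq by simp
    qed
  qed
qed

text \<open>For \<open>a\<close> equal to a covariant derivative of \<open>V\<close> along itself,
  the term differentiating the components of \<open>V\<close> cancels and only the quadratic
  expression in the connection coefficients is left.\<close>

lemma push_vlift_qv:
  assumes X: "local_frame Q U X" "q \<in> U" and V: "vector_field Q U' V" "q \<in> U'" and a: "a \<in> T q" and \<gamma>: "\<gamma> < DIM('e)"
  shows "(pushforward V q (V q) - vlift a (q, V q)) (quasi_velocity DIM('e) X \<gamma>) =
    V q (\<lambda>p. quasi_velocity DIM('e) X \<gamma> (p, V p)) - quasi_velocity DIM('e) X \<gamma> (q, a)"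
  using smooth_near_qv[OF X(1) \<gamma> X(2) vf_T[OF V]] vlift_qv[OF X \<gamma> vf_T[OF V] a]
  by (simp add: fun_diff_def pushforward_def)

end

section \<open>Symmetric tensors and the Levi-Civita connection\<close>

context smooth_atlas
begin

lemma lie_bracket_add_right:
  assumes X: "vector_field Q U X" and Y: "vector_field Q U Y" "vector_field Q U Y'" and q: "q \<in> U"
  shows "lie_bracket Q X (\<lambda>p. Y p + Y' p) q = lie_bracket Q X Y q + lie_bracket Q X Y' q"
  using lie_bracket_add[OF Y X q] lie_bracket_antisym[of X _ q] by simp

lemma lie_bracket_scale_right:
  assumes X: "vector_field Q U X" and Y: "vector_field Q U Y" and h: "smooth_fun Q U h" and q: "q \<in> U"
  shows "lie_bracket Q X (\<lambda>p. h p *\<^sub>R Y p) q = h q *\<^sub>R lie_bracket Q X Y q + X q h *\<^sub>R Y q"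
  using lie_bracket_scale[OF Y X h q] lie_bracket_antisym[of X _ q] by simp

text \<open>A trivial kernel gives a nonzero determinant, and the adjugate matrix then provides a
  solution.\<close>

lemma solve_ex:
  fixes a :: "nat \<times> nat \<Rightarrow> real"
  assumes "\<And>y. \<forall>i<n. (\<Sum>j<n. a (i, j) * y j) = 0 \<Longrightarrow> \<forall>j<n. y j = 0"
  shows "\<exists>x. \<forall>i<n. (\<Sum>j<n. a (i, j) * x j) = r i"
proof -
  let ?A = "Matrix.mat n n a" and ?r = "Matrix.vec n r"
  have d: "Determinant.det ?A \<noteq> 0" using det_nonzero_iff assms by blast
  have A: "?A \<in> carrier_mat n n" by simp
  note adj = adj_mat[OF A]
  have car: "adj_mat ?A *\<^sub>v ?r \<in> carrier_vec n" using adj(1) by simp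
  have "?A *\<^sub>v (adj_mat ?A *\<^sub>v ?r) = (?A * adj_mat ?A) *\<^sub>v ?r"
    using adj(1) by (intro assoc_mult_mat_vec[symmetric, OF A]) auto
  also have "\<dots> = Determinant.det ?A \<cdot>\<^sub>v ?r" unfolding adj(2) by (rule eq_vecI) auto
  finally have *: "?A *\<^sub>v (adj_mat ?A *\<^sub>v ?r) = Determinant.det ?A \<cdot>\<^sub>v ?r" .
  have "(\<Sum>j<n. a (i, j) * (vec_index (adj_mat ?A *\<^sub>v ?r) j / Determinant.det ?A)) = r i" if i: "i < n" for i
  proof -
    have "vec_index (?A *\<^sub>v (adj_mat ?A *\<^sub>v ?r)) i = (\<Sum>j<n. a (i, j) * vec_index (adj_mat ?A *\<^sub>v ?r) j)"
      using i car adj(1) by (auto simp: scalar_prod_def atLeast0LessThan)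
    then have "(\<Sum>j<n. a (i, j) * vec_index (adj_mat ?A *\<^sub>v ?r) j) = Determinant.det ?A * r i"
      using * i by simp
    then show ?thesis using d by (simp flip: sum_divide_distrib)
  qed
  then show ?thesis
    by (intro exI[of _ "\<lambda>j. vec_index (adj_mat ?A *\<^sub>v ?r) j / Determinant.det ?A"] allI impI)
qed

end

section \<open>Calculus with a symmetric tensor and Koszul's formula\<close>

locale tensor_atlas = smooth_atlas Q for Q :: "('q, 'e::euclidean_space) atlas" +
  fixes h :: "'q tensor2"
  assumes symmetric: "symmetric_tensor Q h"
begin

lemma tensor_sym: "u \<in> T q \<Longrightarrow> v \<in> T q \<Longrightarrow> h q u v = h q v u"
  using symmetric tangent_points unfolding symmetric_tensor_def by blast

lemma add_left: "u \<in> T q \<Longrightarrow> v \<in> T q \<Longrightarrow> w \<in> T q \<Longrightarrow> h q (u + v) w = h q u w + h q v w"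
  using symmetric tangent_points unfolding symmetric_tensor_def by blast

lemma scale_left: "u \<in> T q \<Longrightarrow> v \<in> T q \<Longrightarrow> h q (r *\<^sub>R u) v = r * h q u v"
  using symmetric tangent_points unfolding symmetric_tensor_def by blast

lemma add_right: "u \<in> T q \<Longrightarrow> v \<in> T q \<Longrightarrow> w \<in> T q \<Longrightarrow> h q w (u + v) = h q w u + h q w v"
  using add_left tensor_sym T_add by metis

lemma scale_right: "u \<in> T q \<Longrightarrow> v \<in> T q \<Longrightarrow> h q v (r *\<^sub>R u) = r * h q v u"
  using scale_left tensor_sym T_scale by metis

lemma diff_left: "u \<in> T q \<Longrightarrow> v \<in> T q \<Longrightarrow> w \<in> T q \<Longrightarrow> h q (u - v) w = h q u w - h q v w"
  using add_left[of u q "-1 *\<^sub>R v" w] scale_left[of v q w "-1"] T_scale[of v q "-1"] by simp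

lemma diff_right: "u \<in> T q \<Longrightarrow> v \<in> T q \<Longrightarrow> w \<in> T q \<Longrightarrow> h q w (u - v) = h q w u - h q w v"
  using diff_left tensor_sym T_diff by metis

lemma zero_left: "v \<in> T q \<Longrightarrow> h q 0 v = 0"
  using scale_left[of v q v 0] by simp

lemma zero_right: "v \<in> T q \<Longrightarrow> h q v 0 = 0"
  using scale_right[of v q v 0] by simp

lemma sum_left: "w \<in> T q \<Longrightarrow> (\<And>i. i \<in> I \<Longrightarrow> u i \<in> T q) \<Longrightarrow> h q (\<Sum>i\<in>I. u i) w = (\<Sum>i\<in>I. h q (u i) w)"
  by (induction I rule: infinite_finite_induct) (simp_all add: zero_left add_left T_sum[OF tangent_points])

lemma sum_right: "w \<in> T q \<Longrightarrow> (\<And>i. i \<in> I \<Longrightarrow> u i \<in> T q) \<Longrightarrow> h q w (\<Sum>i\<in>I. u i) = (\<Sum>i\<in>I. h q w (u i))"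
  by (induction I rule: infinite_finite_induct) (simp_all add: zero_right add_right T_sum[OF tangent_points])

lemma lincomb_left:
  "w \<in> T q \<Longrightarrow> (\<And>i. i \<in> I \<Longrightarrow> u i \<in> T q) \<Longrightarrow> h q (\<Sum>i\<in>I. c i *\<^sub>R u i) w = (\<Sum>i\<in>I. c i * h q (u i) w)"
  by (simp add: sum_left T_scale scale_left)

lemma lincomb_right:
  "w \<in> T q \<Longrightarrow> (\<And>i. i \<in> I \<Longrightarrow> u i \<in> T q) \<Longrightarrow> h q w (\<Sum>i\<in>I. c i *\<^sub>R u i) = (\<Sum>i\<in>I. c i * h q w (u i))"
  by (simp add: sum_right T_scale scale_right)

lemma smooth: "vector_field Q U X \<Longrightarrow> vector_field Q U Y \<Longrightarrow> smooth_fun Q U (\<lambda>q. h q (X q) (Y q))"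
  using symmetric unfolding symmetric_tensor_def by blast

lemma smooth_nearby:
  "vector_field Q U X \<Longrightarrow> vector_field Q U Y \<Longrightarrow> q \<in> U \<Longrightarrow> smooth_near Q q (\<lambda>q. h q (X q) (Y q))"
  using smooth smooth_nearI vf_opn by blast

lemma deriv_sym:
  assumes "A \<in> T q" "vector_field Q U X" "vector_field Q U Y" "q \<in> U"
  shows "A (\<lambda>p. h p (X p) (Y p)) = A (\<lambda>p. h p (Y p) (X p))"
  by (rule tangent_local[OF assms(1) vf_opn[OF assms(2)] assms(4)])
     (use tensor_sym vf_T assms(2,3) in blast)

lemma deriv_add:
  assumes "A \<in> T q" "vector_field Q U X" "vector_field Q U X'" "vector_field Q U Y" "q \<in> U"
  shows "A (\<lambda>p. h p (X p + X' p) (Y p)) = A (\<lambda>p. h p (X p) (Y p)) + A (\<lambda>p. h p (X' p) (Y p))"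
proof -
  have "A (\<lambda>p. h p (X p + X' p) (Y p)) = A (\<lambda>p. h p (X p) (Y p) + h p (X' p) (Y p))"
    by (rule tangent_local[OF assms(1) vf_opn[OF assms(2)] assms(5)])
       (use add_left vf_T assms(2-4) in blast)
  then show ?thesis using tangent_add[OF assms(1) smooth_nearby[OF assms(2,4,5)] smooth_nearby[OF assms(3,4,5)]] by simp
qed

lemma deriv_scale:
  assumes "A \<in> T q" "vector_field Q U X" "vector_field Q U Y" "q \<in> U" "smooth_fun Q U f"
  shows "A (\<lambda>p. h p (f p *\<^sub>R X p) (Y p)) = f q * A (\<lambda>p. h p (X p) (Y p)) + h q (X q) (Y q) * A f"
proof -
  have "A (\<lambda>p. h p (f p *\<^sub>R X p) (Y p)) = A (\<lambda>p. f p * h p (X p) (Y p))"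
    by (rule tangent_local[OF assms(1) vf_opn[OF assms(2)] assms(4)])
       (use scale_left vf_T assms(2,3) in blast)
  then show ?thesis
    using tangent_mult[OF assms(1) smooth_nearI[OF vf_opn[OF assms(2)] assms(4,5)] smooth_nearby[OF assms(2,3,4)]] by simp
qed

lemma deriv_add_right:
  assumes "A \<in> T q" "vector_field Q U X" "vector_field Q U X'" "vector_field Q U Y" "q \<in> U"
  shows "A (\<lambda>p. h p (Y p) (X p + X' p)) = A (\<lambda>p. h p (Y p) (X p)) + A (\<lambda>p. h p (Y p) (X' p))"
  using deriv_add[OF assms] deriv_sym[OF assms(1) assms(4) vf_add[OF assms(2,3)] assms(5)]
    deriv_sym[OF assms(1,4,2,5)] deriv_sym[OF assms(1,4,3,5)] by simp

lemma deriv_scale_right: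
  assumes "A \<in> T q" "vector_field Q U X" "vector_field Q U Y" "q \<in> U" "smooth_fun Q U f"
  shows "A (\<lambda>p. h p (Y p) (f p *\<^sub>R X p)) = f q * A (\<lambda>p. h p (Y p) (X p)) + h q (Y q) (X q) * A f"
  using deriv_scale[OF assms] deriv_sym[OF assms(1,3) vf_scale[OF assms(2,5)] assms(4)]
    deriv_sym[OF assms(1,3,2,4)] tensor_sym[OF vf_T[OF assms(2,4)] vf_T[OF assms(3,4)]] by simp

text \<open>The right-hand side of Koszul's formula, that is, twice the pairing with
  \<open>Z\<close> of the covariant derivative of \<open>Y\<close> along \<open>X\<close>.\<close>

definition koszul :: "('q \<Rightarrow> 'q tvec) \<Rightarrow> ('q \<Rightarrow> 'q tvec) \<Rightarrow> ('q \<Rightarrow> 'q tvec) \<Rightarrow> 'q \<Rightarrow> real" where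
  "koszul X Y Z q = X q (\<lambda>p. h p (Y p) (Z p)) + Y q (\<lambda>p. h p (X p) (Z p)) - Z q (\<lambda>p. h p (X p) (Y p)) +
     h q (lie_bracket Q X Y q) (Z q) - h q (lie_bracket Q X Z q) (Y q) - h q (lie_bracket Q Y Z q) (X q)"

lemma bracket_T: "vector_field Q U X \<Longrightarrow> vector_field Q U Y \<Longrightarrow> q \<in> U \<Longrightarrow> lie_bracket Q X Y q \<in> T q"
  using vf_bracket vf_T by blast

lemma koszul_local:
  assumes X: "vector_field Q U X" and Y: "vector_field Q U Y" and Z: "vector_field Q U Z"
    and V: "opn V" "q \<in> V" "q \<in> U"
    and eq: "\<And>p. p \<in> V \<Longrightarrow> X p = X' p" "\<And>p. p \<in> V \<Longrightarrow> Y p = Y' p" "\<And>p. p \<in> V \<Longrightarrow> Z p = Z' p"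
  shows "koszul X Y Z q = koszul X' Y' Z' q"
proof -
  have d: "A (\<lambda>p. h p (B p) (C p)) = A (\<lambda>p. h p (B' p) (C' p))"
    if "A \<in> T q" "\<And>p. p \<in> V \<Longrightarrow> B p = B' p" "\<And>p. p \<in> V \<Longrightarrow> C p = C' p" for A B B' C C'
    by (rule tangent_local[OF that(1) V(1,2)]) (simp add: that)
  have "lie_bracket Q X Y q = lie_bracket Q X' Y' q" "lie_bracket Q X Z q = lie_bracket Q X' Z' q"
    "lie_bracket Q Y Z q = lie_bracket Q Y' Z' q"
    by (rule lie_bracket_local[OF X Y V], use eq in blast, use eq in blast)
       (rule lie_bracket_local[OF X Z V], use eq in blast, use eq in blast,
        rule lie_bracket_local[OF Y Z V], use eq in blast, use eq in blast)
  then show ?thesis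
    using d[OF vf_T[OF X V(3)] eq(2,3)] d[OF vf_T[OF Y V(3)] eq(1,3)] d[OF vf_T[OF Z V(3)] eq(1,2)]
      eq[OF V(2)] by (simp add: koszul_def)
qed

lemma koszul_smooth:
  assumes X: "vector_field Q U X" and Y: "vector_field Q U Y" and Z: "vector_field Q U Z"
  shows "smooth_fun Q U (koszul X Y Z)"
proof -
  note o = vf_opn[OF X]
  have "smooth_fun Q U (\<lambda>q. X q (\<lambda>p. h p (Y p) (Z p)) + Y q (\<lambda>p. h p (X p) (Z p)) - Z q (\<lambda>p. h p (X p) (Y p)) +
     h q (lie_bracket Q X Y q) (Z q) - h q (lie_bracket Q X Z q) (Y q) - h q (lie_bracket Q Y Z q) (X q))"
    by (intro smooth_fun_add[OF o] smooth_fun_diff[OF o] vf_smooth_same[OF X] vf_smooth_same[OF Y]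
        vf_smooth_same[OF Z] smooth vf_bracket X Y Z)
  then show ?thesis by (simp add: koszul_def[abs_def])
qed

lemma koszul_add_third:
  assumes X: "vector_field Q U X" and Y: "vector_field Q U Y" and Z: "vector_field Q U Z" "vector_field Q U Z'" and q: "q \<in> U"
  shows "koszul X Y (\<lambda>p. Z p + Z' p) q = koszul X Y Z q + koszul X Y Z' q"
  using deriv_add_right[OF vf_T[OF X q] Z Y q] deriv_add_right[OF vf_T[OF Y q] Z X q]
    lie_bracket_add_right[OF X Z q] lie_bracket_add_right[OF Y Z q]
    vf_T[OF X q] vf_T[OF Y q] vf_T[OF Z(1) q] vf_T[OF Z(2) q]
    bracket_T[OF X Y q] bracket_T[OF X Z(1) q] bracket_T[OF X Z(2) q] bracket_T[OF Y Z(1) q] bracket_T[OF Y Z(2) q]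
  by (simp add: koszul_def plus_fun_apply add_right add_left)

text \<open>The derivatives of \<open>f\<close> coming from the metric terms cancel those coming
  from the brackets. Linearity over functions in the third argument is what allows the expression to
  be represented by a vector at \<open>q\<close>.\<close>

lemma koszul_scale_third:
  assumes X: "vector_field Q U X" and Y: "vector_field Q U Y" and Z: "vector_field Q U Z" and q: "q \<in> U"
    and f: "smooth_fun Q U f"
  shows "koszul X Y (\<lambda>p. f p *\<^sub>R Z p) q = f q * koszul X Y Z q"
  using deriv_scale_right[OF vf_T[OF X q] Z Y q f] deriv_scale_right[OF vf_T[OF Y q] Z X q f]
    lie_bracket_scale_right[OF X Z f q] lie_bracket_scale_right[OF Y Z f q]
    vf_T[OF X q] vf_T[OF Y q] vf_T[OF Z(1) q]
    bracket_T[OF X Y q] bracket_T[OF X Z q] bracket_T[OF Y Z q] tensor_sym[OF vf_T[OF X q] vf_T[OF Z q]] tensor_sym[OF vf_T[OF Y q] vf_T[OF Z q]]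
  by (simp add: koszul_def scaleR_fun_def[THEN fun_cong] add_left scale_left scale_right T_scale algebra_simps)

text \<open>This identity becomes torsion-freeness of the connection, and
  \<open>koszul_metric\<close> becomes its compatibility with the metric.\<close>

lemma koszul_torsion:
  assumes X: "vector_field Q U X" and Y: "vector_field Q U Y" and Z: "vector_field Q U Z" and q: "q \<in> U"
  shows "koszul X Y Z q - koszul Y X Z q = 2 * h q (lie_bracket Q X Y q) (Z q)"
  using deriv_sym[OF vf_T[OF Z q] X Y q] lie_bracket_antisym[of Y X q]
    scale_left[OF bracket_T[OF X Y q] vf_T[OF Z q], of "-1"]
  by (simp add: koszul_def)

lemma koszul_metric:
  assumes X: "vector_field Q U X" and Y: "vector_field Q U Y" and Z: "vector_field Q U Z" and q: "q \<in> U"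
  shows "koszul X Y Z q + koszul X Z Y q = 2 * X q (\<lambda>p. h p (Y p) (Z p))"
  using deriv_sym[OF vf_T[OF X q] Y Z q] lie_bracket_antisym[of Z Y q] 
    scale_left[OF bracket_T[OF Y Z q] vf_T[OF X q], of "-1"]
  by (simp add: koszul_def)

lemma koszul_add_first:
  assumes X: "vector_field Q U X" "vector_field Q U X'" and Y: "vector_field Q U Y" and Z: "vector_field Q U Z" and q: "q \<in> U"
  shows "koszul (\<lambda>p. X p + X' p) Y Z q = koszul X Y Z q + koszul X' Y Z q"
  using deriv_add[OF vf_T[OF Y q] X Z q] deriv_add[OF vf_T[OF Z q] X Y q]
    lie_bracket_add[OF X Y q] lie_bracket_add[OF X Z q]
    vf_T[OF X(1) q] vf_T[OF X(2) q] vf_T[OF Y q] vf_T[OF Z q]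
    bracket_T[OF X(1) Y q] bracket_T[OF X(2) Y q] bracket_T[OF X(1) Z q] bracket_T[OF X(2) Z q] bracket_T[OF Y Z q]
  by (simp add: koszul_def plus_fun_apply add_right add_left)

lemma koszul_scale_first:
  assumes X: "vector_field Q U X" and Y: "vector_field Q U Y" and Z: "vector_field Q U Z" and q: "q \<in> U"
    and f: "smooth_fun Q U f"
  shows "koszul (\<lambda>p. f p *\<^sub>R X p) Y Z q = f q * koszul X Y Z q"
proof -
  note T = vf_T[OF X q] vf_T[OF Y q] vf_T[OF Z q] bracket_T[OF X Y q] bracket_T[OF X Z q] bracket_T[OF Y Z q]
  have "h q (lie_bracket Q (\<lambda>p. f p *\<^sub>R X p) Y q) (Z q) = f q * h q (lie_bracket Q X Y q) (Z q) - Y q f * h q (X q) (Z q)"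
    "h q (lie_bracket Q (\<lambda>p. f p *\<^sub>R X p) Z q) (Y q) = f q * h q (lie_bracket Q X Z q) (Y q) - Z q f * h q (X q) (Y q)"
    using T by (simp_all add: lie_bracket_scale[OF X _ f q] Y Z diff_left scale_left T_scale)
  then show ?thesis
    using deriv_scale[OF vf_T[OF Y q] X Z q f] deriv_scale[OF vf_T[OF Z q] X Y q f] T
    by (simp add: koszul_def scaleR_fun_def[THEN fun_cong] scale_right algebra_simps)
qed

text \<open>Reduced to additivity in the first argument: exchanging the first two arguments costs
  only a bracket term. The scaling rule that follows is obtained in the same way.\<close>

lemma koszul_add_second:
  assumes X: "vector_field Q U X" and Y: "vector_field Q U Y" "vector_field Q U Y'" and Z: "vector_field Q U Z" and q: "q \<in> U"
  shows "koszul X (\<lambda>p. Y p + Y' p) Z q = koszul X Y Z q + koszul X Y' Z q"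
  using koszul_torsion[OF X vf_add[OF Y] Z q] koszul_torsion[OF X Y(1) Z q] koszul_torsion[OF X Y(2) Z q]
    koszul_add_first[OF Y X Z q] lie_bracket_add_right[OF X Y q]
    add_left[OF bracket_T[OF X Y(1) q] bracket_T[OF X Y(2) q] vf_T[OF Z q]]
  by simp

lemma koszul_scale_second:
  assumes X: "vector_field Q U X" and Y: "vector_field Q U Y" and Z: "vector_field Q U Z" and q: "q \<in> U"
    and f: "smooth_fun Q U f"
  shows "koszul X (\<lambda>p. f p *\<^sub>R Y p) Z q = f q * koszul X Y Z q + 2 * X q f * h q (Y q) (Z q)"
proof -
  have "h q (lie_bracket Q X (\<lambda>p. f p *\<^sub>R Y p) q) (Z q) = f q * h q (lie_bracket Q X Y q) (Z q) + X q f * h q (Y q) (Z q)"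
    using bracket_T[OF X Y q] vf_T[OF Y q] vf_T[OF Z q]
    by (simp add: lie_bracket_scale_right[OF X Y f q] add_left scale_left T_scale)
  moreover have "koszul X (\<lambda>p. f p *\<^sub>R Y p) Z q = f q * koszul Y X Z q + 2 * h q (lie_bracket Q X (\<lambda>p. f p *\<^sub>R Y p) q) (Z q)"
    using koszul_torsion[OF X vf_scale[OF Y f] Z q] koszul_scale_first[OF Y X Z q f] by simp
  moreover have "koszul X Y Z q = koszul Y X Z q + 2 * h q (lie_bracket Q X Y q) (Z q)"
    using koszul_torsion[OF X Y Z q] by simp
  ultimately show ?thesis by (simp add: algebra_simps)
qed

lemma koszul_lincomb_third:
  assumes X: "vector_field Q U X" and Y: "vector_field Q U Y" and Z: "\<And>i. i \<in> I \<Longrightarrow> vector_field Q U (Z i)" and q: "q \<in> U"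
    and f: "\<And>i. i \<in> I \<Longrightarrow> smooth_fun Q U (f i)" and I: "finite I"
  shows "koszul X Y (\<lambda>p. \<Sum>i\<in>I. f i p *\<^sub>R Z i p) q = (\<Sum>i\<in>I. f i q * koszul X Y (Z i) q)"
  using I Z f
proof (induction I)
  case empty
  \<comment> \<open>The zero field is \<open>0\<close> times any field, so the scaling rule covers
    the empty sum.\<close>
  show ?case using koszul_scale_third[OF X Y X q smooth_fun_const[OF vf_opn[OF X]], of 0]
    by (simp only: sum.empty scaleR_zero_left mult_zero_left)
next
  case (insert i I)
  have "vector_field Q U (\<lambda>p. \<Sum>i\<in>I. f i p *\<^sub>R Z i p)" "vector_field Q U (\<lambda>p. f i p *\<^sub>R Z i p)"
    using insert.prems by (auto intro!: vf_lincomb vf_scale vf_opn[OF X])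
  note add = koszul_add_third[OF X Y this(2,1) q]
  have IH: "koszul X Y (\<lambda>p. \<Sum>i\<in>I. f i p *\<^sub>R Z i p) q = (\<Sum>i\<in>I. f i q * koszul X Y (Z i) q)"
    using insert by blast
  have scale: "koszul X Y (\<lambda>p. f i p *\<^sub>R Z i p) q = f i q * koszul X Y (Z i) q"
    using koszul_scale_third[OF X Y _ q, of "Z i" "f i"] insert.prems by blast
  show ?case by (simp only: sum.insert[OF insert.hyps(1,2)] add IH scale)
qed

end

section \<open>Existence of the Levi-Civita connection\<close>

locale riemannian_atlas = tensor_atlas Q h for Q :: "('q, 'e::euclidean_space) atlas" and h +
  assumes posdef: "v \<in> tangent_space Q q \<Longrightarrow> v \<noteq> 0 \<Longrightarrow> h q v v > 0"
begin

text \<open>The difference of the two vectors pairs to zero with the frame, hence with itself, and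
  definiteness makes it vanish.\<close>

lemma frame_eqI:
  assumes E: "local_frame Q U E" "q \<in> U" and u: "u \<in> T q" "v \<in> T q"
    and eq: "\<And>i. i < DIM('e) \<Longrightarrow> h q u (E i q) = h q v (E i q)"
  shows "u = v"
proof -
  let ?d = "u - v"
  have d: "?d \<in> T q" using u T_diff by blast
  have "h q ?d (E i q) = 0" if "i < DIM('e)" for i
    using eq[OF that] diff_left[OF u lf_T[OF E(1) that E(2)]] by simp
  then have "h q ?d (\<Sum>i<DIM('e). quasi_velocity DIM('e) E i (q, ?d) *\<^sub>R E i q) = 0"
    using lf_T[OF E(1) _ E(2)] by (subst lincomb_right[OF d]) auto
  then have "h q ?d ?d = 0" unfolding qv_expand[OF E d] .
  then show ?thesis using posdef[OF d] by auto
qed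

lemma gram_kernel:
  assumes E: "local_frame Q U E" "q \<in> U" and y: "\<forall>i<DIM('e). (\<Sum>j<DIM('e). h q (E j q) (E i q) * y j) = 0"
  shows "\<forall>j<DIM('e). y j = 0"
proof -
  have pts: "q \<in> points Q" using E lf_opn opn_points by blast
  have "(\<Sum>j<DIM('e). y j *\<^sub>R E j q) = 0"
  proof (rule frame_eqI[OF E])
    show "(\<Sum>j<DIM('e). y j *\<^sub>R E j q) \<in> T q" using lf_T[OF E(1) _ E(2)] pts by (intro T_sum T_scale) auto
    fix i assume "i < DIM('e)"
    then have Ei: "E i q \<in> T q" using lf_T[OF E(1) _ E(2)] by blast
    have "h q (\<Sum>j<DIM('e). y j *\<^sub>R E j q) (E i q) = (\<Sum>j<DIM('e). y j * h q (E j q) (E i q))"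
      by (rule lincomb_left[OF Ei]) (use lf_T[OF E(1) _ E(2)] in auto)
    then show "h q (\<Sum>j<DIM('e). y j *\<^sub>R E j q) (E i q) = h q 0 (E i q)"
      using y \<open>i < DIM('e)\<close> zero_left[OF Ei] by (simp add: mult.commute)
  qed (rule T_zero[OF pts])
  then show ?thesis using frame_independent[OF E, of y "\<lambda>_. 0"] by simp
qed

text \<open>Solving the Gram system of a local frame at \<open>q\<close> produces a vector with the
  right pairings against the frame fields. Linearity of \<open>koszul\<close> over functions extends
  this to every field \<open>Z\<close>.\<close>

lemma levi_civita_at:
  assumes X: "vector_field Q U X" and Y: "vector_field Q U Y" and q: "q \<in> U"
  shows "\<exists>w\<in>T q. \<forall>V Z. vector_field Q V Z \<and> q \<in> V \<longrightarrow> 2 * h q w (Z q) = koszul X Y Z q"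
proof -
  have pts: "q \<in> points Q" using q vf_opn[OF X] opn_points by blast
  obtain U0 E where E: "local_frame Q U0 E" "q \<in> U0" using local_frame_ex[OF pts] .
  have "\<exists>x. \<forall>i<DIM('e). (\<Sum>j<DIM('e). (case (i, j) of (i, j) \<Rightarrow> h q (E j q) (E i q)) * x j) = koszul X Y (E i) q / 2"
    by (rule solve_ex) (use gram_kernel[OF E] in auto)
  then obtain x where x: "\<And>i. i < DIM('e) \<Longrightarrow> (\<Sum>j<DIM('e). h q (E j q) (E i q) * x j) = koszul X Y (E i) q / 2"
    by auto
  define w where "w = (\<Sum>j<DIM('e). x j *\<^sub>R E j q)"
  have w: "w \<in> T q" unfolding w_def using lf_T[OF E(1) _ E(2)] pts by (intro T_sum T_scale) auto
  have wE: "h q w (E i q) = koszul X Y (E i) q / 2" if "i < DIM('e)" for i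
  proof -
    have "h q w (E i q) = (\<Sum>j<DIM('e). x j * h q (E j q) (E i q))"
      unfolding w_def by (rule lincomb_left) (use lf_T[OF E(1) _ E(2)] that in auto)
    then show ?thesis using x[OF that] by (simp add: mult.commute)
  qed
  have "2 * h q w (Z q) = koszul X Y Z q" if Z: "vector_field Q V Z" and qV: "q \<in> V" for V Z
  proof -
    let ?W = "U \<inter> V \<inter> U0"
    let ?f = "\<lambda>i p. quasi_velocity DIM('e) E i (p, Z p)"
    have o: "opn ?W" using vf_opn[OF X] vf_opn[OF Z] lf_opn[OF E(1)] by blast
    have qW: "q \<in> ?W" using q qV E by simp
    note XW = vf_subset[OF X o] and YW = vf_subset[OF Y o] and ZW = vf_subset[OF Z o]
    have EW: "vector_field Q ?W (E i)" if "i < DIM('e)" for i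
      using vf_subset[OF lf_vf[OF E(1) that] o] by blast
    have f: "smooth_fun Q ?W (?f i)" if "i < DIM('e)" for i
      by (rule smooth_qv_field[OF E(1) ZW _ that]) auto
    \<comment> \<open>\<open>Z\<close> agrees with its frame expansion only on \<open>?W\<close>, so
      locality of \<open>koszul\<close> is needed before linearity can be applied.\<close>
    have "koszul X Y Z q = koszul X Y (\<lambda>p. \<Sum>i<DIM('e). ?f i p *\<^sub>R E i p) q"
      by (rule koszul_local[OF XW YW ZW o qW qW])
         (use qv_expand[OF E(1)] vf_T[OF Z] in auto)
    also have "\<dots> = (\<Sum>i<DIM('e). ?f i q * koszul X Y (E i) q)"
      by (rule koszul_lincomb_third[OF XW YW EW qW f]) auto
    also have "\<dots> = (\<Sum>i<DIM('e). ?f i q * (2 * h q w (E i q)))"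
      by (rule sum.cong) (simp_all add: wE)
    also have "\<dots> = 2 * h q w (\<Sum>i<DIM('e). ?f i q *\<^sub>R E i q)"
      using lf_T[OF E(1) _ E(2)] by (subst lincomb_right[OF w]) (auto simp: sum_distrib_left mult.left_commute)
    finally show ?thesis using qv_expand[OF E vf_T[OF Z qV]] by simp
  qed
  then show ?thesis using w by blast
qed

text \<open>A choice made point by point; for smooth \<open>X\<close> and \<open>Y\<close> the
  pairings determine it, and smoothness in the point is proved afterwards in
  \<open>lc_vf\<close>.\<close>

definition lc :: "('q \<Rightarrow> 'q tvec) \<Rightarrow> ('q \<Rightarrow> 'q tvec) \<Rightarrow> 'q \<Rightarrow> 'q tvec" where
  "lc X Y q = (SOME w. w \<in> T q \<and> (\<forall>V Z. vector_field Q V Z \<and> q \<in> V \<longrightarrow> 2 * h q w (Z q) = koszul X Y Z q))"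

lemma lc:
  assumes X: "vector_field Q U X" and Y: "vector_field Q U Y" and q: "q \<in> U"
  shows "lc X Y q \<in> T q" "\<And>V Z. vector_field Q V Z \<Longrightarrow> q \<in> V \<Longrightarrow> 2 * h q (lc X Y q) (Z q) = koszul X Y Z q"
proof -
  have "\<exists>w. w \<in> T q \<and> (\<forall>V Z. vector_field Q V Z \<and> q \<in> V \<longrightarrow> 2 * h q w (Z q) = koszul X Y Z q)"
    using levi_civita_at[OF X Y q] by blast
  from someI_ex[OF this]
  show "lc X Y q \<in> T q" "\<And>V Z. vector_field Q V Z \<Longrightarrow> q \<in> V \<Longrightarrow> 2 * h q (lc X Y q) (Z q) = koszul X Y Z q"
    unfolding lc_def by blast+
qed

lemma lc_eqI:
  assumes X: "vector_field Q U X" and Y: "vector_field Q U Y" and q: "q \<in> U" and w: "w \<in> T q"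
    and eq: "\<And>V Z. vector_field Q V Z \<Longrightarrow> V \<subseteq> U \<Longrightarrow> q \<in> V \<Longrightarrow> 2 * h q w (Z q) = koszul X Y Z q"
  shows "lc X Y q = w"
proof -
  have pts: "q \<in> points Q" using q vf_opn[OF X] opn_points by blast
  obtain U0 E where E: "local_frame Q U0 E" "q \<in> U0" using local_frame_ex[OF pts] .
  have o: "opn (U \<inter> U0)" using vf_opn[OF X] lf_opn[OF E(1)] by blast
  show ?thesis
  proof (rule frame_eqI[OF E lc(1)[OF X Y q] w])
    fix i assume i: "i < DIM('e)"
    have Ei: "vector_field Q (U \<inter> U0) (E i)" using vf_subset[OF lf_vf[OF E(1) i] o] by blast
    show "h q (lc X Y q) (E i q) = h q w (E i q)"
      using eq[OF Ei] lc(2)[OF X Y q Ei] q E(2) by simp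
  qed
qed

text \<open>The frame components solve the Gram system with half the \<open>koszul\<close> values on
  the right. All of these are smooth, so Cramer's rule applies.\<close>

lemma lc_vf:
  assumes X: "vector_field Q U X" and Y: "vector_field Q U Y"
  shows "vector_field Q U (lc X Y)"
proof (rule vf_local[OF vf_opn[OF X]])
  fix q assume q: "q \<in> U"
  have pts: "q \<in> points Q" using q vf_opn[OF X] opn_points by blast
  obtain U0 E where E: "local_frame Q U0 E" "q \<in> U0" using local_frame_ex[OF pts] .
  let ?W = "U \<inter> U0"
  have o: "opn ?W" using vf_opn[OF X] lf_opn[OF E(1)] by blast
  have EW: "vector_field Q ?W (E i)" if "i < DIM('e)" for i
    using vf_subset[OF lf_vf[OF E(1) that] o] by blast
  let ?f = "\<lambda>i p. quasi_velocity DIM('e) E i (p, lc X Y p)"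
  have f: "smooth_fun Q ?W (?f k)" if k: "k < DIM('e)" for k
  proof (rule smooth_fun_solve[where a = "\<lambda>p (i, j). h p (E j p) (E i p)" and b = "\<lambda>i p. (1/2) * koszul X Y (E i) p"
        and x = ?f, OF o _ _ _ _ k])
    show "smooth_fun Q ?W (\<lambda>p. case (i, j) of (i, j) \<Rightarrow> h p (E j p) (E i p))" if "i < DIM('e)" "j < DIM('e)" for i j
      using smooth[OF EW EW] that by simp
    show "smooth_fun Q ?W (\<lambda>p. (1/2) * koszul X Y (E i) p)" if "i < DIM('e)" for i
      by (intro smooth_fun_cmult o koszul_smooth vf_subset[OF X o] vf_subset[OF Y o] EW that) auto
    show "(\<Sum>j<DIM('e). (case (i, j) of (i, j) \<Rightarrow> h p (E j p) (E i p)) * ?f j p) = (1/2) * koszul X Y (E i) p"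
      if p: "p \<in> ?W" and i: "i < DIM('e)" for p i
    proof -
      have pU: "p \<in> U" "p \<in> U0" using p by auto
      have "koszul X Y (E i) p = 2 * h p (\<Sum>j<DIM('e). ?f j p *\<^sub>R E j p) (E i p)"
        using lc(2)[OF X Y pU(1) EW[OF i] p] qv_expand[OF E(1) pU(2) lc(1)[OF X Y pU(1)]] by simp
      moreover have "h p (\<Sum>j<DIM('e). ?f j p *\<^sub>R E j p) (E i p) = (\<Sum>j<DIM('e). ?f j p * h p (E j p) (E i p))"
        by (rule lincomb_left) (use lf_T[OF E(1) _ pU(2)] i in auto)
      ultimately show ?thesis by (simp add: mult.commute)
    qed
    show "\<forall>j<DIM('e). y j = 0" if "p \<in> ?W" "\<forall>i<DIM('e). (\<Sum>j<DIM('e). (case (i, j) of (i, j) \<Rightarrow> h p (E j p) (E i p)) * y j) = 0" for p y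
      using gram_kernel[OF E(1), of p y] that by simp
  qed
  have "vector_field Q ?W (lc X Y)"
  proof (rule vf_cong)
    show "vector_field Q ?W (\<lambda>p. \<Sum>i<DIM('e). ?f i p *\<^sub>R E i p)" using f EW by (intro vf_lincomb o) auto
    show "(\<Sum>i<DIM('e). ?f i p *\<^sub>R E i p) = lc X Y p" if "p \<in> ?W" for p
      using qv_expand[OF E(1) _ lc(1)[OF X Y]] that by blast
  qed
  then show "\<exists>V. q \<in> V \<and> vector_field Q V (lc X Y)" using q E by blast
qed

lemma lc_affine: "affine_connection Q lc"
  unfolding affine_connection_def
proof (intro conjI allI impI ballI; elim conjE)
  show "vector_field Q U (lc X Y)" if "vector_field Q U X" "vector_field Q U Y" for U X Y
    using lc_vf that .
next
  fix U X X' Y Y' q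
  assume X: "vector_field Q U X" "vector_field Q U X'" and Y: "vector_field Q U Y" "vector_field Q U Y'"
    and eq: "\<forall>q\<in>U. X q = X' q \<and> Y q = Y' q" and q: "q \<in> U"
  show "lc X Y q = lc X' Y' q"
  proof (rule lc_eqI[OF X(1) Y(1) q lc(1)[OF X(2) Y(2) q]])
    fix V Z assume V: "vector_field Q V Z" "V \<subseteq> U" "q \<in> V"
    note oV = vf_opn[OF V(1)]
    have "koszul X Y Z q = koszul X' Y' Z q"
      by (rule koszul_local[OF vf_subset[OF X(1) oV V(2)] vf_subset[OF Y(1) oV V(2)] V(1) oV V(3) V(3)])
         (use eq V(2) in auto)
    then show "2 * h q (lc X' Y' q) (Z q) = koszul X Y Z q"
      using lc(2)[OF X(2) Y(2) q V(1,3)] by simp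
  qed
next
  fix U X X' Y f q
  assume X: "vector_field Q U X" "vector_field Q U X'" and Y: "vector_field Q U Y"
    and f: "smooth_fun Q U f" and q: "q \<in> U"
  show "lc (\<lambda>p. X p + X' p) Y q = lc X Y q + lc X' Y q"
  proof (rule lc_eqI[OF vf_add[OF X] Y q])
    show "lc X Y q + lc X' Y q \<in> T q" using lc(1)[OF _ Y q] X T_add by blast
    fix V Z assume V: "vector_field Q V Z" "V \<subseteq> U" "q \<in> V"
    note sub = vf_subset[OF _ vf_opn[OF V(1)] V(2)]
    show "2 * h q (lc X Y q + lc X' Y q) (Z q) = koszul (\<lambda>p. X p + X' p) Y Z q"
      using koszul_add_first[OF sub[OF X(1)] sub[OF X(2)] sub[OF Y] V(1,3)]
        lc(2)[OF X(1) Y q V(1,3)] lc(2)[OF X(2) Y q V(1,3)]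
        add_left[OF lc(1)[OF X(1) Y q] lc(1)[OF X(2) Y q] vf_T[OF V(1,3)]] by simp
  qed
next
  fix U X X' Y f q
  assume X: "vector_field Q U X" "vector_field Q U X'" and Y: "vector_field Q U Y"
    and f: "smooth_fun Q U f" and q: "q \<in> U"
  show "lc (\<lambda>p. f p *\<^sub>R X p) Y q = f q *\<^sub>R lc X Y q"
  proof (rule lc_eqI[OF vf_scale[OF X(1) f] Y q])
    show "f q *\<^sub>R lc X Y q \<in> T q" using lc(1)[OF X(1) Y q] T_scale by blast
    fix V Z assume V: "vector_field Q V Z" "V \<subseteq> U" "q \<in> V"
    note sub = vf_subset[OF _ vf_opn[OF V(1)] V(2)]
    show "2 * h q (f q *\<^sub>R lc X Y q) (Z q) = koszul (\<lambda>p. f p *\<^sub>R X p) Y Z q"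
      using koszul_scale_first[OF sub[OF X(1)] sub[OF Y] V(1,3) smooth_fun_subset[OF f V(2)]]
        lc(2)[OF X(1) Y q V(1,3)]
        scale_left[OF lc(1)[OF X(1) Y q] vf_T[OF V(1,3)]] by simp
  qed
next
  fix U X Y Y' f q
  assume X: "vector_field Q U X" and Y: "vector_field Q U Y" "vector_field Q U Y'"
    and f: "smooth_fun Q U f" and q: "q \<in> U"
  show "lc X (\<lambda>p. Y p + Y' p) q = lc X Y q + lc X Y' q"
  proof (rule lc_eqI[OF X vf_add[OF Y] q])
    show "lc X Y q + lc X Y' q \<in> T q" using lc(1)[OF X _ q] Y T_add by blast
    fix V Z assume V: "vector_field Q V Z" "V \<subseteq> U" "q \<in> V"
    note sub = vf_subset[OF _ vf_opn[OF V(1)] V(2)]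
    show "2 * h q (lc X Y q + lc X Y' q) (Z q) = koszul X (\<lambda>p. Y p + Y' p) Z q"
      using koszul_add_second[OF sub[OF X] sub[OF Y(1)] sub[OF Y(2)] V(1,3)]
        lc(2)[OF X Y(1) q V(1,3)] lc(2)[OF X Y(2) q V(1,3)]
        add_left[OF lc(1)[OF X Y(1) q] lc(1)[OF X Y(2) q] vf_T[OF V(1,3)]] by simp
  qed
next
  fix U X Y Y' f q
  assume X: "vector_field Q U X" and Y: "vector_field Q U Y" "vector_field Q U Y'"
    and f: "smooth_fun Q U f" and q: "q \<in> U"
  show "lc X (\<lambda>p. f p *\<^sub>R Y p) q = X q f *\<^sub>R Y q + f q *\<^sub>R lc X Y q"
  proof (rule lc_eqI[OF X vf_scale[OF Y(1) f] q])
    note 1 = lc(1)[OF X Y(1) q] and 2 = vf_T[OF Y(1) q]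
    show "X q f *\<^sub>R Y q + f q *\<^sub>R lc X Y q \<in> T q" using 1 2 T_scale T_add by blast
    fix V Z assume V: "vector_field Q V Z" "V \<subseteq> U" "q \<in> V"
    note sub = vf_subset[OF _ vf_opn[OF V(1)] V(2)]
    show "2 * h q (X q f *\<^sub>R Y q + f q *\<^sub>R lc X Y q) (Z q) = koszul X (\<lambda>p. f p *\<^sub>R Y p) Z q"
      using koszul_scale_second[OF sub[OF X] sub[OF Y(1)] V(1,3) smooth_fun_subset[OF f V(2)]]
        lc(2)[OF X Y(1) q V(1,3)] 1 2 vf_T[OF V(1,3)]
      by (simp add: add_left scale_left T_scale algebra_simps)
  qed
qed

abbreviation nabla :: "('q \<Rightarrow> 'q tvec) \<Rightarrow> ('q \<Rightarrow> 'q tvec) \<Rightarrow> 'q \<Rightarrow> 'q tvec" where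
  "nabla \<equiv> levi_civita Q h"

text \<open>The operator \<open>lc\<close> witnesses that the choice in \<open>levi_civita\<close>
  is made from a nonempty set, so the chosen connection has the defining properties. From here on
  only these properties are used.\<close>

lemma levi_civita_properties:
  "affine_connection Q nabla"
  "\<And>U X Y q. vector_field Q U X \<Longrightarrow> vector_field Q U Y \<Longrightarrow> q \<in> U \<Longrightarrow>
     nabla X Y q - nabla Y X q = lie_bracket Q X Y q"
  "\<And>U X Y Z q. vector_field Q U X \<Longrightarrow> vector_field Q U Y \<Longrightarrow> vector_field Q U Z \<Longrightarrow> q \<in> U \<Longrightarrow>
     X q (\<lambda>p. h p (Y p) (Z p)) = h q (nabla X Y q) (Z q) + h q (Y q) (nabla X Z q)"
proof -
  let ?P = "\<lambda>N. affine_connection Q N \<and>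
     (\<forall>U X Y. vector_field Q U X \<and> vector_field Q U Y \<longrightarrow>
        (\<forall>q\<in>U. N X Y q - N Y X q = lie_bracket Q X Y q)) \<and>
     (\<forall>U X Y Z. vector_field Q U X \<and> vector_field Q U Y \<and> vector_field Q U Z \<longrightarrow>
        (\<forall>q\<in>U. X q (\<lambda>p. h p (Y p) (Z p)) = h q (N X Y q) (Z q) + h q (Y q) (N X Z q)))"
  have "?P lc"
  proof (intro conjI allI impI ballI lc_affine; elim conjE)
    fix U X Y q assume X: "vector_field Q U X" and Y: "vector_field Q U Y" and q: "q \<in> U"
    have "lc X Y q = lc Y X q + lie_bracket Q X Y q"
    proof (rule lc_eqI[OF X Y q])
      show "lc Y X q + lie_bracket Q X Y q \<in> T q" using lc(1)[OF Y X q] bracket_T[OF X Y q] T_add by blast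
      fix V Z assume V: "vector_field Q V Z" "V \<subseteq> U" "q \<in> V"
      note sub = vf_subset[OF _ vf_opn[OF V(1)] V(2)]
      show "2 * h q (lc Y X q + lie_bracket Q X Y q) (Z q) = koszul X Y Z q"
        using koszul_torsion[OF sub[OF X] sub[OF Y] V(1,3)] lc(2)[OF Y X q V(1,3)]
          add_left[OF lc(1)[OF Y X q] bracket_T[OF X Y q] vf_T[OF V(1,3)]] by simp
    qed
    then show "lc X Y q - lc Y X q = lie_bracket Q X Y q" by simp
  next
    fix U X Y Z q assume X: "vector_field Q U X" and Y: "vector_field Q U Y" and Z: "vector_field Q U Z" and q: "q \<in> U"
    show "X q (\<lambda>p. h p (Y p) (Z p)) = h q (lc X Y q) (Z q) + h q (Y q) (lc X Z q)"
      using koszul_metric[OF X Y Z q] lc(2)[OF X Y q Z q] lc(2)[OF X Z q Y q]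
        tensor_sym[OF vf_T[OF Y q] lc(1)[OF X Z q]] by simp
  qed
  then have "\<exists>N. ?P N" by blast
  from someI_ex[OF this] have *: "?P nabla" unfolding levi_civita_def .
  show "affine_connection Q nabla" using * by blast
  show "nabla X Y q - nabla Y X q = lie_bracket Q X Y q"
    if "vector_field Q U X" "vector_field Q U Y" "q \<in> U" for U X Y q using * that by blast
  show "X q (\<lambda>p. h p (Y p) (Z p)) = h q (nabla X Y q) (Z q) + h q (Y q) (nabla X Z q)"
    if "vector_field Q U X" "vector_field Q U Y" "vector_field Q U Z" "q \<in> U" for U X Y Z q using * that by blast
qed

lemmas connection = levi_civita_properties(1)[unfolded affine_connection_def]

lemma nabla_vf: "vector_field Q U X \<Longrightarrow> vector_field Q U Y \<Longrightarrow> vector_field Q U (nabla X Y)"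
  by (rule connection[THEN conjunct1, rule_format, OF conjI])

lemma nabla_T: "vector_field Q U X \<Longrightarrow> vector_field Q U Y \<Longrightarrow> q \<in> U \<Longrightarrow> nabla X Y q \<in> T q"
  by (rule vf_T[OF nabla_vf])

lemma nabla_left:
  assumes "vector_field Q U X" "vector_field Q U X'" "vector_field Q U Y" "smooth_fun Q U f" "q \<in> U"
  shows "nabla (\<lambda>p. X p + X' p) Y q = nabla X Y q + nabla X' Y q"
    "nabla (\<lambda>p. f p *\<^sub>R X p) Y q = f q *\<^sub>R nabla X Y q"
  using connection[THEN conjunct2, THEN conjunct2, THEN conjunct1, rule_format,
      OF conjI[OF assms(1) conjI[OF assms(2) conjI[OF assms(3,4)]]] assms(5)]
  by (rule conjunct1, rule conjunct2)

lemma nabla_right: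
  assumes "vector_field Q U X" "vector_field Q U Y" "vector_field Q U Y'" "smooth_fun Q U f" "q \<in> U"
  shows "nabla X (\<lambda>p. Y p + Y' p) q = nabla X Y q + nabla X Y' q"
    "nabla X (\<lambda>p. f p *\<^sub>R Y p) q = X q f *\<^sub>R Y q + f q *\<^sub>R nabla X Y q"
  using connection[THEN conjunct2, THEN conjunct2, THEN conjunct2, rule_format,
      OF conjI[OF assms(1) conjI[OF assms(2) conjI[OF assms(3,4)]]] assms(5)]
  by (rule conjunct1, rule conjunct2)

lemma nabla_lincomb:
  assumes X: "\<And>i. i \<in> I \<Longrightarrow> vector_field Q U (X i)" and c: "\<And>i. i \<in> I \<Longrightarrow> smooth_fun Q U (c i)"
    and q: "q \<in> U" and I: "finite I" and o: "opn U"
  defines "V \<equiv> \<lambda>p. \<Sum>i\<in>I. c i p *\<^sub>R X i p"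
  shows "nabla V V q = (\<Sum>j\<in>I. V q (c j) *\<^sub>R X j q) + (\<Sum>j\<in>I. \<Sum>i\<in>I. (c i q * c j q) *\<^sub>R nabla (X i) (X j) q)"
proof -
  have left: "nabla (\<lambda>p. \<Sum>i\<in>J. c i p *\<^sub>R X i p) Y q = (\<Sum>i\<in>J. c i q *\<^sub>R nabla (X i) Y q)"
    if Y: "vector_field Q U Y" and J: "finite J" "J \<subseteq> I" for Y J
    using J
  proof (induction J)
    case empty
    show ?case using nabla_left(2)[OF Y Y Y smooth_fun_const[OF o] q, of 0]
      by (simp only: sum.empty scaleR_zero_left)
  next
    case (insert i J)
    have Xi: "vector_field Q U (X i)" and ci: "smooth_fun Q U (c i)" using X c insert by blast+
    have s: "vector_field Q U (\<lambda>p. \<Sum>i\<in>J. c i p *\<^sub>R X i p)"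
      using X c insert by (intro vf_lincomb o) auto
    have IH: "nabla (\<lambda>p. \<Sum>i\<in>J. c i p *\<^sub>R X i p) Y q = (\<Sum>i\<in>J. c i q *\<^sub>R nabla (X i) Y q)"
      using insert by blast
    show ?case
      by (simp only: sum.insert[OF insert.hyps(1,2)] IH nabla_left(1)[OF vf_scale[OF Xi ci] s Y ci q]
          nabla_left(2)[OF Xi Xi Y ci q])
  qed
  have right: "nabla Y (\<lambda>p. \<Sum>i\<in>J. c i p *\<^sub>R X i p) q = (\<Sum>i\<in>J. Y q (c i) *\<^sub>R X i q + c i q *\<^sub>R nabla Y (X i) q)"
    if Y: "vector_field Q U Y" and J: "finite J" "J \<subseteq> I" for Y J
    using J
  proof (induction J)
    case empty
    show ?case using nabla_right(2)[OF Y Y Y smooth_fun_const[OF o] q, of 0]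
      by (simp only: sum.empty scaleR_zero_left tangent_const[OF vf_T[OF Y q]] add_0_left)
  next
    case (insert i J)
    have Xi: "vector_field Q U (X i)" and ci: "smooth_fun Q U (c i)" using X c insert by blast+
    have s: "vector_field Q U (\<lambda>p. \<Sum>i\<in>J. c i p *\<^sub>R X i p)"
      using X c insert by (intro vf_lincomb o) auto
    have IH: "nabla Y (\<lambda>p. \<Sum>i\<in>J. c i p *\<^sub>R X i p) q = (\<Sum>i\<in>J. Y q (c i) *\<^sub>R X i q + c i q *\<^sub>R nabla Y (X i) q)"
      using insert by blast
    show ?case
      by (simp only: sum.insert[OF insert.hyps(1,2)] IH nabla_right(1)[OF Y vf_scale[OF Xi ci] s ci q]
          nabla_right(2)[OF Y Xi Xi ci q])
  qed
  have V: "vector_field Q U V" unfolding V_def using X c by (intro vf_lincomb o) auto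
  have "nabla V V q = (\<Sum>j\<in>I. V q (c j) *\<^sub>R X j q + c j q *\<^sub>R nabla V (X j) q)"
    using right[OF V I] unfolding V_def by blast
  also have "\<dots> = (\<Sum>j\<in>I. V q (c j) *\<^sub>R X j q + c j q *\<^sub>R (\<Sum>i\<in>I. c i q *\<^sub>R nabla (X i) (X j) q))"
    using left[OF X I] unfolding V_def by (intro sum.cong) auto
  finally show ?thesis by (simp add: sum.distrib scaleR_sum_right mult.commute)
qed

lemma nabla_local:
  assumes "vector_field Q U X" "vector_field Q U X'" "vector_field Q U Y" "vector_field Q U Y'"
    "\<And>p. p \<in> U \<Longrightarrow> X p = X' p" "\<And>p. p \<in> U \<Longrightarrow> Y p = Y' p" "q \<in> U"
  shows "nabla X Y q = nabla X' Y' q"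
  by (rule connection[THEN conjunct2, THEN conjunct1, rule_format, of U X X' Y Y' q]) (use assms in auto)

text \<open>Koszul's formula with equal first arguments, the form in which it enters the comparison
  of \<open>g\<close> and \<open>ghat\<close>. Torsion-freeness trades the derivative of
  \<open>Z\<close> along \<open>V\<close> for that of \<open>V\<close> along \<open>Z\<close>, whose
  pairing with \<open>V\<close> is half the derivative of the squared length.\<close>

lemma nabla_self:
  assumes V: "vector_field Q U V" and Z: "vector_field Q U Z" and q: "q \<in> U"
  shows "h q (nabla V V q) (Z q) =
    V q (\<lambda>p. h p (V p) (Z p)) - Z q (\<lambda>p. h p (V p) (V p)) / 2 - h q (lie_bracket Q V Z q) (V q)"
proof -
  note T = vf_T[OF V q] nabla_T[OF V V q] nabla_T[OF V Z q] nabla_T[OF Z V q] bracket_T[OF V Z q]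
  have "nabla V Z q = nabla Z V q + lie_bracket Q V Z q"
    using levi_civita_properties(2)[OF V Z q] by (simp add: algebra_simps)
  then have "h q (V q) (nabla V Z q) = h q (V q) (nabla Z V q) + h q (V q) (lie_bracket Q V Z q)"
    using T by (simp add: add_right)
  then show ?thesis
    using levi_civita_properties(3)[OF V V Z q] levi_civita_properties(3)[OF Z V V q]
      tensor_sym[OF T(1,4)] tensor_sym[OF T(1,5)] by simp
qed

end

section \<open>The geodesic spray as push-forward minus vertical lift\<close>

context riemannian_atlas
begin

lemma qv_lincomb:
  assumes X: "local_frame Q U X" "q \<in> U" and \<gamma>: "\<gamma> < DIM('e)" and u: "\<And>i. i \<in> I \<Longrightarrow> u i \<in> T q" and I: "finite I"
  shows "quasi_velocity DIM('e) X \<gamma> (q, \<Sum>i\<in>I. c i *\<^sub>R u i) = (\<Sum>i\<in>I. c i * quasi_velocity DIM('e) X \<gamma> (q, u i))"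
proof -
  have pts: "q \<in> points Q" using X lf_opn opn_points by blast
  show ?thesis
    using I u
  proof (induction I)
    case empty
    from qv_scale[OF X \<gamma> T_zero[OF pts], of 0] show ?case
      by (simp only: sum.empty scaleR_zero_left mult_zero_left)
  next
    case (insert i I)
    have ui: "u i \<in> T q" and s: "(\<Sum>i\<in>I. c i *\<^sub>R u i) \<in> T q"
      using insert.prems by (auto intro!: T_sum T_scale pts)
    have IH: "quasi_velocity DIM('e) X \<gamma> (q, \<Sum>i\<in>I. c i *\<^sub>R u i) = (\<Sum>i\<in>I. c i * quasi_velocity DIM('e) X \<gamma> (q, u i))"
      using insert by blast
    show ?case
      by (simp only: sum.insert[OF insert.hyps(1,2)] qv_add[OF X \<gamma> T_scale[OF ui] s] qv_scale[OF X \<gamma> ui] IH)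
  qed
qed

text \<open>Vanishing of the right-hand side along a curve with velocity \<open>V\<close> is the
  geodesic equation in quasi-velocities; this links the frame description of the spray with the
  frame-free one.\<close>

lemma nabla_self_qv:
  assumes X: "local_frame Q U' X" "q \<in> U'" and V: "vector_field Q U V" "q \<in> U" and \<gamma>: "\<gamma> < DIM('e)"
  shows "quasi_velocity DIM('e) X \<gamma> (q, nabla V V q) = V q (\<lambda>p. quasi_velocity DIM('e) X \<gamma> (p, V p)) +
    (\<Sum>\<alpha><DIM('e). \<Sum>\<beta><DIM('e). connection_coeff Q h X \<gamma> \<alpha> \<beta> q *
      quasi_velocity DIM('e) X \<alpha> (q, V q) * quasi_velocity DIM('e) X \<beta> (q, V q))"
proof -
  let ?W = "U \<inter> U'"
  let ?f = "\<lambda>\<alpha> p. quasi_velocity DIM('e) X \<alpha> (p, V p)"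
  let ?V = "\<lambda>p. \<Sum>\<alpha><DIM('e). ?f \<alpha> p *\<^sub>R X \<alpha> p"
  have o: "opn ?W" using vf_opn[OF V(1)] lf_opn[OF X(1)] by blast
  have q: "q \<in> ?W" using X V by blast
  have VW: "vector_field Q ?W V" using vf_subset[OF V(1) o] by blast
  have XW: "vector_field Q ?W (X i)" if "i < DIM('e)" for i
    using vf_subset[OF lf_vf[OF X(1) that] o] by blast
  have f: "smooth_fun Q ?W (?f i)" if "i < DIM('e)" for i
    by (rule smooth_qv_field[OF X(1) VW _ that]) auto
  have eq: "V p = ?V p" if "p \<in> ?W" for p
    using qv_expand[OF X(1) _ vf_T[OF V(1)], of p] that by simp
  have V': "vector_field Q ?W ?V" using f XW by (intro vf_lincomb o) auto
  have Vq: "?V q = V q" using eq[OF q] by simp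
  have nT: "nabla (X i) (X j) q \<in> T q" if "i < DIM('e)" "j < DIM('e)" for i j
    using nabla_T[OF XW XW q] that by blast
  \<comment> \<open>\<open>V\<close> equals its frame expansion only on \<open>?W\<close>, hence the
    appeal to locality of the connection.\<close>
  have "nabla V V q = nabla ?V ?V q"
    by (rule nabla_local[OF VW V' VW V' eq eq q])
  also have "\<dots> = (\<Sum>j<DIM('e). V q (?f j) *\<^sub>R X j q) +
      (\<Sum>j<DIM('e). \<Sum>i<DIM('e). (?f i q * ?f j q) *\<^sub>R nabla (X i) (X j) q)"
    by (subst nabla_lincomb[OF XW f q _ o]) (auto simp only: Vq lessThan_iff finite_lessThan)
  \<comment> \<open>The factor \<open>1\<close> only gives the outer sum the shape required by
    \<open>qv_lincomb\<close>.\<close>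
  finally have n: "nabla V V q = (\<Sum>j<DIM('e). V q (?f j) *\<^sub>R X j q) +
      (\<Sum>j<DIM('e). 1 *\<^sub>R (\<Sum>i<DIM('e). (?f i q * ?f j q) *\<^sub>R nabla (X i) (X j) q))" by simp
  have pts: "q \<in> points Q" using X lf_opn opn_points by blast
  have T1: "(\<Sum>j<DIM('e). V q (?f j) *\<^sub>R X j q) \<in> T q"
    using lf_T[OF X(1) _ X(2)] pts by (intro T_sum T_scale) auto
  have T2: "(\<Sum>i<DIM('e). (?f i q * ?f j q) *\<^sub>R nabla (X i) (X j) q) \<in> T q" if "j < DIM('e)" for j
    using nT that pts by (intro T_sum T_scale) auto
  have T3: "(\<Sum>j<DIM('e). 1 *\<^sub>R (\<Sum>i<DIM('e). (?f i q * ?f j q) *\<^sub>R nabla (X i) (X j) q)) \<in> T q"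
    by (rule T_sum[OF pts T_scale[OF T2]]) auto
  have inner: "quasi_velocity DIM('e) X \<gamma> (q, \<Sum>i<DIM('e). (?f i q * ?f j q) *\<^sub>R nabla (X i) (X j) q) =
      (\<Sum>i<DIM('e). (?f i q * ?f j q) * connection_coeff Q h X \<gamma> i j q)" if "j < DIM('e)" for j
    unfolding connection_coeff_def by (rule qv_lincomb[OF X \<gamma>]) (use nT that in auto)
  have "quasi_velocity DIM('e) X \<gamma> (q, nabla V V q) = V q (?f \<gamma>) +
      (\<Sum>j<DIM('e). 1 * quasi_velocity DIM('e) X \<gamma> (q, \<Sum>i<DIM('e). (?f i q * ?f j q) *\<^sub>R nabla (X i) (X j) q))"
    unfolding n qv_add[OF X \<gamma> T1 T3] qv_sum[OF X \<gamma>]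
    by (subst qv_lincomb[OF X \<gamma>]) (use T2 in auto)
  also have "(\<Sum>j<DIM('e). 1 * quasi_velocity DIM('e) X \<gamma> (q, \<Sum>i<DIM('e). (?f i q * ?f j q) *\<^sub>R nabla (X i) (X j) q)) =
      (\<Sum>j<DIM('e). \<Sum>i<DIM('e). (?f i q * ?f j q) * connection_coeff Q h X \<gamma> i j q)"
    by (rule sum.cong) (simp_all add: inner)
  also have "\<dots> = (\<Sum>i<DIM('e). \<Sum>j<DIM('e). connection_coeff Q h X \<gamma> i j q * ?f i q * ?f j q)"
    by (subst sum.swap) (simp add: mult_ac)
  finally show ?thesis .
qed

text \<open>In every frame the derivative of the components of \<open>V\<close> occurs both in the
  push-forward and in the covariant derivative and cancels, which leaves the geodesic equation. The
  right-hand side is thus a witness for the description, and one frame shows that there is no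
  other.\<close>

lemma geodesic_spray_eq:
  assumes V: "vector_field Q U V" "q \<in> U"
  shows "geodesic_spray Q h (q, V q) = pushforward V q (V q) - vlift (nabla V V q) (q, V q)"
  unfolding geodesic_spray_def
proof (rule the_equality)
  let ?W = "pushforward V q (V q) - vlift (nabla V V q) (q, V q)"
  have n: "nabla V V q \<in> T q" using nabla_T[OF V(1) V] .
  have spray: "?W (quasi_velocity DIM('e) X \<gamma>) =
      - (\<Sum>\<alpha><DIM('e). \<Sum>\<beta><DIM('e). connection_coeff Q h X \<gamma> \<alpha> \<beta> (fst (q, V q)) *
          quasi_velocity DIM('e) X \<alpha> (q, V q) * quasi_velocity DIM('e) X \<beta> (q, V q))"
    if X: "local_frame Q U' X" "q \<in> U'" and \<gamma>: "\<gamma> < DIM('e)" for U' X \<gamma>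
    using push_vlift_qv[OF X V n \<gamma>] nabla_self_qv[OF X V \<gamma>] by simp
  show "second_order_vector Q (q, V q) ?W \<and>
     (\<forall>U X. local_frame Q U X \<and> fst (q, V q) \<in> U \<longrightarrow>
        (\<forall>\<gamma><DIM('e). ?W (quasi_velocity DIM('e) X \<gamma>) =
           - (\<Sum>\<alpha><DIM('e). \<Sum>\<beta><DIM('e). connection_coeff Q h X \<gamma> \<alpha> \<beta> (fst (q, V q)) *
                quasi_velocity DIM('e) X \<alpha> (q, V q) * quasi_velocity DIM('e) X \<beta> (q, V q))))"
    by (intro conjI allI impI second_order_push_vlift[OF V n]; elim conjE)
       (rule spray, simp_all only: fst_conv)
  fix W assume W: "second_order_vector Q (q, V q) W \<and>
     (\<forall>U X. local_frame Q U X \<and> fst (q, V q) \<in> U \<longrightarrow>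
        (\<forall>\<gamma><DIM('e). W (quasi_velocity DIM('e) X \<gamma>) =
           - (\<Sum>\<alpha><DIM('e). \<Sum>\<beta><DIM('e). connection_coeff Q h X \<gamma> \<alpha> \<beta> (fst (q, V q)) *
                quasi_velocity DIM('e) X \<alpha> (q, V q) * quasi_velocity DIM('e) X \<beta> (q, V q))))"
  obtain U' X where X: "local_frame Q U' X" "q \<in> U'"
    using local_frame_ex[OF opn_points[OF vf_opn[OF V(1)] V(2)]] .
  show "W = ?W"
    by (rule second_order_unique[OF X vf_T[OF V] _ second_order_push_vlift[OF V n]])
       (use W X spray[OF X] in auto)
qed

end

section \<open>Distributions\<close>

text \<open>\<open>basis_of\<close> speaks of injectivity and of the image set, whereas computations
  compare coefficients index by index; this translates between the two.\<close>

lemma indexed_independent_iff: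
  fixes Y :: "nat \<Rightarrow> 'v::real_vector"
  assumes I: "finite I"
  shows "inj_on Y I \<and> independent (Y ` I) \<longleftrightarrow>
    (\<forall>c. (\<Sum>i\<in>I. c i *\<^sub>R Y i) = 0 \<longrightarrow> (\<forall>i\<in>I. c i = 0))"
proof (intro iffI allI impI ballI)
  fix c i assume Y: "inj_on Y I \<and> independent (Y ` I)" and c: "(\<Sum>i\<in>I. c i *\<^sub>R Y i) = 0" and i: "i \<in> I"
  let ?i = "the_inv_into I Y"
  have inv: "?i (Y j) = j" if "j \<in> I" for j using the_inv_into_f_f that Y by metis
  have "(\<Sum>x\<in>Y ` I. c (?i x) *\<^sub>R x) = 0"
    using c Y inv by (simp add: sum.reindex)
  then have "c (?i (Y i)) = 0"
    using independentD[of "Y ` I" "Y ` I" "\<lambda>x. c (?i x)" "Y i"] Y I i by auto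
  then show "c i = 0" using inv[OF i] by simp
next
  assume *: "\<forall>c. (\<Sum>i\<in>I. c i *\<^sub>R Y i) = 0 \<longrightarrow> (\<forall>i\<in>I. c i = 0)"
  have inj: "inj_on Y I"
  proof (rule inj_onI, rule ccontr)
    fix i j assume ij: "i \<in> I" "j \<in> I" "Y i = Y j" "i \<noteq> j"
    \<comment> \<open>If \<open>Y\<close> repeats a value at \<open>i\<close> and \<open>j\<close>,
      the coefficients 1 at \<open>i\<close> and -1 at \<open>j\<close> form a nontrivial
      relation.\<close>
    let ?c = "\<lambda>k. (if k = i then 1 else 0) - (if k = j then 1 else 0) :: real"
    have "(\<Sum>k\<in>I. ?c k *\<^sub>R Y k) = (\<Sum>k\<in>I. if k = i then Y k else 0) - (\<Sum>k\<in>I. if k = j then Y k else 0)"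
      unfolding sum_subtractf[symmetric] by (rule sum.cong) (auto simp: scaleR_left_diff_distrib)
    then have "(\<Sum>k\<in>I. ?c k *\<^sub>R Y k) = 0" using ij I by simp
    then have "\<forall>k\<in>I. ?c k = 0" using *[rule_format, of ?c] by blast
    then show False using ij by (metis cancel_comm_monoid_add_class.diff_zero zero_neq_one)
  qed
  moreover have "independent (Y ` I)"
  proof (rule independent_if_scalars_zero)
    show "finite (Y ` I)" using I by simp
    fix f x assume f: "(\<Sum>x\<in>Y ` I. f x *\<^sub>R x) = 0" and x: "x \<in> Y ` I"
    have "(\<Sum>i\<in>I. f (Y i) *\<^sub>R Y i) = 0" using f by (simp add: sum.reindex[OF inj])
    then show "f x = 0" using *[rule_format, of "\<lambda>i. f (Y i)"] x by blast
  qed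
  ultimately show "inj_on Y I \<and> independent (Y ` I)" by blast
qed

lemma span_image_finite:
  fixes Y :: "nat \<Rightarrow> 'v::real_vector"
  assumes I: "finite I" and v: "v \<in> span (Y ` I)"
  obtains c where "v = (\<Sum>i\<in>I. c i *\<^sub>R Y i)"
proof -
  have "\<exists>c. v = (\<Sum>i\<in>I. c i *\<^sub>R Y i)"
    using v
  proof (induction rule: span_induct_alt)
    case base
    then show ?case by (intro exI[of _ "\<lambda>_. 0"]) simp
  next
    case (step r x y)
    then obtain i c where i: "i \<in> I" "x = Y i" and c: "y = (\<Sum>i\<in>I. c i *\<^sub>R Y i)" by blast
    have "(\<Sum>k\<in>I. (c k + (if k = i then r else 0)) *\<^sub>R Y k) = y + (\<Sum>k\<in>I. if k = i then r *\<^sub>R Y k else 0)"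
      unfolding c sum.distrib[symmetric] by (rule sum.cong) (auto simp: scaleR_left_distrib)
    then have "r *\<^sub>R x + y = (\<Sum>k\<in>I. (c k + (if k = i then r else 0)) *\<^sub>R Y k)"
      using i I by simp
    then show ?case by (intro exI[of _ "\<lambda>k. c k + (if k = i then r else 0)"]) blast
  qed
  then show ?thesis using that by blast
qed

text \<open>A dimension count: a vector outside the span of the family could be added to it, giving
  an independent set larger than \<open>S\<close> inside the span of \<open>S\<close>.\<close>

lemma basis_ofI:
  fixes Y :: "nat \<Rightarrow> 'v::real_vector"
  assumes I: "finite I" and Y: "\<And>c. (\<Sum>i\<in>I. c i *\<^sub>R Y i) = 0 \<Longrightarrow> \<forall>i\<in>I. c i = 0"
    and V: "\<And>i. i \<in> I \<Longrightarrow> Y i \<in> V" and S: "span S = V" "finite S" "card S \<le> card I"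
  shows "basis_of I Y V"
proof -
  have ind: "inj_on Y I" "independent (Y ` I)" using indexed_independent_iff[OF I, of Y] Y by blast+
  have sub: "subspace V" using S(1) by (metis subspace_span)
  have "v \<in> span (Y ` I)" if v: "v \<in> V" for v
  proof (rule ccontr)
    assume nv: "v \<notin> span (Y ` I)"
    then have "independent (insert v (Y ` I))" using independent_insertI ind(2) by blast
    moreover have "insert v (Y ` I) \<subseteq> span S" using v V S(1) by auto
    ultimately have "card (insert v (Y ` I)) \<le> card S" using independent_span_bound[OF S(2)] by blast
    moreover have "v \<notin> Y ` I" using nv span_base[of v "Y ` I"] by auto
    ultimately show False using I S(3) ind(1) by (simp add: card_image)
  qed
  moreover have "span (Y ` I) \<subseteq> V" using V sub by (intro span_minimal) auto
  ultimately show ?thesis using ind unfolding basis_of_def by blast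
qed

section \<open>Representing tensors on a distribution\<close>

locale distribution_atlas = riemannian_atlas Q g for Q :: "('q, 'e::euclidean_space) atlas" and g +
  fixes m :: nat and D :: "'q \<Rightarrow> 'q tvec set"
  assumes distr: "distribution Q m D"
begin

lemma D_T: "q \<in> points Q \<Longrightarrow> v \<in> D q \<Longrightarrow> v \<in> T q"
  using distr unfolding distribution_def by blast

lemma D_frame:
  assumes "q \<in> points Q"
  obtains U X where "opn U" "q \<in> U" "\<And>a. a < m \<Longrightarrow> vector_field Q U (X a)"
    "\<And>p. p \<in> U \<Longrightarrow> basis_of {..<m} (\<lambda>a. X a p) (D p)"
  using distr assms unfolding distribution_def by metis

lemma subspace_D: "q \<in> points Q \<Longrightarrow> subspace (D q)"
  by (elim D_frame) (metis basis_of_def subspace_span)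

text \<open>The vector of \<open>D q\<close> that represents the restriction of \<open>k q u\<close>
  to \<open>D q\<close> with respect to \<open>g\<close>. For \<open>k = g\<close> it is the
  orthogonal projection; for a tensor agreeing with \<open>g\<close> on \<open>D\<close> it is the
  projection onto \<open>D\<close> along the complement of \<open>D\<close> orthogonal for that
  tensor.\<close>

definition riesz :: "'q tensor2 \<Rightarrow> 'q \<Rightarrow> 'q tvec \<Rightarrow> 'q tvec" where
  "riesz k q u = (SOME d. d \<in> D q \<and> (\<forall>w\<in>D q. g q d w = k q u w))"

lemma D_gram_kernel:
  assumes p: "p \<in> points Q" and B: "basis_of {..<m} (\<lambda>a. X a p) (D p)"
    and y: "\<forall>i<m. (\<Sum>j<m. g p (X j p) (X i p) * y j) = 0"
  shows "\<forall>j<m. y j = 0"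
proof -
  have XD: "X a p \<in> D p" if "a < m" for a using B that unfolding basis_of_def by (metis imageI lessThan_iff span_base)
  have XT: "X a p \<in> T p" if "a < m" for a using D_T[OF p XD[OF that]] .
  let ?v = "\<Sum>j<m. y j *\<^sub>R X j p"
  have v: "?v \<in> T p" using XT p by (intro T_sum T_scale) auto
  have "g p ?v (X i p) = 0" if "i < m" for i
  proof -
    have "g p ?v (X i p) = (\<Sum>j<m. y j * g p (X j p) (X i p))"
      by (rule lincomb_left) (use XT that in auto)
    then show ?thesis using y that by (simp add: mult.commute)
  qed
  moreover have "g p ?v ?v = (\<Sum>i<m. y i * g p ?v (X i p))"
    by (rule lincomb_right[OF v]) (use XT in auto)
  ultimately have "g p ?v ?v = 0" by simp
  then have "?v = 0" using posdef[OF v] by auto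
  then show ?thesis using indexed_independent_iff[of "{..<m}" "\<lambda>a. X a p"] B unfolding basis_of_def by auto
qed

lemma riesz_unique:
  assumes q: "q \<in> points Q" and d: "d \<in> D q" "d' \<in> D q" and eq: "\<And>w. w \<in> D q \<Longrightarrow> g q d w = g q d' w"
  shows "d = d'"
proof -
  have "d - d' \<in> D q" using subspace_D[OF q] d subspace_diff by blast
  moreover have "g q (d - d') w = 0" if "w \<in> D q" for w
    using eq[OF that] D_T[OF q] d that by (simp add: diff_left)
  ultimately have "g q (d - d') (d - d') = 0" by blast
  then show ?thesis using posdef[of "d - d'" q] D_T[OF q] d T_diff by force
qed

lemma riesz:
  assumes k: "tensor_atlas Q k" and u: "u \<in> T q"
  shows "riesz k q u \<in> D q" "\<And>w. w \<in> D q \<Longrightarrow> g q (riesz k q u) w = k q u w"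
proof -
  interpret k: tensor_atlas Q k by (rule k)
  have q: "q \<in> points Q" using tangent_points[OF u] .
  obtain U X where X: "opn U" "q \<in> U" "\<And>a. a < m \<Longrightarrow> vector_field Q U (X a)"
    "\<And>p. p \<in> U \<Longrightarrow> basis_of {..<m} (\<lambda>a. X a p) (D p)" using D_frame[OF q] by blast
  note B = X(4)[OF X(2)]
  have XD: "X a q \<in> D q" if "a < m" for a using B that unfolding basis_of_def by (metis imageI lessThan_iff span_base)
  have XT: "X a q \<in> T q" if "a < m" for a using D_T[OF q XD[OF that]] .
  have "\<exists>x. \<forall>i<m. (\<Sum>j<m. (case (i, j) of (i, j) \<Rightarrow> g q (X j q) (X i q)) * x j) = k q u (X i q)"
    by (rule solve_ex) (use D_gram_kernel[where X = X, OF q B] in auto)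
  then obtain x where x: "\<And>i. i < m \<Longrightarrow> (\<Sum>j<m. g q (X j q) (X i q) * x j) = k q u (X i q)"
    by auto
  let ?d = "\<Sum>j<m. x j *\<^sub>R X j q"
  have dD: "?d \<in> D q" using XD subspace_D[OF q] by (intro subspace_sum subspace_scale) auto
  have dX: "g q ?d (X i q) = k q u (X i q)" if "i < m" for i
  proof -
    have "g q ?d (X i q) = (\<Sum>j<m. x j * g q (X j q) (X i q))"
      by (rule lincomb_left) (use XT that in auto)
    then show ?thesis using x[OF that] by (simp add: mult.commute)
  qed
  have "g q ?d w = k q u w" if w: "w \<in> D q" for w
  proof -
    have "w \<in> span ((\<lambda>a. X a q) ` {..<m})" using w B unfolding basis_of_def by simp
    then obtain c where c: "w = (\<Sum>i<m. c i *\<^sub>R X i q)"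
      using span_image_finite[of "{..<m}" w "\<lambda>a. X a q"] by auto
    have "g q ?d w = (\<Sum>i<m. c i * g q ?d (X i q))"
      unfolding c by (rule lincomb_right) (use XT D_T[OF q dD] in auto)
    moreover have "k q u w = (\<Sum>i<m. c i * k q u (X i q))"
      unfolding c by (rule k.lincomb_right) (use XT u in auto)
    ultimately show ?thesis using dX by simp
  qed
  then have "\<exists>d. d \<in> D q \<and> (\<forall>w\<in>D q. g q d w = k q u w)" using dD by blast
  from someI_ex[OF this] show "riesz k q u \<in> D q" "\<And>w. w \<in> D q \<Longrightarrow> g q (riesz k q u) w = k q u w"
    unfolding riesz_def by blast+
qed

lemma riesz_eqI:
  assumes k: "tensor_atlas Q k" and u: "u \<in> T q" and d: "d \<in> D q" "\<And>w. w \<in> D q \<Longrightarrow> g q d w = k q u w"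
  shows "riesz k q u = d"
  by (rule riesz_unique[OF tangent_points[OF u] riesz(1)[OF k u] d(1)]) (simp add: riesz(2)[OF k u] d(2))

lemma riesz_T: "tensor_atlas Q k \<Longrightarrow> u \<in> T q \<Longrightarrow> riesz k q u \<in> T q"
  using riesz(1) D_T tangent_points by blast

lemma riesz_add:
  assumes k: "tensor_atlas Q k" and u: "u \<in> T q" "v \<in> T q"
  shows "riesz k q (u + v) = riesz k q u + riesz k q v"
proof (rule riesz_eqI[OF k T_add[OF u]])
  interpret k: tensor_atlas Q k by (rule k)
  have q: "q \<in> points Q" using tangent_points[OF u(1)] .
  show "riesz k q u + riesz k q v \<in> D q" using riesz(1)[OF k] u subspace_add subspace_D[OF q] by blast
  show "g q (riesz k q u + riesz k q v) w = k q (u + v) w" if w: "w \<in> D q" for w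
    using riesz(2)[OF k _ w] riesz_T[OF k] u D_T[OF q w] by (simp add: add_left k.add_left)
qed

lemma riesz_scale:
  assumes k: "tensor_atlas Q k" and u: "u \<in> T q"
  shows "riesz k q (r *\<^sub>R u) = r *\<^sub>R riesz k q u"
proof (rule riesz_eqI[OF k T_scale[OF u]])
  interpret k: tensor_atlas Q k by (rule k)
  have q: "q \<in> points Q" using tangent_points[OF u(1)] .
  show "r *\<^sub>R riesz k q u \<in> D q" using riesz(1)[OF k u] subspace_scale subspace_D[OF q] by blast
  show "g q (r *\<^sub>R riesz k q u) w = k q (r *\<^sub>R u) w" if w: "w \<in> D q" for w
    using riesz(2)[OF k u w] riesz_T[OF k u] u D_T[OF q w] by (simp add: scale_left k.scale_left)
qed

lemma riesz_vf:
  assumes k: "tensor_atlas Q k" and Z: "vector_field Q U Z"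
  shows "vector_field Q U (\<lambda>p. riesz k p (Z p))"
proof (rule vf_local[OF vf_opn[OF Z]])
  interpret k: tensor_atlas Q k by (rule k)
  fix q assume q: "q \<in> U"
  have pts: "q \<in> points Q" using q vf_opn[OF Z] opn_points by blast
  obtain U0 X where X: "opn U0" "q \<in> U0" "\<And>a. a < m \<Longrightarrow> vector_field Q U0 (X a)"
    "\<And>p. p \<in> U0 \<Longrightarrow> basis_of {..<m} (\<lambda>a. X a p) (D p)" using D_frame[OF pts] by blast
  let ?W = "U \<inter> U0"
  have o: "opn ?W" using vf_opn[OF Z] X(1) by blast
  have XW: "vector_field Q ?W (X a)" if "a < m" for a using vf_subset[OF X(3)[OF that] o] by blast
  have ZW: "vector_field Q ?W Z" using vf_subset[OF Z o] by blast
  have "\<exists>c. riesz k p (Z p) = (\<Sum>i<m. c i *\<^sub>R X i p)" if p: "p \<in> ?W" for p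
  proof -
    have "riesz k p (Z p) \<in> span ((\<lambda>a. X a p) ` {..<m})"
      using riesz(1)[OF k vf_T[OF Z]] X(4)[of p] p unfolding basis_of_def by simp
    then show ?thesis using span_image_finite[of "{..<m}" _ "\<lambda>a. X a p"] by blast
  qed
  then obtain c where c: "\<And>p. p \<in> ?W \<Longrightarrow> riesz k p (Z p) = (\<Sum>i<m. c p i *\<^sub>R X i p)" by metis
  have "smooth_fun Q ?W (\<lambda>p. c p l)" if l: "l < m" for l
  proof (rule smooth_fun_solve[where a = "\<lambda>p (i, j). g p (X j p) (X i p)" and b = "\<lambda>i p. k p (Z p) (X i p)"
        and x = "\<lambda>l p. c p l", OF o _ _ _ _ l])
    show "smooth_fun Q ?W (\<lambda>p. case (i, j) of (i, j) \<Rightarrow> g p (X j p) (X i p))" if "i < m" "j < m" for i j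
      using smooth[OF XW XW] that by simp
    show "smooth_fun Q ?W (\<lambda>p. k p (Z p) (X i p))" if "i < m" for i
      using k.smooth[OF ZW XW[OF that]] .
    show "(\<Sum>j<m. (case (i, j) of (i, j) \<Rightarrow> g p (X j p) (X i p)) * c p j) = k p (Z p) (X i p)"
      if p: "p \<in> ?W" and i: "i < m" for p i
    proof -
      have pp: "p \<in> points Q" using p o opn_points by blast
      have XD: "X a p \<in> D p" if "a < m" for a
        using X(4)[of p] p that unfolding basis_of_def by (metis IntD2 imageI lessThan_iff span_base)
      have "g p (riesz k p (Z p)) (X i p) = (\<Sum>j<m. c p j * g p (X j p) (X i p))"
        unfolding c[OF p] by (rule lincomb_left) (use D_T[OF pp XD] i in auto)
      moreover have "g p (riesz k p (Z p)) (X i p) = k p (Z p) (X i p)"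
        using riesz(2)[OF k vf_T[OF Z] XD[OF i]] p by simp
      ultimately show ?thesis by (simp add: mult.commute)
    qed
    show "\<forall>j<m. y j = 0" if p: "p \<in> ?W" and "\<forall>i<m. (\<Sum>j<m. (case (i, j) of (i, j) \<Rightarrow> g p (X j p) (X i p)) * y j) = 0" for p y
      using D_gram_kernel[where X = X, OF opn_points[OF o p] X(4), of y] that by auto
  qed
  then have "vector_field Q ?W (\<lambda>p. \<Sum>i<m. c p i *\<^sub>R X i p)" using XW by (intro vf_lincomb o) auto
  then have "vector_field Q ?W (\<lambda>p. riesz k p (Z p))" by (rule vf_cong) (simp add: c)
  then show "\<exists>V. q \<in> V \<and> vector_field Q V (\<lambda>p. riesz k p (Z p))" using q X(2) by blast
qed

lemma g_tensor: "tensor_atlas Q g" ..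

abbreviation proj :: "'q \<Rightarrow> 'q tvec \<Rightarrow> 'q tvec" where "proj \<equiv> riesz g"
abbreviation Dperp :: "'q \<Rightarrow> 'q tvec set" where "Dperp \<equiv> orthogonal_distribution Q g D"

lemma proj_D: "q \<in> points Q \<Longrightarrow> v \<in> D q \<Longrightarrow> proj q v = v"
  by (rule riesz_eqI[OF g_tensor D_T]) auto

lemma minus_proj_perp: "u \<in> T q \<Longrightarrow> u - proj q u \<in> Dperp q"
  unfolding orthogonal_distribution_def
  using riesz(2)[OF g_tensor] riesz_T[OF g_tensor] T_diff D_T[OF tangent_points]
  by (auto simp: diff_left)

lemma D_Int_perp: "q \<in> points Q \<Longrightarrow> v \<in> D q \<Longrightarrow> v \<in> Dperp q \<Longrightarrow> v = 0"
  using posdef[of v q] unfolding orthogonal_distribution_def by force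

lemma subspace_perp: "q \<in> points Q \<Longrightarrow> subspace (Dperp q)"
  unfolding orthogonal_distribution_def subspace_def
  by (auto simp: T_zero T_add T_scale zero_left add_left scale_left D_T)

subsection \<open>Adapted frames\<close>

lemma m_le_n:
  assumes "q \<in> points Q"
  shows "m \<le> DIM('e)"
proof -
  obtain U X where X: "opn U" "q \<in> U" "\<And>a. a < m \<Longrightarrow> vector_field Q U (X a)"
    "\<And>p. p \<in> U \<Longrightarrow> basis_of {..<m} (\<lambda>a. X a p) (D p)" using D_frame[OF assms] by blast
  obtain U0 E where E: "local_frame Q U0 E" "q \<in> U0" using local_frame_ex[OF assms] .
  note B = X(4)[OF X(2), unfolded basis_of_def]
  have "(\<lambda>a. X a q) ` {..<m} \<subseteq> D q" using B span_superset[of "(\<lambda>a. X a q) ` {..<m}"] by simp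
  then have "(\<lambda>a. X a q) ` {..<m} \<subseteq> span ((\<lambda>\<alpha>. E \<alpha> q) ` {..<DIM('e)})"
    unfolding lf_basis(3)[OF E] using D_T[OF assms] by blast
  then have "card ((\<lambda>a. X a q) ` {..<m}) \<le> card ((\<lambda>\<alpha>. E \<alpha> q) ` {..<DIM('e)})"
    using independent_span_bound B by blast
  then show ?thesis using B by (simp add: card_image lf_basis(1)[OF E])
qed

text \<open>Fields spanning \<open>D\<close> are completed at \<open>q\<close> by coordinate fields
  to a basis. This remains a basis near \<open>q\<close>, and subtracting from the added fields
  their projections to \<open>D\<close> makes them orthogonal without destroying
  independence.\<close>

lemma adapted_frame_ex:
  assumes q: "q \<in> points Q"
  obtains U Y where "adapted_frame Q g m D U Y" "q \<in> U"
proof -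
  let ?n = "DIM('e)"
  have mn: "m \<le> ?n" using m_le_n[OF q] .
  obtain U X where X: "opn U" "q \<in> U" "\<And>a. a < m \<Longrightarrow> vector_field Q U (X a)"
    "\<And>p. p \<in> U \<Longrightarrow> basis_of {..<m} (\<lambda>a. X a p) (D p)" using D_frame[OF q] by blast
  obtain c where c: "c \<in> Q" "q \<in> fst c" using chart_ex[OF q] by blast
  obtain \<beta> where \<beta>: "bij_betw \<beta> {..<?n} (Basis :: 'e set)"
    and E: "local_frame Q (fst c) (\<lambda>i p. chart_vector Q c p (\<beta> i))"
    using chart_local_frame[OF c(1)] by blast
  define E where "E = (\<lambda>i p. chart_vector Q c p (\<beta> i))"
  note E = E[folded E_def] and B = X(4)[OF X(2), unfolded basis_of_def]
  let ?Xs = "(\<lambda>a. X a q) ` {..<m}" and ?Es = "(\<lambda>i. E i q) ` {..<?n}"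
  have XsT: "?Xs \<subseteq> T q" using B span_superset[of ?Xs] D_T[OF q] by auto
  have "?Xs \<subseteq> ?Xs \<union> ?Es" "independent ?Xs" using B by auto
  \<comment> \<open>The Steinitz exchange at the single point \<open>q\<close>; the vectors added to
    the frame of \<open>D\<close> are coordinate vectors and therefore extend to fields on the
    chart.\<close>
  then obtain S where S: "?Xs \<subseteq> S" "S \<subseteq> ?Xs \<union> ?Es" "independent S" "?Xs \<union> ?Es \<subseteq> span S"
    by (rule maximal_independent_subset_extend)
  have fin: "finite S" using S(2) finite_subset by blast
  have ST: "S \<subseteq> T q" using S(2) XsT span_superset[of ?Es] lf_basis(3)[OF E c(2)] by blast
  have "T q \<subseteq> span S" using S(4) span_mono[of ?Es "span S"] lf_basis(3)[OF E c(2)] by (simp add: span_span)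
  then have "card ?Es \<le> card S" using independent_span_bound[OF fin lf_basis(2)[OF E c(2)]]
      span_superset[of ?Es] lf_basis(3)[OF E c(2)] by blast
  moreover have "card S \<le> card ?Es"
    using independent_span_bound[of ?Es S] S(3) ST lf_basis(3)[OF E c(2)] by simp
  ultimately have cardS: "card S = ?n" using lf_basis(1)[OF E c(2)] by (simp add: card_image)
  have "card ?Xs = m" using B by (simp add: card_image)
  then have "card (S - ?Xs) = card {m..<?n}" using cardS S(1) fin by (simp add: card_Diff_subset)
  then obtain \<eta> where \<eta>: "bij_betw \<eta> {m..<?n} (S - ?Xs)"
    using fin by (metis finite_Diff finite_atLeastLessThan finite_same_card_bij)
  have "\<exists>j<?n. \<eta> i = E j q" if "i \<in> {m..<?n}" for i
    using bij_betwE[OF \<eta>] that S(2) by blast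
  then obtain e where e: "\<And>i. i \<in> {m..<?n} \<Longrightarrow> e i < ?n \<and> \<eta> i = E (e i) q" by metis
  define X' where "X' = (\<lambda>\<alpha>. if \<alpha> < m then X \<alpha> else E (e \<alpha>))"
  have un: "{..<?n} = {..<m} \<union> {m..<?n}" using mn by auto
  have "bij_betw (\<lambda>\<alpha>. X' \<alpha> q) {..<?n} S"
  proof -
    have "bij_betw (\<lambda>\<alpha>. X' \<alpha> q) {..<m} ?Xs"
      using B by (auto simp: X'_def bij_betw_def inj_on_def)
    moreover have "bij_betw (\<lambda>\<alpha>. X' \<alpha> q) {m..<?n} (S - ?Xs)"
      using \<eta> e by (subst bij_betw_cong[of _ _ \<eta>]) (auto simp: X'_def)
    ultimately have "bij_betw (\<lambda>\<alpha>. X' \<alpha> q) ({..<m} \<union> {m..<?n}) (?Xs \<union> (S - ?Xs))"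
      by (rule bij_betw_combine) auto
    then show ?thesis using S(1) un by (simp add: Un_absorb1)
  qed
  then have X'q: "\<forall>\<alpha><?n. y \<alpha> = 0" if "(\<Sum>\<alpha><?n. y \<alpha> *\<^sub>R X' \<alpha> q) = 0" for y
    using indexed_independent_iff[of "{..<?n}" "\<lambda>\<alpha>. X' \<alpha> q"] S(3) that unfolding bij_betw_def by auto
  let ?W0 = "U \<inter> fst c"
  have o: "opn ?W0" using X(1) opn_chart[OF c(1)] by blast
  have X'W: "vector_field Q ?W0 (X' \<alpha>)" if "\<alpha> < ?n" for \<alpha>
    using vf_subset[OF X(3) o] vf_subset[OF lf_vf[OF E] o] e[of \<alpha>] that by (auto simp: X'_def)
  define a where "a = (\<lambda>p (i, \<alpha>). X' \<alpha> p (\<lambda>p. snd c p \<bullet> \<beta> i))"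
  \<comment> \<open>The determinant of the coordinate components of \<open>X'\<close>. It is nonzero
    exactly where these fields are independent, which makes independence an open condition.\<close>
  define \<delta> where "\<delta> p = Determinant.det (Matrix.mat ?n ?n (a p))" for p
  have ker: "\<delta> p \<noteq> 0 \<longleftrightarrow> (\<forall>y. (\<Sum>\<alpha><?n. y \<alpha> *\<^sub>R X' \<alpha> p) = 0 \<longrightarrow> (\<forall>\<alpha><?n. y \<alpha> = 0))" if p: "p \<in> ?W0" for p
  proof -
    have "(\<forall>i<?n. (\<Sum>\<alpha><?n. a p (i, \<alpha>) * y \<alpha>) = 0) \<longleftrightarrow> (\<Sum>\<alpha><?n. y \<alpha> *\<^sub>R X' \<alpha> p) = 0" for y
    proof
      assume *: "\<forall>i<?n. (\<Sum>\<alpha><?n. a p (i, \<alpha>) * y \<alpha>) = 0"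
      show "(\<Sum>\<alpha><?n. y \<alpha> *\<^sub>R X' \<alpha> p) = 0"
      proof (rule tangent_eqI[OF c(1)])
        have pp: "p \<in> points Q" using p o opn_points by blast
        show "p \<in> fst c" "0 \<in> T p" "(\<Sum>\<alpha><?n. y \<alpha> *\<^sub>R X' \<alpha> p) \<in> T p"
          using p pp T_zero vf_T[OF X'W] by (auto intro!: T_sum T_scale)
        fix b :: 'e assume "b \<in> Basis"
        then have "b \<in> \<beta> ` {..<?n}" using bij_betw_imp_surj_on[OF \<beta>] by simp
        then obtain i where "i < ?n" "b = \<beta> i" by auto
        then show "(\<Sum>\<alpha><?n. y \<alpha> *\<^sub>R X' \<alpha> p) (\<lambda>p. snd c p \<bullet> b) = 0 (\<lambda>p. snd c p \<bullet> b)"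
          using * by (simp add: a_def sum_fun_apply scaleR_fun_def mult.commute)
      qed
    next
      assume *: "(\<Sum>\<alpha><?n. y \<alpha> *\<^sub>R X' \<alpha> p) = 0"
      show "\<forall>i<?n. (\<Sum>\<alpha><?n. a p (i, \<alpha>) * y \<alpha>) = 0"
        using arg_cong[OF *, of "\<lambda>v. v (\<lambda>p. snd c p \<bullet> \<beta> _)"]
        by (simp add: a_def sum_fun_apply scaleR_fun_def mult.commute)
    qed
    then show ?thesis unfolding \<delta>_def det_nonzero_iff by simp
  qed
  have "smooth_fun Q ?W0 \<delta>"
    unfolding \<delta>_def[abs_def]
  proof (rule smooth_fun_det[OF o])
    fix i j assume "i < ?n" "j < ?n"
    then show "smooth_fun Q ?W0 (\<lambda>p. a p (i, j))"
      unfolding a_def using vf_smooth_same[OF X'W smooth_fun_subset[OF smooth_chart_coordinate[OF c(1)]]] by simp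
  qed
  define W where "W = {p \<in> ?W0. \<delta> p \<in> - {0}}"
  have W: "opn W" "W \<subseteq> ?W0"
    unfolding W_def using opn_smooth_preimage[OF \<open>smooth_fun Q ?W0 \<delta>\<close> o, of "- {0}"] by auto
  have qW: "q \<in> W" using X'q ker[of q] X(2) c(2) by (auto simp: W_def)
  \<comment> \<open>A Gram-Schmidt step done for all added fields at once: only orthogonality to
    \<open>D\<close> is demanded, not orthogonality among the added fields.\<close>
  define Y where "Y = (\<lambda>\<alpha> p. if \<alpha> < m then X' \<alpha> p else X' \<alpha> p - proj p (X' \<alpha> p))"
  have Yvf: "vector_field Q W (Y \<alpha>)" if \<alpha>: "\<alpha> < ?n" for \<alpha>
  proof -
    have v: "vector_field Q W (X' \<alpha>)" using vf_subset[OF X'W[OF \<alpha>] W] .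
    show ?thesis
    proof (cases "\<alpha> < m")
      case True
      then have "Y \<alpha> = X' \<alpha>" by (simp add: Y_def fun_eq_iff)
      then show ?thesis using v by simp
    next
      case False
      then have "Y \<alpha> = (\<lambda>p. X' \<alpha> p - proj p (X' \<alpha> p))" by (simp add: Y_def)
      then show ?thesis using vf_diff[OF v riesz_vf[OF g_tensor v]] by (simp only:)
    qed
  qed
  have main: "basis_of {..<?n} (\<lambda>\<alpha>. Y \<alpha> p) (T p) \<and> span ((\<lambda>a. Y a p) ` {..<m}) = D p \<and>
      span ((\<lambda>i. Y i p) ` {m..<?n}) = Dperp p" if p: "p \<in> W" for p
  proof -
    have pp: "p \<in> points Q" using p W opn_points by blast
    have p0: "p \<in> U" "p \<in> fst c" using p W by auto
    have spanD: "span ((\<lambda>a. Y a p) ` {..<m}) = D p"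
      using X(4)[OF p0(1)] unfolding basis_of_def by (simp add: Y_def X'_def)
    have YD: "Y a p \<in> D p" if "a < m" for a
      using span_base[of "Y a p" "(\<lambda>a. Y a p) ` {..<m}"] that spanD by blast
    have YP: "Y i p \<in> Dperp p" if "i \<in> {m..<?n}" for i
      using minus_proj_perp[OF vf_T[OF X'W]] that p W(2) by (auto simp: Y_def)
    have YT: "Y \<alpha> p \<in> T p" if "\<alpha> < ?n" for \<alpha> using vf_T[OF Yvf[OF that] p] .
    have X'T: "X' \<alpha> p \<in> T p" if "\<alpha> < ?n" for \<alpha> using vf_T[OF X'W[OF that]] p W(2) by blast
    have sumD: "(\<Sum>a<m. y a *\<^sub>R Y a p) \<in> D p" for y
      using YD subspace_D[OF pp] by (intro subspace_sum subspace_scale) auto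
    have sumP: "(\<Sum>i=m..<?n. y i *\<^sub>R Y i p) \<in> Dperp p" for y
      using YP subspace_perp[OF pp] by (intro subspace_sum subspace_scale) auto
    have split: "(\<Sum>\<alpha><?n. f \<alpha>) = (\<Sum>a<m. f a) + (\<Sum>i=m..<?n. f i)" for f :: "nat \<Rightarrow> 'q tvec"
      unfolding un by (rule sum.union_disjoint) auto
    have indep: "\<forall>\<alpha>\<in>{..<?n}. y \<alpha> = 0" if y: "(\<Sum>\<alpha><?n. y \<alpha> *\<^sub>R Y \<alpha> p) = 0" for y
    proof -
      let ?d = "\<Sum>i=m..<?n. y i *\<^sub>R proj p (X' i p)"
      have "?d \<in> D p"
        using riesz(1)[OF g_tensor X'T] subspace_D[OF pp] by (intro subspace_sum subspace_scale) auto
      then obtain z where z: "?d = (\<Sum>a<m. z a *\<^sub>R Y a p)"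
        using span_image_finite[of "{..<m}" ?d "\<lambda>a. Y a p"] spanD by blast
      \<comment> \<open>The projections subtracted in \<open>Y\<close> lie in \<open>D\<close>, so
        they are absorbed into the first \<open>m\<close> coefficients, and a relation among the
        fields \<open>Y\<close> becomes one among the fields \<open>X'\<close>.\<close>
      let ?y = "\<lambda>\<alpha>. if \<alpha> < m then y \<alpha> - z \<alpha> else y \<alpha>"
      have "(\<Sum>i=m..<?n. y i *\<^sub>R Y i p) = (\<Sum>i=m..<?n. y i *\<^sub>R X' i p) - ?d"
        unfolding sum_subtractf[symmetric] by (rule sum.cong) (auto simp: Y_def scaleR_right_diff_distrib)
      then have "0 = (\<Sum>a<m. y a *\<^sub>R Y a p) + (\<Sum>i=m..<?n. y i *\<^sub>R X' i p) - (\<Sum>a<m. z a *\<^sub>R Y a p)"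
        using y unfolding split z by (simp add: add_diff_eq)
      also have "\<dots> = (\<Sum>a<m. ?y a *\<^sub>R X' a p) + (\<Sum>i=m..<?n. ?y i *\<^sub>R X' i p)"
        by (simp add: Y_def scaleR_left_diff_distrib sum_subtractf)
      also have "\<dots> = (\<Sum>\<alpha><?n. ?y \<alpha> *\<^sub>R X' \<alpha> p)" by (rule split[symmetric])
      finally have y0: "(\<Sum>\<alpha><?n. ?y \<alpha> *\<^sub>R X' \<alpha> p) = 0" by (rule sym)
      have "\<delta> p \<noteq> 0" "p \<in> ?W0" using p by (auto simp: W_def)
      then have y': "\<forall>\<alpha><?n. ?y \<alpha> = 0" using ker[THEN iffD1, rule_format, OF _ _ y0] by blast
      then have yi: "y i = 0" if "i \<in> {m..<?n}" for i using that by (metis atLeastLessThan_iff not_le)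
      then have "(\<Sum>a<m. y a *\<^sub>R Y a p) = 0" using y unfolding split by simp
      then have "(\<Sum>a<m. y a *\<^sub>R X a p) = 0" by (simp add: Y_def X'_def)
      then have "\<forall>a\<in>{..<m}. y a = 0"
        using indexed_independent_iff[of "{..<m}" "\<lambda>a. X a p"] X(4)[OF p0(1)]
        unfolding basis_of_def by auto
      then show ?thesis using yi unfolding un by blast
    qed
    have basis: "basis_of {..<?n} (\<lambda>\<alpha>. Y \<alpha> p) (T p)"
      by (rule basis_ofI[OF _ indep YT lf_basis(3)[OF E p0(2)]])
         (auto simp: card_image[OF lf_basis(1)[OF E p0(2)]])
    have "span ((\<lambda>i. Y i p) ` {m..<?n}) \<subseteq> Dperp p"
      using YP subspace_perp[OF pp] by (intro span_minimal) auto
    moreover have "v \<in> span ((\<lambda>i. Y i p) ` {m..<?n})" if v: "v \<in> Dperp p" for v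
    proof -
      have "v \<in> span ((\<lambda>\<alpha>. Y \<alpha> p) ` {..<?n})"
        using v basis unfolding orthogonal_distribution_def basis_of_def by auto
      then obtain y where y: "v = (\<Sum>\<alpha><?n. y \<alpha> *\<^sub>R Y \<alpha> p)"
        using span_image_finite[of "{..<?n}" v "\<lambda>a. Y a p"] by auto
      have "(\<Sum>a<m. y a *\<^sub>R Y a p) = v - (\<Sum>i=m..<?n. y i *\<^sub>R Y i p)" unfolding y split by simp
      also have "\<dots> \<in> Dperp p" using v sumP subspace_perp[OF pp] subspace_diff by blast
      \<comment> \<open>The part in \<open>D\<close> is also orthogonal to \<open>D\<close>, hence
        zero.\<close>
      finally have "(\<Sum>a<m. y a *\<^sub>R Y a p) = 0" using D_Int_perp[OF pp sumD] by blast
      then have "v = (\<Sum>i=m..<?n. y i *\<^sub>R Y i p)" unfolding y split by simp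
      moreover have "(\<Sum>i=m..<?n. y i *\<^sub>R Y i p) \<in> span ((\<lambda>i. Y i p) ` {m..<?n})"
        by (intro span_sum span_scale) (simp add: span_base)
      ultimately show ?thesis by simp
    qed
    ultimately show ?thesis using basis spanD by blast
  qed
  have "adapted_frame Q g m D W Y"
    unfolding adapted_frame_def local_frame_def using main W(1) Yvf by blast
  then show ?thesis using that qW by blast
qed

end

section \<open>The nonholonomic field as push-forward minus vertical lift\<close>

context distribution_atlas
begin

lemma af_lf: "adapted_frame Q g m D U X \<Longrightarrow> local_frame Q U X"
  by (simp add: adapted_frame_def)

lemma af_points: "adapted_frame Q g m D U X \<Longrightarrow> q \<in> U \<Longrightarrow> q \<in> points Q"
  using af_lf lf_opn opn_points by blast

lemma af_le: "adapted_frame Q g m D U X \<Longrightarrow> q \<in> U \<Longrightarrow> a < m \<Longrightarrow> a < DIM('e)"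
  using m_le_n[OF af_points] by fastforce

lemma af_D:
  assumes "adapted_frame Q g m D U X" "q \<in> U" "a < m"
  shows "X a q \<in> D q"
  using assms span_base[of "X a q" "(\<lambda>a. X a q) ` {..<m}"] unfolding adapted_frame_def by blast

lemma af_perp:
  assumes "adapted_frame Q g m D U X" "q \<in> U" "i \<in> {m..<DIM('e)}"
  shows "X i q \<in> Dperp q"
  using assms span_base[of "X i q" "(\<lambda>a. X a q) ` {m..<DIM('e)}"] unfolding adapted_frame_def by blast

lemma af_T: "adapted_frame Q g m D U X \<Longrightarrow> q \<in> U \<Longrightarrow> a < m \<Longrightarrow> X a q \<in> T q"
  using lf_T[OF af_lf] af_le by blast

lemma qv_zeroI:
  assumes X: "local_frame Q U X" "q \<in> U" and I: "I \<subseteq> {..<DIM('e)}" and u: "u \<in> span ((\<lambda>\<alpha>. X \<alpha> q) ` I)"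
    and \<gamma>: "\<gamma> < DIM('e)" "\<gamma> \<notin> I"
  shows "quasi_velocity DIM('e) X \<gamma> (q, u) = 0"
proof -
  have fin: "finite I" using I finite_subset by blast
  obtain c where c: "u = (\<Sum>\<alpha>\<in>I. c \<alpha> *\<^sub>R X \<alpha> q)"
    using span_image_finite[OF fin u] by blast
  have "u = (\<Sum>\<alpha><DIM('e). (if \<alpha> \<in> I then c \<alpha> else 0) *\<^sub>R X \<alpha> q)"
    unfolding c by (rule sum.mono_neutral_cong_left) (use I in auto)
  then show ?thesis using qv_sum[OF X \<gamma>(1), of "\<lambda>\<alpha>. if \<alpha> \<in> I then c \<alpha> else 0"] \<gamma>(2) by simp
qed

lemma qv_D:
  assumes X: "adapted_frame Q g m D U X" "q \<in> U" and v: "v \<in> D q" and i: "i \<in> {m..<DIM('e)}"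
  shows "quasi_velocity DIM('e) X i (q, v) = 0"
  by (rule qv_zeroI[OF af_lf[OF X(1)] X(2), of "{..<m}"])
     (use X v i m_le_n[OF af_points[OF X]] in \<open>auto simp: adapted_frame_def\<close>)

lemma qv_perp:
  assumes X: "adapted_frame Q g m D U X" "q \<in> U" and v: "v \<in> Dperp q" and a: "a < m"
  shows "quasi_velocity DIM('e) X a (q, v) = 0"
  by (rule qv_zeroI[OF af_lf[OF X(1)] X(2), of "{m..<DIM('e)}"])
     (use X v a af_le[OF X a] in \<open>auto simp: adapted_frame_def\<close>)

lemma lessThan_split:
  assumes "q \<in> points Q"
  shows "{..<DIM('e)} = {..<m} \<union> {m..<DIM('e)}"
  using m_le_n[OF assms] by auto

lemma af_expand:
  assumes X: "adapted_frame Q g m D U X" "q \<in> U" and v: "v \<in> D q"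
  shows "(\<Sum>a<m. quasi_velocity DIM('e) X a (q, v) *\<^sub>R X a q) = v"
proof -
  have "(\<Sum>a<m. quasi_velocity DIM('e) X a (q, v) *\<^sub>R X a q) =
      (\<Sum>a<DIM('e). quasi_velocity DIM('e) X a (q, v) *\<^sub>R X a q)"
    by (rule sum.mono_neutral_left) (use lessThan_split[OF af_points[OF X]] qv_D[OF X v] in auto)
  then show ?thesis using qv_expand[OF af_lf[OF X(1)] X(2) D_T[OF af_points[OF X] v]] by simp
qed

lemma qv_proj:
  assumes X: "adapted_frame Q g m D U X" "q \<in> U" and u: "u \<in> T q"
  shows "a < m \<Longrightarrow> quasi_velocity DIM('e) X a (q, proj q u) = quasi_velocity DIM('e) X a (q, u)"
    "i \<in> {m..<DIM('e)} \<Longrightarrow> quasi_velocity DIM('e) X i (q, proj q u) = 0"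
proof -
  note p = riesz_T[OF g_tensor u]
  show "quasi_velocity DIM('e) X a (q, proj q u) = quasi_velocity DIM('e) X a (q, u)" if "a < m"
    using qv_add[OF af_lf[OF X(1)] X(2) af_le[OF X that] p T_diff[OF u p]] qv_perp[OF X minus_proj_perp[OF u] that]
    by simp
  show "quasi_velocity DIM('e) X i (q, proj q u) = 0" if "i \<in> {m..<DIM('e)}"
    using qv_D[OF X riesz(1)[OF g_tensor u] that] .
qed

lemma perp_expand:
  assumes X: "adapted_frame Q g m D U X" "q \<in> U" and u: "u \<in> T q"
  shows "(\<Sum>k\<in>{m..<DIM('e)}. quasi_velocity DIM('e) X k (q, u) *\<^sub>R X k q) = u - proj q u"
proof -
  have "u = (\<Sum>a\<in>{..<m} \<union> {m..<DIM('e)}. quasi_velocity DIM('e) X a (q, u) *\<^sub>R X a q)"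
    using qv_expand[OF af_lf[OF X(1)] X(2) u] lessThan_split[OF af_points[OF X]] by simp
  also have "\<dots> = (\<Sum>a<m. quasi_velocity DIM('e) X a (q, u) *\<^sub>R X a q) +
      (\<Sum>k\<in>{m..<DIM('e)}. quasi_velocity DIM('e) X k (q, u) *\<^sub>R X k q)"
    by (rule sum.union_disjoint) auto
  also have "(\<Sum>a<m. quasi_velocity DIM('e) X a (q, u) *\<^sub>R X a q) =
      (\<Sum>a<m. quasi_velocity DIM('e) X a (q, proj q u) *\<^sub>R X a q)"
    by (rule sum.cong) (simp_all add: qv_proj(1)[OF X u])
  also have "\<dots> = proj q u" by (rule af_expand[OF X riesz(1)[OF g_tensor u]])
  finally have "proj q u + (\<Sum>k\<in>{m..<DIM('e)}. quasi_velocity DIM('e) X k (q, u) *\<^sub>R X k q) = u" by (rule sym)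
  then show ?thesis by (simp only: eq_diff_eq add.commute)
qed

text \<open>Compared with the spray, the projection removes the normal part of the covariant
  derivative. The tangential equations are unchanged, and since \<open>V\<close> stays in
  \<open>D\<close> only coefficients with both lower indices below \<open>m\<close> survive in
  them.\<close>

lemma nonholonomic_field_eq:
  assumes V: "vector_field Q U V" "q \<in> U" and VD: "\<And>p. p \<in> U \<Longrightarrow> V p \<in> D p"
  shows "nonholonomic_field Q g m D (q, V q) =
    pushforward V q (V q) - vlift (proj q (nabla V V q)) (q, V q)"
  unfolding nonholonomic_field_def
proof (rule the_equality)
  let ?W = "pushforward V q (V q) - vlift (proj q (nabla V V q)) (q, V q)"
  have n: "nabla V V q \<in> T q" using nabla_T[OF V(1) V] .
  have pn: "proj q (nabla V V q) \<in> T q" using riesz_T[OF g_tensor n] .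
  have W1: "?W (quasi_velocity DIM('e) X d) =
      - (\<Sum>a<m. \<Sum>b<m. connection_coeff Q g X d a b (fst (q, V q)) *
          quasi_velocity DIM('e) X a (q, V q) * quasi_velocity DIM('e) X b (q, V q))"
    if X: "adapted_frame Q g m D U' X" "q \<in> U'" and d: "d < m" for U' X d
  proof -
    note dn = af_le[OF X d]
    have "(\<Sum>a<DIM('e). \<Sum>b<DIM('e). connection_coeff Q g X d a b q *
          quasi_velocity DIM('e) X a (q, V q) * quasi_velocity DIM('e) X b (q, V q)) =
        (\<Sum>a<m. \<Sum>b<DIM('e). connection_coeff Q g X d a b q *
          quasi_velocity DIM('e) X a (q, V q) * quasi_velocity DIM('e) X b (q, V q))"
      by (rule sum.mono_neutral_right)
         (use lessThan_split[OF af_points[OF X]] qv_D[OF X VD[OF V(2)]] in auto)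
    also have "\<dots> = (\<Sum>a<m. \<Sum>b<m. connection_coeff Q g X d a b q *
          quasi_velocity DIM('e) X a (q, V q) * quasi_velocity DIM('e) X b (q, V q))"
      by (intro sum.cong refl sum.mono_neutral_right)
         (use lessThan_split[OF af_points[OF X]] qv_D[OF X VD[OF V(2)]] in auto)
    finally show ?thesis
      using push_vlift_qv[OF af_lf[OF X(1)] X(2) V pn dn] qv_proj(1)[OF X n d]
        nabla_self_qv[OF af_lf[OF X(1)] X(2) V dn] by simp
  qed
  have W2: "?W (quasi_velocity DIM('e) X i) = 0"
    if X: "adapted_frame Q g m D U' X" "q \<in> U'" and i: "i \<in> {m..<DIM('e)}" for U' X i
  proof -
    have i': "i < DIM('e)" using i by simp
    have o: "opn (U \<inter> U')" using vf_opn[OF V(1)] lf_opn[OF af_lf[OF X(1)]] by blast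
    \<comment> \<open>The normal quasi-velocities vanish identically along a section of
      \<open>D\<close>, hence so do their derivatives.\<close>
    have "V q (\<lambda>p. quasi_velocity DIM('e) X i (p, V p)) = V q (\<lambda>p. 0)"
      by (rule tangent_local[OF vf_T[OF V] o]) (use V X qv_D[OF X(1) _ VD i] in auto)
    then show ?thesis
      using push_vlift_qv[OF af_lf[OF X(1)] X(2) V pn i'] qv_proj(2)[OF X n i] tangent_const[OF vf_T[OF V]] by simp
  qed
  show "second_order_vector Q (q, V q) ?W \<and>
     (\<forall>U X. adapted_frame Q g m D U X \<and> fst (q, V q) \<in> U \<longrightarrow>
        (\<forall>d<m. ?W (quasi_velocity DIM('e) X d) =
           - (\<Sum>a<m. \<Sum>b<m. connection_coeff Q g X d a b (fst (q, V q)) *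
                quasi_velocity DIM('e) X a (q, V q) * quasi_velocity DIM('e) X b (q, V q))) \<and>
        (\<forall>i\<in>{m..<DIM('e)}. ?W (quasi_velocity DIM('e) X i) = 0))"
    by (intro conjI allI impI ballI second_order_push_vlift[OF V pn]; elim conjE)
       (rule W1, simp_all only: fst_conv, rule W2)
  fix W assume W: "second_order_vector Q (q, V q) W \<and>
     (\<forall>U X. adapted_frame Q g m D U X \<and> fst (q, V q) \<in> U \<longrightarrow>
        (\<forall>d<m. W (quasi_velocity DIM('e) X d) =
           - (\<Sum>a<m. \<Sum>b<m. connection_coeff Q g X d a b (fst (q, V q)) *
                quasi_velocity DIM('e) X a (q, V q) * quasi_velocity DIM('e) X b (q, V q))) \<and>
        (\<forall>i\<in>{m..<DIM('e)}. W (quasi_velocity DIM('e) X i) = 0))"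
  obtain U' X where X: "adapted_frame Q g m D U' X" "q \<in> U'"
    using adapted_frame_ex[OF opn_points[OF vf_opn[OF V(1)] V(2)]] .
  show "W = ?W"
  proof (rule second_order_unique[OF af_lf[OF X(1)] X(2) vf_T[OF V] _ second_order_push_vlift[OF V pn]])
    show "second_order_vector Q (q, V q) W" using W by blast
    fix \<gamma> assume "\<gamma> < DIM('e)"
    then consider "\<gamma> < m" | "\<gamma> \<in> {m..<DIM('e)}" by force
    then show "W (quasi_velocity DIM('e) X \<gamma>) = ?W (quasi_velocity DIM('e) X \<gamma>)"
    proof cases
      case 1
      then show ?thesis using W X W1[OF X 1] by auto
    next
      case 2
      then show ?thesis using W X W2[OF X 2] by auto
    qed
  qed
qed

end

section \<open>The two conditions as components of one equation\<close>

definition A_expr :: "('q, 'e::euclidean_space) atlas \<Rightarrow> 'q tensor2 \<Rightarrow> nat \<Rightarrow> ('q \<Rightarrow> real) \<Rightarrow> 'q tensor2 \<Rightarrow>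
    (nat \<Rightarrow> 'q \<Rightarrow> 'q tvec) \<Rightarrow> 'q \<Rightarrow> 'q tvec \<Rightarrow> nat \<Rightarrow> real" where
  "A_expr Q g m F gbar X q v c =
        (\<Sum>a<m. \<Sum>b<m. \<Sum>d<m.
           g q (X b q) (X d q) * (of_bool (d = a) * X c q F - of_bool (d = c) * X a q F) *
           quasi_velocity DIM('e) X a (q, v) * quasi_velocity DIM('e) X b (q, v)) +
        (\<Sum>k\<in>{m..<DIM('e)}. \<Sum>a<m.
           theta Q m gbar X k (q, v) * structure_fun Q X k a c q *
           quasi_velocity DIM('e) X a (q, v))"

definition B_expr :: "('q, 'e::euclidean_space) atlas \<Rightarrow> 'q tensor2 \<Rightarrow> nat \<Rightarrow> ('q \<Rightarrow> 'q tvec set) \<Rightarrow>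
    ('q \<Rightarrow> real) \<Rightarrow> 'q tensor2 \<Rightarrow> (nat \<Rightarrow> 'q \<Rightarrow> 'q tvec) \<Rightarrow> 'q \<Rightarrow> 'q tvec \<Rightarrow> nat \<Rightarrow> real" where
  "B_expr Q g m D F gbar X q v i =
        nonholonomic_field Q g m D (q, v) (theta Q m gbar X i) +
        lagrange_multiplier Q g m X i (q, v) +
        (\<Sum>k\<in>{m..<DIM('e)}. \<Sum>a<m.
           theta Q m gbar X k (q, v) *
           (structure_fun Q X k i a q + of_bool (k = i) * X a q F) *
           quasi_velocity DIM('e) X a (q, v)) -
        (\<Sum>a<m. \<Sum>b<m.
           g q (X a q) (X b q) * X i q F *
           quasi_velocity DIM('e) X a (q, v) * quasi_velocity DIM('e) X b (q, v))"

lemma condition_A_iff: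
  "condition_A Q g m D F gbar \<longleftrightarrow>
    (\<forall>U X. adapted_frame Q g m D U X \<longrightarrow> (\<forall>q\<in>U. \<forall>v\<in>D q. \<forall>c<m. A_expr Q g m F gbar X q v c = 0))"
  unfolding condition_A_def A_expr_def ..

lemma condition_B_iff:
  fixes Q :: "('q, 'e::euclidean_space) atlas"
  shows "condition_B Q g m D F gbar \<longleftrightarrow>
    (\<forall>U X. adapted_frame Q g m D U X \<longrightarrow>
      (\<forall>q\<in>U. \<forall>v\<in>D q. \<forall>i\<in>{m..<DIM('e)}. B_expr Q g m D F gbar X q v i = 0))"
  unfolding condition_B_def B_expr_def ..

locale preserving_atlas = distribution_atlas Q g m D + bar: tensor_atlas Q gbar
  for Q :: "('q, 'e::euclidean_space) atlas" and g m D gbar +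
  fixes F :: "'q \<Rightarrow> real"
  assumes F: "smooth_fun Q (points Q) F"
    and preserving: "q \<in> points Q \<Longrightarrow> v \<in> D q \<Longrightarrow> w \<in> D q \<Longrightarrow> gbar q v w = g q v w"
begin

interpretation TB: smooth_atlas "tangent_bundle Q"
  by (rule smooth_atlas_tangent_bundle)

lemma F_smooth: "opn U \<Longrightarrow> smooth_fun Q U F"
  using smooth_fun_subset[OF F] opn_points by blast

lemma F_near: "q \<in> points Q \<Longrightarrow> smooth_near Q q F"
  using chart_ex opn_chart F_smooth smooth_nearI by metis

context
  fixes U X q v
  assumes X: "adapted_frame Q g m D U X" and q: "q \<in> U" and v: "v \<in> D q"
begin

lemma base_point: "q \<in> points Q"
  using af_points[OF X q] .

lemma velocity_tangent: "v \<in> T q"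
  using D_T[OF base_point v] .

lemma frame_local: "local_frame Q U X"
  using af_lf[OF X] .

lemma frame_tangent: "\<alpha> < DIM('e) \<Longrightarrow> X \<alpha> q \<in> T q"
  using lf_T[OF frame_local _ q] .

lemma frame_field: "\<alpha> < DIM('e) \<Longrightarrow> vector_field Q U (X \<alpha>)"
  using lf_vf[OF frame_local] .

text \<open>A section of \<open>D\<close> through \<open>v\<close> with coefficients frozen at
  \<open>q\<close>. Constant coefficients are what keeps derivative terms out of
  \<open>bracket_V\<close>.\<close>

definition extension :: "'q \<Rightarrow> 'q tvec" where
  "extension p = (\<Sum>a<m. quasi_velocity DIM('e) X a (q, v) *\<^sub>R X a p)"

lemma extension_field: "vector_field Q U extension"
  unfolding extension_def[abs_def] using lf_opn[OF frame_local] frame_field af_le[OF X q]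
  by (intro vf_lincomb smooth_fun_const) auto

lemma extension_at: "extension q = v"
  unfolding extension_def by (rule af_expand[OF X q v])

lemma extension_D: "p \<in> U \<Longrightarrow> extension p \<in> D p"
  unfolding extension_def using af_D[OF X] subspace_D[OF af_points[OF X]]
  by (intro subspace_sum subspace_scale) auto

lemma v_apply: "v f = (\<Sum>a<m. quasi_velocity DIM('e) X a (q, v) * X a q f)"
  using arg_cong[OF af_expand[OF X q v], of "\<lambda>v. v f"] by (simp add: sum_fun_apply scaleR_fun_def)

lemma left_v:
  assumes "tensor_atlas Q k" "w \<in> T q"
  shows "k q v w = (\<Sum>a<m. quasi_velocity DIM('e) X a (q, v) * k q (X a q) w)"
proof -
  interpret k: tensor_atlas Q k by fact
  have "k q (\<Sum>a<m. quasi_velocity DIM('e) X a (q, v) *\<^sub>R X a q) w =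
      (\<Sum>a<m. quasi_velocity DIM('e) X a (q, v) * k q (X a q) w)"
    by (rule k.lincomb_left[OF assms(2)]) (use frame_tangent af_le[OF X q] in auto)
  then show ?thesis by (simp add: af_expand[OF X q v])
qed

lemma bracket_V:
  assumes Z: "vector_field Q U Z"
  shows "lie_bracket Q extension Z q = (\<Sum>a<m. quasi_velocity DIM('e) X a (q, v) *\<^sub>R lie_bracket Q (X a) Z q)"
proof -
  have "lie_bracket Q (\<lambda>p. \<Sum>a\<in>J. c a *\<^sub>R X a p) Z q = (\<Sum>a\<in>J. c a *\<^sub>R lie_bracket Q (X a) Z q)"
    if "finite J" "J \<subseteq> {..<m}" for c and J :: "nat set"
    using that
  proof (induction J)
    case empty
    show ?case using lie_bracket_scale[OF Z Z smooth_fun_const[OF lf_opn[OF frame_local]] q, of 0]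
      by (simp only: sum.empty scaleR_zero_left tangent_const[OF vf_T[OF Z q]] diff_0_right)
  next
    case (insert a J)
    have Xa: "vector_field Q U (X a)" using frame_field af_le[OF X q] insert by blast
    have s: "vector_field Q U (\<lambda>p. \<Sum>a\<in>J. c a *\<^sub>R X a p)"
      using frame_field af_le[OF X q] insert lf_opn[OF frame_local] by (intro vf_lincomb smooth_fun_const) auto
    have IH: "lie_bracket Q (\<lambda>p. \<Sum>a\<in>J. c a *\<^sub>R X a p) Z q = (\<Sum>a\<in>J. c a *\<^sub>R lie_bracket Q (X a) Z q)"
      using insert by blast
    show ?case
      by (simp only: sum.insert[OF insert.hyps(1,2)] lie_bracket_add[OF vf_cscale[OF Xa] s Z q] IH
          lie_bracket_scale[OF Xa Z smooth_fun_const[OF lf_opn[OF frame_local]] q] tangent_const[OF vf_T[OF Z q]]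
          scaleR_zero_left diff_0_right)
  qed
  from this[of "{..<m}"] show ?thesis unfolding extension_def[abs_def] by simp
qed

lemma theta_D:
  assumes "p \<in> U" "u \<in> D p" "k < DIM('e)"
  shows "theta Q m gbar X k (p, u) = gbar p u (X k p)"
proof -
  have "gbar p (\<Sum>a<m. quasi_velocity DIM('e) X a (p, u) *\<^sub>R X a p) (X k p) =
      (\<Sum>a<m. quasi_velocity DIM('e) X a (p, u) * gbar p (X a p) (X k p))"
    by (rule bar.lincomb_left) (use af_T[OF X assms(1)] lf_T[OF frame_local assms(3,1)] in auto)
  then show ?thesis by (simp add: theta_def af_expand[OF X assms(1,2)] mult.commute)
qed

text \<open>The sum sees only the part of \<open>u\<close> orthogonal to \<open>D\<close>. On the
  part in \<open>D\<close> the tensors \<open>gbar\<close> and \<open>g\<close> agree, so what is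
  left is the difference of the two pairings with \<open>v\<close>. This removes the structure
  functions from (A') and (B').\<close>

lemma perp_pairing:
  assumes u: "u \<in> T q"
  shows "(\<Sum>k\<in>{m..<DIM('e)}. theta Q m gbar X k (q, v) * quasi_velocity DIM('e) X k (q, u)) = gbar q v u - g q v u"
proof -
  note p = riesz_T[OF g_tensor u] and pD = riesz(1)[OF g_tensor u]
  have "(\<Sum>k\<in>{m..<DIM('e)}. theta Q m gbar X k (q, v) * quasi_velocity DIM('e) X k (q, u)) =
      (\<Sum>k\<in>{m..<DIM('e)}. quasi_velocity DIM('e) X k (q, u) * gbar q v (X k q))"
    by (rule sum.cong) (simp_all add: theta_D[OF q v])
  also have "\<dots> = gbar q v (u - proj q u)"
    unfolding perp_expand[OF X q u, symmetric]
    by (rule bar.lincomb_right[symmetric, OF velocity_tangent]) (use frame_tangent in auto)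
  also have "\<dots> = gbar q v u - g q v (proj q u)"
    using preserving[OF base_point v pD] by (simp add: bar.diff_right[OF u p velocity_tangent])
  also have "g q v (proj q u) = g q v u"
    using riesz(2)[OF g_tensor u v] tensor_sym[OF velocity_tangent p] tensor_sym[OF velocity_tangent u] by simp
  finally show ?thesis .
qed

text \<open>The normal components of \<open>extension\<close> vanish, so those of its covariant
  derivative along itself have no derivative term and are exactly the sums in the multiplier. Since
  \<open>X i\<close> is orthogonal to \<open>D\<close>, the tangential components drop out of the
  pairing.\<close>

lemma nabla_perp:
  assumes i: "i \<in> {m..<DIM('e)}"
  shows "lagrange_multiplier Q g m X i (q, v) = g q (nabla extension extension q) (X i q)"
proof -
  let ?n = "nabla extension extension q"
  have n: "?n \<in> T q" using nabla_T[OF extension_field extension_field q] .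
  have k: "quasi_velocity DIM('e) X k (q, ?n) = (\<Sum>a<m. \<Sum>b<m. connection_coeff Q g X k a b q *
      quasi_velocity DIM('e) X a (q, v) * quasi_velocity DIM('e) X b (q, v))" if k: "k \<in> {m..<DIM('e)}" for k
  proof -
    have "extension q (\<lambda>p. quasi_velocity DIM('e) X k (p, extension p)) = extension q (\<lambda>p. 0)"
      by (rule tangent_local[OF vf_T[OF extension_field q] lf_opn[OF frame_local] q]) (use qv_D[OF X _ extension_D k] in auto)
    then have "quasi_velocity DIM('e) X k (q, ?n) = (\<Sum>a<DIM('e). \<Sum>b<DIM('e). connection_coeff Q g X k a b q *
        quasi_velocity DIM('e) X a (q, v) * quasi_velocity DIM('e) X b (q, v))"
      using nabla_self_qv[OF frame_local q extension_field q, of k] k tangent_const[OF vf_T[OF extension_field q]] by (simp add: extension_at)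
    also have "\<dots> = (\<Sum>a<m. \<Sum>b<DIM('e). connection_coeff Q g X k a b q *
        quasi_velocity DIM('e) X a (q, v) * quasi_velocity DIM('e) X b (q, v))"
      by (rule sum.mono_neutral_right) (use lessThan_split[OF base_point] qv_D[OF X q v] in auto)
    also have "\<dots> = (\<Sum>a<m. \<Sum>b<m. connection_coeff Q g X k a b q *
        quasi_velocity DIM('e) X a (q, v) * quasi_velocity DIM('e) X b (q, v))"
      by (intro sum.cong refl sum.mono_neutral_right) (use lessThan_split[OF base_point] qv_D[OF X q v] in auto)
    finally show ?thesis .
  qed
  have Xi: "X i q \<in> T q" using frame_tangent i by simp
  have "lagrange_multiplier Q g m X i (q, v) =
      (\<Sum>k\<in>{m..<DIM('e)}. quasi_velocity DIM('e) X k (q, ?n) * g q (X k q) (X i q))"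
    unfolding lagrange_multiplier_def by (rule sum.cong) (simp_all add: k)
  also have "\<dots> = g q (?n - proj q ?n) (X i q)"
    unfolding perp_expand[OF X q n, symmetric]
    by (rule lincomb_left[symmetric, OF Xi]) (use frame_tangent in auto)
  also have "\<dots> = g q ?n (X i q)"
    using af_perp[OF X q i] riesz(1)[OF g_tensor n] riesz_T[OF g_tensor n] Xi
    by (simp add: diff_left[OF n _ Xi] orthogonal_distribution_def tensor_sym[OF _ Xi])
  finally show ?thesis .
qed

lemma A_expr_eq:
  assumes c: "c < m"
  shows "A_expr Q g m F gbar X q v c = X c q F * g q v v - v F * g q v (X c q) +
    (gbar q v (lie_bracket Q extension (X c) q) - g q v (lie_bracket Q extension (X c) q))"
proof -
  let ?v = "\<lambda>a. quasi_velocity DIM('e) X a (q, v)"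
  have cn: "c < DIM('e)" using af_le[OF X q c] .
  \<comment> \<open>The two Kronecker symbols contract the sum over \<open>d\<close>, the first to
    \<open>d = a\<close> and the second to \<open>d = c\<close>.\<close>
  have d: "(\<Sum>d<m. g q (X b q) (X d q) * (of_bool (d = a) * X c q F - of_bool (d = c) * X a q F) * ?v a * ?v b) =
      X c q F * (?v a * (?v b * g q (X b q) (X a q))) - (?v a * X a q F) * (?v b * g q (X b q) (X c q))"
    if a: "a < m" for a b
  proof -
    have "(\<Sum>d<m. g q (X b q) (X d q) * (of_bool (d = a) * X c q F - of_bool (d = c) * X a q F) * ?v a * ?v b) =
       (\<Sum>d<m. if d = a then X c q F * (?v a * (?v b * g q (X b q) (X d q))) else 0) -
       (\<Sum>d<m. if d = c then (?v a * X a q F) * (?v b * g q (X b q) (X d q)) else 0)"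
      unfolding sum_subtractf[symmetric] by (rule sum.cong) (auto simp: algebra_simps)
    then show ?thesis using a c by simp
  qed
  have "(\<Sum>a<m. \<Sum>b<m. \<Sum>d<m. g q (X b q) (X d q) * (of_bool (d = a) * X c q F - of_bool (d = c) * X a q F) * ?v a * ?v b) =
      (\<Sum>a<m. \<Sum>b<m. X c q F * (?v a * (?v b * g q (X b q) (X a q))) - (?v a * X a q F) * (?v b * g q (X b q) (X c q)))"
    by (intro sum.cong refl d) simp
  also have "\<dots> = X c q F * (\<Sum>a<m. ?v a * (\<Sum>b<m. ?v b * g q (X b q) (X a q))) -
      (\<Sum>a<m. ?v a * X a q F) * (\<Sum>b<m. ?v b * g q (X b q) (X c q))"
    by (simp only: sum_subtractf sum_product, simp only: sum_distrib_left)
  also have "(\<Sum>b<m. ?v b * g q (X b q) (X c q)) = g q v (X c q)"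
    using left_v[OF g_tensor frame_tangent[OF cn]] by simp
  also have "(\<Sum>a<m. ?v a * (\<Sum>b<m. ?v b * g q (X b q) (X a q))) = (\<Sum>a<m. ?v a * g q (X a q) v)"
    using left_v[OF g_tensor frame_tangent] af_le[OF X q] tensor_sym[OF frame_tangent velocity_tangent] by (intro sum.cong refl) simp
  also have "\<dots> = g q v v" using left_v[OF g_tensor velocity_tangent] by simp
  also have "(\<Sum>a<m. ?v a * X a q F) = v F" using v_apply by simp
  finally have 1: "(\<Sum>a<m. \<Sum>b<m. \<Sum>d<m. g q (X b q) (X d q) * (of_bool (d = a) * X c q F - of_bool (d = c) * X a q F) * ?v a * ?v b) =
      X c q F * g q v v - v F * g q v (X c q)" .
  have bT: "lie_bracket Q (X a) (X c) q \<in> T q" if "a < m" for a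
    using bracket_T[OF frame_field frame_field q] af_le[OF X q that] cn by blast
  \<comment> \<open>Contracting the structure functions with \<open>v\<close> gives the normal
    components of the bracket of \<open>extension\<close> with \<open>X c\<close>.\<close>
  have "(\<Sum>a<m. theta Q m gbar X k (q, v) * structure_fun Q X k a c q * ?v a) =
      theta Q m gbar X k (q, v) * quasi_velocity DIM('e) X k (q, lie_bracket Q extension (X c) q)" if k: "k \<in> {m..<DIM('e)}" for k
  proof -
    have "quasi_velocity DIM('e) X k (q, lie_bracket Q extension (X c) q) = (\<Sum>a<m. ?v a * structure_fun Q X k a c q)"
      unfolding bracket_V[OF frame_field[OF cn]] structure_fun_def
      by (rule qv_lincomb[OF frame_local q]) (use k bT in auto)
    then show ?thesis by (simp add: sum_distrib_left mult_ac)
  qed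
  then have "(\<Sum>k\<in>{m..<DIM('e)}. \<Sum>a<m. theta Q m gbar X k (q, v) * structure_fun Q X k a c q * ?v a) =
      gbar q v (lie_bracket Q extension (X c) q) - g q v (lie_bracket Q extension (X c) q)"
    using perp_pairing[OF bracket_T[OF extension_field frame_field[OF cn] q]] by simp
  with 1 show ?thesis unfolding A_expr_def by simp
qed

text \<open>A tangent vector of \<open>TQ\<close> takes the default \<open>0\<close> on functions
  that are not smooth, so the derivative of theta_i in (B') has its meaning only through
  this.\<close>

lemma theta_smooth_near:
  assumes i: "i < DIM('e)"
  shows "smooth_near (tangent_bundle Q) (q, v) (theta Q m gbar X i)"
proof -
  have "smooth_near (tangent_bundle Q) (q, v) (\<lambda>w. \<Sum>a<m. ((\<lambda>p. gbar p (X a p) (X i p)) \<circ> fst) w * quasi_velocity DIM('e) X a w)"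
    using af_le[OF X q] velocity_tangent i base_point
    by (intro TB.smooth_near_sum TB.smooth_near_mult smooth_near_fst bar.smooth_nearby[OF frame_field frame_field q]
        smooth_near_qv[OF frame_local _ q]) (auto simp: points_tangent_bundle)
  then show ?thesis by (simp add: theta_def[abs_def])
qed

text \<open>The push-forward differentiates \<open>theta\<close> along the section, where it is a
  pairing by \<open>gbar\<close>; the vertical lift evaluates the fibrewise linear function
  \<open>theta\<close> at the projected covariant derivative.\<close>

lemma nonholonomic_theta:
  assumes i: "i < DIM('e)"
  shows "nonholonomic_field Q g m D (q, v) (theta Q m gbar X i) =
    v (\<lambda>p. gbar p (extension p) (X i p)) - gbar q (proj q (nabla extension extension q)) (X i q)"
proof -
  let ?a = "proj q (nabla extension extension q)"
  have n: "nabla extension extension q \<in> T q" using nabla_T[OF extension_field extension_field q] .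
  note aT = riesz_T[OF g_tensor n] and aD = riesz(1)[OF g_tensor n]
  note s = theta_smooth_near[OF i]
  have "theta Q m gbar X i (q, v + r *\<^sub>R ?a) = theta Q m gbar X i (q, v) + r * theta Q m gbar X i (q, ?a)" for r
    using qv_add[OF frame_local q _ velocity_tangent T_scale[OF aT]] qv_scale[OF frame_local q _ aT] af_le[OF X q]
    by (simp add: theta_def sum_distrib_left algebra_simps flip: sum.distrib)
  then have "vlift ?a (q, v) (theta Q m gbar X i) = gbar q ?a (X i q)"
    using vlift_linear[OF s, of ?a] theta_D[OF q aD i] by simp
  moreover have "pushforward extension q v (theta Q m gbar X i) = v (\<lambda>p. theta Q m gbar X i (p, extension p))"
    using s by (simp add: pushforward_def extension_at)
  moreover have "v (\<lambda>p. theta Q m gbar X i (p, extension p)) = v (\<lambda>p. gbar p (extension p) (X i p))"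
    by (rule tangent_local[OF velocity_tangent lf_opn[OF frame_local] q]) (rule theta_D[OF _ extension_D i])
  ultimately show ?thesis
    using nonholonomic_field_eq[OF extension_field q extension_D] by (simp add: extension_at fun_diff_def)
qed

lemma B_expr_eq:
  assumes i: "i \<in> {m..<DIM('e)}"
  shows "B_expr Q g m D F gbar X q v i =
    v (\<lambda>p. gbar p (extension p) (X i p)) - gbar q (proj q (nabla extension extension q)) (X i q) + g q (nabla extension extension q) (X i q) -
    (gbar q v (lie_bracket Q extension (X i) q) - g q v (lie_bracket Q extension (X i) q)) +
    v F * gbar q v (X i q) - X i q F * g q v v"
proof -
  let ?v = "\<lambda>a. quasi_velocity DIM('e) X a (q, v)"
  have i': "i < DIM('e)" using i by simp
  have bT: "lie_bracket Q (X a) (X i) q \<in> T q" if "a < m" for a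
    using bracket_T[OF frame_field frame_field q] af_le[OF X q that] i' by blast
  \<comment> \<open>The sign comes from the order of the lower indices: (B') has i before a, while
    the bracket has \<open>extension\<close> first.\<close>
  have R: "(\<Sum>a<m. structure_fun Q X k i a q * ?v a) = - quasi_velocity DIM('e) X k (q, lie_bracket Q extension (X i) q)"
    if k: "k \<in> {m..<DIM('e)}" for k
  proof -
    have kn: "k < DIM('e)" using k by simp
    have "structure_fun Q X k i a q = - quasi_velocity DIM('e) X k (q, lie_bracket Q (X a) (X i) q)" if "a < m" for a
      using qv_scale[OF frame_local q kn bT[OF that], of "-1"] lie_bracket_antisym[of "X i" "X a" q]
      by (simp add: structure_fun_def)
    moreover have "quasi_velocity DIM('e) X k (q, lie_bracket Q extension (X i) q) =
        (\<Sum>a<m. ?v a * quasi_velocity DIM('e) X k (q, lie_bracket Q (X a) (X i) q))"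
      unfolding bracket_V[OF frame_field[OF i']] by (rule qv_lincomb[OF frame_local q kn]) (use bT in auto)
    ultimately show ?thesis by (simp add: sum_negf mult.commute)
  qed
  \<comment> \<open>The Kronecker symbol singles out \<open>k = i\<close>, and the contraction of
    the derivatives of \<open>F\<close> with \<open>v\<close> is \<open>v F\<close>.\<close>
  have "(\<Sum>a<m. theta Q m gbar X k (q, v) * (structure_fun Q X k i a q + of_bool (k = i) * X a q F) * ?v a) =
      - (theta Q m gbar X k (q, v) * quasi_velocity DIM('e) X k (q, lie_bracket Q extension (X i) q)) +
      (if k = i then theta Q m gbar X k (q, v) * v F else 0)" if k: "k \<in> {m..<DIM('e)}" for k
  proof -
    have "(\<Sum>a<m. theta Q m gbar X k (q, v) * (structure_fun Q X k i a q + of_bool (k = i) * X a q F) * ?v a) =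
      theta Q m gbar X k (q, v) * (\<Sum>a<m. structure_fun Q X k i a q * ?v a) +
      of_bool (k = i) * (theta Q m gbar X k (q, v) * (\<Sum>a<m. ?v a * X a q F))"
      by (simp add: sum_distrib_left sum.distrib algebra_simps)
    then show ?thesis using R[OF k] v_apply[of F] by simp
  qed
  then have "(\<Sum>k\<in>{m..<DIM('e)}. \<Sum>a<m. theta Q m gbar X k (q, v) * (structure_fun Q X k i a q + of_bool (k = i) * X a q F) * ?v a) =
      (\<Sum>k\<in>{m..<DIM('e)}. - (theta Q m gbar X k (q, v) * quasi_velocity DIM('e) X k (q, lie_bracket Q extension (X i) q)) +
      (if k = i then theta Q m gbar X k (q, v) * v F else 0))"
    by (intro sum.cong refl)
  also have "\<dots> = - (gbar q v (lie_bracket Q extension (X i) q) - g q v (lie_bracket Q extension (X i) q)) + gbar q v (X i q) * v F"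
    using perp_pairing[OF bracket_T[OF extension_field frame_field[OF i'] q]] i theta_D[OF q v i']
    by (simp add: sum_subtractf)
  finally have 1: "(\<Sum>k\<in>{m..<DIM('e)}. \<Sum>a<m. theta Q m gbar X k (q, v) * (structure_fun Q X k i a q + of_bool (k = i) * X a q F) * ?v a) =
    - (gbar q v (lie_bracket Q extension (X i) q) - g q v (lie_bracket Q extension (X i) q)) + gbar q v (X i q) * v F" .
  have "(\<Sum>a<m. \<Sum>b<m. g q (X a q) (X b q) * X i q F * ?v a * ?v b) =
      X i q F * (\<Sum>a<m. ?v a * (\<Sum>b<m. ?v b * g q (X b q) (X a q)))"
    using af_le[OF X q] frame_tangent by (simp add: sum_distrib_left mult_ac tensor_sym[of "X _ q" q "X _ q"])
  also have "(\<Sum>a<m. ?v a * (\<Sum>b<m. ?v b * g q (X b q) (X a q))) = (\<Sum>a<m. ?v a * g q (X a q) v)"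
    using left_v[OF g_tensor frame_tangent] af_le[OF X q] tensor_sym[OF frame_tangent velocity_tangent] by (intro sum.cong refl) simp
  also have "\<dots> = g q v v" using left_v[OF g_tensor velocity_tangent] by simp
  finally show ?thesis
    unfolding B_expr_def nonholonomic_theta[OF i'] nabla_perp[OF i] 1 by (simp add: mult.commute)
qed

end

end

lemma (in smooth_atlas) riemannian_atlasI: "riemannian_metric Q h \<Longrightarrow> riemannian_atlas Q h"
  by unfold_locales (auto simp: riemannian_metric_def dest: tangent_points)

section \<open>The projective equation tested against one field\<close>

context preserving_atlas
begin

text \<open>Divided by \<open>exp (2 * F q)\<close>, the pairing with \<open>Z\<close> under e^{2F}
  gbar of the defect in the projective equation, after Koszul's formula. The coefficient of
  \<open>v F\<close> is 2 from differentiating the weight minus 1 from the Liouville term; the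
  coefficient of \<open>Z q F\<close> is half of 2. No connection of the rescaled tensor appears, so
  the expression makes sense before that tensor is known to be a metric.\<close>

definition residual :: "(nat \<Rightarrow> 'q \<Rightarrow> 'q tvec) \<Rightarrow> 'q \<Rightarrow> 'q tvec \<Rightarrow> ('q \<Rightarrow> 'q tvec) \<Rightarrow> real" where
  "residual X q v Z = gbar q (proj q (nabla (extension X q v) (extension X q v) q)) (Z q) -
     (v F * gbar q v (Z q) + v (\<lambda>p. gbar p (extension X q v p) (Z p)) - Z q F * g q v v -
      Z q (\<lambda>p. g p (extension X q v p) (extension X q v p)) / 2 - gbar q v (lie_bracket Q (extension X q v) Z q))"

context
  fixes U X q v
  assumes X: "adapted_frame Q g m D U X" and q: "q \<in> U" and v: "v \<in> D q"
begin

lemmas frame = X q v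

text \<open>Paired with a field of \<open>D\<close>, the projected derivative can be evaluated by
  Koszul's formula for \<open>g\<close>. The derivative terms of the two formulas agree and cancel,
  leaving the derivatives of \<open>F\<close> and the difference of the bracket pairings.\<close>

lemma A_expr_residual:
  assumes c: "c < m"
  shows "A_expr Q g m F gbar X q v c = residual X q v (X c)"
proof -
  let ?V = "extension X q v"
  have cn: "c < DIM('e)" using af_le[OF X q c] .
  note extension_field = extension_field[OF frame] and extension_at = extension_at[OF frame] and extension_D = extension_D[OF frame] and velocity_tangent = velocity_tangent[OF frame] and base_point = base_point[OF frame]
  note Xc = frame_field[OF frame cn] and o = lf_opn[OF frame_local[OF frame]]
  have n: "nabla ?V ?V q \<in> T q" using nabla_T[OF extension_field extension_field q] .
  have "gbar q (proj q (nabla ?V ?V q)) (X c q) = g q (nabla ?V ?V q) (X c q)"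
    using preserving[OF base_point riesz(1)[OF g_tensor n] af_D[OF X q c]] riesz(2)[OF g_tensor n af_D[OF X q c]] by simp
  moreover have "v (\<lambda>p. gbar p (?V p) (X c p)) = v (\<lambda>p. g p (?V p) (X c p))"
    by (rule tangent_local[OF velocity_tangent o q]) (use preserving[OF af_points[OF X] extension_D af_D[OF X _ c]] in blast)
  moreover have "gbar q v (X c q) = g q v (X c q)" by (rule preserving[OF base_point v af_D[OF X q c]])
  ultimately show ?thesis
    unfolding A_expr_eq[OF frame c] residual_def
    using nabla_self[OF extension_field Xc q] tensor_sym[OF velocity_tangent bracket_T[OF extension_field Xc q]] by (simp add: extension_at)
qed

text \<open>The section is orthogonal to \<open>X i\<close> throughout \<open>U\<close>, so Koszul's
  formula for the multiplier loses its first term. What remains converts the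
  \<open>g\<close>-pairing of the bracket into half the derivative of the squared length of the
  section.\<close>

lemma B_expr_residual:
  assumes i: "i \<in> {m..<DIM('e)}"
  shows "B_expr Q g m D F gbar X q v i = - residual X q v (X i)"
proof -
  let ?V = "extension X q v"
  have i': "i < DIM('e)" using i by simp
  note extension_field = extension_field[OF frame] and extension_at = extension_at[OF frame] and extension_D = extension_D[OF frame] and velocity_tangent = velocity_tangent[OF frame]
  note Xi = frame_field[OF frame i'] and o = lf_opn[OF frame_local[OF frame]]
  have "v (\<lambda>p. g p (?V p) (X i p)) = v (\<lambda>p. 0)"
  proof (rule tangent_local[OF velocity_tangent o q])
    fix p assume p: "p \<in> U"
    show "g p (?V p) (X i p) = 0"
      using af_perp[OF X p i] extension_D[OF p] tensor_sym[OF vf_T[OF extension_field p] vf_T[OF Xi p]]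
      by (simp add: orthogonal_distribution_def)
  qed
  then have "v (\<lambda>p. g p (?V p) (X i p)) = 0" using tangent_const[OF velocity_tangent] by simp
  then show ?thesis
    unfolding B_expr_eq[OF frame i] residual_def
    using nabla_self[OF extension_field Xi q] tensor_sym[OF velocity_tangent bracket_T[OF extension_field Xi q]] by (simp add: extension_at)
qed

end

end

section \<open>Comparison with the spray of the rescaled metric\<close>

locale conformal_atlas = preserving_atlas Q g m D gbar F + hat: riemannian_atlas Q ghat
  for Q :: "('q, 'e::euclidean_space) atlas" and g m D gbar F ghat +
  assumes rescaling: "q \<in> points Q \<Longrightarrow> u \<in> tangent_space Q q \<Longrightarrow> w \<in> tangent_space Q q \<Longrightarrow>
    ghat q u w = exp (2 * F q) * gbar q u w"
begin

lemma hat_deriv: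
  assumes A: "A \<in> T q" and Y: "vector_field Q U Y" and Z: "vector_field Q U Z" and q: "q \<in> U"
  shows "A (\<lambda>p. ghat p (Y p) (Z p)) =
    exp (2 * F q) * (2 * A F * gbar q (Y q) (Z q) + A (\<lambda>p. gbar p (Y p) (Z p)))"
proof -
  have base_point: "q \<in> points Q" using tangent_points[OF A] .
  have F2: "smooth_near Q q (\<lambda>p. 2 * F p)"
    by (rule smooth_near_mult[OF smooth_near_const[OF base_point] F_near[OF base_point]])
  have e: "smooth_near Q q (\<lambda>p. exp (2 * F p))"
    by (rule smooth_nearI[OF vf_opn[OF Y] q])
       (intro smooth_fun_exp smooth_fun_cmult vf_opn[OF Y] F_smooth)
  have "A (\<lambda>p. ghat p (Y p) (Z p)) = A (\<lambda>p. exp (2 * F p) * gbar p (Y p) (Z p))"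
    by (rule tangent_local[OF A vf_opn[OF Y] q])
       (rule rescaling[OF opn_points[OF vf_opn[OF Y]] vf_T[OF Y] vf_T[OF Z]])
  also have "\<dots> = exp (2 * F q) * (2 * A F * gbar q (Y q) (Z q) + A (\<lambda>p. gbar p (Y p) (Z p)))"
    using tangent_mult[OF A e bar.smooth_nearby[OF Y Z q]] tangent_exp[OF A F2] tangent_cmult[OF A F_near[OF base_point], of 2]
    by (simp add: algebra_simps)
  finally show ?thesis .
qed

text \<open>Lifted to the tangent bundle, the projective equation compares two vertical vectors, hence
  two vectors of the tangent space of \<open>Q\<close>. Their difference has pairings \<open>e\<^sup>2\<^sup>F\<close> times
  \<open>residual\<close> with the frame under \<open>ghat\<close>.\<close>

lemma projective_iff:
  assumes X: "adapted_frame Q g m D U X" and q: "q \<in> U" and v: "v \<in> D q"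
  shows "nonholonomic_field Q g m D (q, v) = geodesic_spray Q ghat (q, v) + v F *\<^sub>R liouville Q (q, v) \<longleftrightarrow>
    (\<forall>c<m. A_expr Q g m F gbar X q v c = 0) \<and> (\<forall>i\<in>{m..<DIM('e)}. B_expr Q g m D F gbar X q v i = 0)"
proof -
  note frame = X q v
  let ?V = "extension X q v"
  note extension_field = extension_field[OF frame] and extension_at = extension_at[OF frame] and extension_D = extension_D[OF frame] and velocity_tangent = velocity_tangent[OF frame] and base_point = base_point[OF frame]
  note frame_local = frame_local[OF frame] and frame_field = frame_field[OF frame] and frame_tangent = frame_tangent[OF frame]
  let ?a = "proj q (nabla ?V ?V q)" and ?b = "hat.nabla ?V ?V q"
  \<comment> \<open>Both sides of the projective equation are the same push-forward minus a vertical
    lift. Adding \<open>v F\<close> times the lift of \<open>v\<close> to the spray subtracts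
    \<open>v F\<close> times \<open>v\<close> from the lifted vector.\<close>
  let ?d = "?b + (- v F) *\<^sub>R v"
  have n: "nabla ?V ?V q \<in> T q" using nabla_T[OF extension_field extension_field q] .
  have a: "?a \<in> T q" using riesz_T[OF g_tensor n] .
  have b: "?b \<in> T q" using hat.nabla_T[OF extension_field extension_field q] .
  have d: "?d \<in> T q" using T_add[OF b T_scale[OF velocity_tangent]] .
  have nh: "nonholonomic_field Q g m D (q, v) = pushforward ?V q v - vlift ?a (q, v)"
    using nonholonomic_field_eq[OF extension_field q extension_D] by (simp add: extension_at)
  have sp: "geodesic_spray Q ghat (q, v) = pushforward ?V q v - vlift ?b (q, v)"
    using hat.geodesic_spray_eq[OF extension_field q] by (simp add: extension_at)
  have "vlift ?d (q, v) = vlift ?b (q, v) - v F *\<^sub>R vlift v (q, v)"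
    unfolding vlift_add[OF velocity_tangent b T_scale[OF velocity_tangent]] vlift_scale[OF velocity_tangent velocity_tangent] by simp
  then have "nonholonomic_field Q g m D (q, v) = geodesic_spray Q ghat (q, v) + v F *\<^sub>R liouville Q (q, v) \<longleftrightarrow>
      vlift ?a (q, v) = vlift ?d (q, v)"
    unfolding nh sp liouville_eq_vlift[OF velocity_tangent] by (auto simp: algebra_simps)
  also have "\<dots> \<longleftrightarrow> ?a = ?d" using vlift_inj[OF velocity_tangent a d] by auto
  also have "\<dots> \<longleftrightarrow> (\<forall>\<gamma><DIM('e). ghat q ?a (X \<gamma> q) = ghat q ?d (X \<gamma> q))"
    using hat.frame_eqI[OF frame_local q a d] by auto
  also have "\<dots> \<longleftrightarrow> (\<forall>\<gamma><DIM('e). residual X q v (X \<gamma>) = 0)"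
  proof -
    have "ghat q ?a (X \<gamma> q) - ghat q ?d (X \<gamma> q) = exp (2 * F q) * residual X q v (X \<gamma>)" if \<gamma>: "\<gamma> < DIM('e)" for \<gamma>
    proof -
      note Z = frame_field[OF \<gamma>] and ZT = frame_tangent[OF \<gamma>]
      have "X \<gamma> q (\<lambda>p. gbar p (?V p) (?V p)) = X \<gamma> q (\<lambda>p. g p (?V p) (?V p))"
        by (rule tangent_local[OF ZT lf_opn[OF frame_local] q]) (rule preserving[OF af_points[OF X] extension_D extension_D])
      then have hb: "ghat q ?b (X \<gamma> q) = exp (2 * F q) * (2 * v F * gbar q v (X \<gamma> q) + v (\<lambda>p. gbar p (?V p) (X \<gamma> p)) -
          X \<gamma> q F * g q v v - X \<gamma> q (\<lambda>p. g p (?V p) (?V p)) / 2 - gbar q v (lie_bracket Q ?V (X \<gamma>) q))"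
        using hat.nabla_self[OF extension_field Z q] hat_deriv[OF velocity_tangent extension_field Z q] hat_deriv[OF ZT extension_field extension_field q]
          rescaling[OF base_point bracket_T[OF extension_field Z q] velocity_tangent] bar.tensor_sym[OF velocity_tangent bracket_T[OF extension_field Z q]]
          preserving[OF base_point v v]
        by (simp add: extension_at algebra_simps add_divide_distrib)
      \<comment> \<open>This lowers the coefficient of the term
        \<open>v F * gbar q v (X \<gamma> q)\<close> from 2 to 1.\<close>
      have "ghat q ?d (X \<gamma> q) = ghat q ?b (X \<gamma> q) - v F * ghat q v (X \<gamma> q)"
        unfolding hat.add_left[OF b T_scale[OF velocity_tangent] ZT] hat.scale_left[OF velocity_tangent ZT] by simp
      then show ?thesis
        unfolding hb residual_def using rescaling[OF base_point a ZT] rescaling[OF base_point velocity_tangent ZT] by (simp add: algebra_simps)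
    qed
    then show ?thesis by (metis diff_eq_diff_eq eq_iff_diff_eq_0 exp_not_eq_zero mult_eq_0_iff)
  qed
  also have "\<dots> \<longleftrightarrow> (\<forall>c<m. residual X q v (X c) = 0) \<and> (\<forall>i\<in>{m..<DIM('e)}. residual X q v (X i) = 0)"
    using lessThan_split[OF base_point] by (metis Un_iff lessThan_iff)
  finally show ?thesis
    using A_expr_residual[OF frame] B_expr_residual[OF frame] by simp
qed

end

section \<open>A Riemannian modification with prescribed mixed part\<close>

context preserving_atlas
begin

text \<open>\<open>riesz gbar\<close> is a smooth bundle map onto \<open>D\<close> that is the identity on \<open>D\<close>, so this tensor is
  positive definite. It agrees with \<open>gbar\<close> on \<open>D \<times> TQ\<close>; only its restriction to the orthogonal
  distribution differs.\<close>

definition gmod :: "'q tensor2" where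
  "gmod q u w = g q (riesz gbar q u) (riesz gbar q w) + g q (u - proj q u) (w - proj q w)"

lemma bar_tensor: "tensor_atlas Q gbar" ..

text \<open>For \<open>u\<close> in \<open>D\<close> both projections fix \<open>u\<close>: the
  normal summand vanishes, and the first one is the defining pairing of
  \<open>riesz gbar\<close>.\<close>

lemma gmod_D:
  assumes q: "q \<in> points Q" and u: "u \<in> D q" and w: "w \<in> T q"
  shows "gmod q u w = gbar q u w"
proof -
  note uT = D_T[OF q u] and wT = riesz_T[OF bar_tensor w]
  have "riesz gbar q u = u" by (rule riesz_eqI[OF bar_tensor uT u]) (simp add: preserving[OF q u])
  moreover have "g q u (riesz gbar q w) = gbar q u w"
    using riesz(2)[OF bar_tensor w u] tensor_sym[OF uT wT] bar.tensor_sym[OF uT w] by simp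
  moreover have "g q 0 (w - proj q w) = 0"
    by (rule zero_left[OF T_diff[OF w riesz_T[OF g_tensor w]]])
  ultimately show ?thesis by (simp only: gmod_def proj_D[OF q u] diff_self add_0_right)
qed

lemma gmod_tensor: "symmetric_tensor Q gmod"
  unfolding symmetric_tensor_def
proof (intro conjI ballI allI impI; (elim conjE)?)
  fix q u v w and r :: real
  assume q: "q \<in> points Q" and T: "u \<in> T q" "v \<in> T q" "w \<in> T q"
  note R = riesz_T[OF bar_tensor] riesz_T[OF g_tensor]
  note P = T_diff[OF T(1) R(2)[OF T(1)]] T_diff[OF T(2) R(2)[OF T(2)]] T_diff[OF T(3) R(2)[OF T(3)]]
  show "gmod q u v = gmod q v u"
    unfolding gmod_def using tensor_sym[OF R(1)[OF T(1)] R(1)[OF T(2)]] tensor_sym[OF P(1,2)] by simp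
  have "u + v - proj q (u + v) = (u - proj q u) + (v - proj q v)"
    unfolding riesz_add[OF g_tensor T(1,2)] by simp
  then show "gmod q (u + v) w = gmod q u w + gmod q v w"
    by (simp only: gmod_def riesz_add[OF bar_tensor T(1,2)]
        add_left[OF R(1)[OF T(1)] R(1)[OF T(2)] R(1)[OF T(3)]] add_left[OF P] add_ac)
  have "r *\<^sub>R u - proj q (r *\<^sub>R u) = r *\<^sub>R (u - proj q u)"
    unfolding riesz_scale[OF g_tensor T(1)] by (simp add: scaleR_diff_right)
  then show "gmod q (r *\<^sub>R u) v = r * gmod q u v"
    unfolding gmod_def riesz_scale[OF bar_tensor T(1)]
    using scale_left[OF R(1)[OF T(1)] R(1)[OF T(2)]] scale_left[OF P(1,2)] by (simp add: distrib_left)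
next
  fix U Y Z assume Y: "vector_field Q U Y" and Z: "vector_field Q U Z"
  show "smooth_fun Q U (\<lambda>q. gmod q (Y q) (Z q))"
    unfolding gmod_def
    by (intro smooth_fun_add vf_opn[OF Y] smooth riesz_vf bar_tensor g_tensor vf_diff Y Z)
qed

text \<open>\<open>gbar\<close> may be indefinite; both summands of \<open>gmod\<close> are squares
  for \<open>g\<close>. The normal one is positive unless \<open>v\<close> lies in \<open>D\<close>,
  and there \<open>gmod\<close> is \<open>g\<close>.\<close>

lemma gmod_pos:
  assumes v: "v \<in> T q" and "v \<noteq> 0"
  shows "gmod q v v > 0"
proof -
  note q = tangent_points[OF v] and R = riesz_T[OF bar_tensor v] riesz_T[OF g_tensor v]
  have nn: "g q u u \<ge> 0" if "u \<in> T q" for u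
    using posdef[OF that] zero_left[OF that] by (cases "u = 0") auto
  show ?thesis
  proof (cases "v = proj q v")
    case True
    then have vD: "v \<in> D q" using riesz(1)[OF g_tensor v] by metis
    have "gmod q v v = g q v v" using gmod_D[OF q vD v] preserving[OF q vD vD] by simp
    then show ?thesis using posdef[OF v] assms(2) by simp
  next
    case False
    then have "g q (v - proj q v) (v - proj q v) > 0"
      using posdef[OF T_diff[OF v R(2)]] by simp
    then show ?thesis unfolding gmod_def using nn[OF R(1)] by simp
  qed
qed

definition ghat :: "'q tensor2" where
  "ghat q u w = exp (2 * F q) * gmod q u w"

lemma ghat_riemannian: "riemannian_metric Q ghat"
  unfolding riemannian_metric_def
proof (intro conjI ballI impI)
  interpret gm: tensor_atlas Q gmod by unfold_locales (rule gmod_tensor)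
  show "symmetric_tensor Q ghat"
    unfolding symmetric_tensor_def
  proof (intro conjI ballI allI impI; (elim conjE)?)
    fix q u v w and r :: real
    assume T: "u \<in> T q" "v \<in> T q" "w \<in> T q"
    show "ghat q u v = ghat q v u" unfolding ghat_def using gm.tensor_sym[OF T(1,2)] by simp
    show "ghat q (u + v) w = ghat q u w + ghat q v w"
      unfolding ghat_def using gm.add_left[OF T] by (simp add: distrib_left)
    show "ghat q (r *\<^sub>R u) v = r * ghat q u v"
      unfolding ghat_def using gm.scale_left[OF T(1,2)] by simp
  next
    fix U Y Z assume Y: "vector_field Q U Y" and Z: "vector_field Q U Z"
    show "smooth_fun Q U (\<lambda>q. ghat q (Y q) (Z q))"
      unfolding ghat_def
      by (intro smooth_fun_mult smooth_fun_exp smooth_fun_cmult F_smooth vf_opn[OF Y] gm.smooth Y Z)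
  qed
  show "ghat q v v > 0" if "v \<in> T q" "v \<noteq> 0" for q v
    using gmod_pos[OF that] by (simp add: ghat_def)
qed

lemma gmod_preserving: "preserving_atlas Q g m D gmod F"
proof
  show "symmetric_tensor Q gmod" by (rule gmod_tensor)
  show "smooth_fun Q (points Q) F" by (rule F)
  show "gmod q v w = g q v w" if "q \<in> points Q" "v \<in> D q" "w \<in> D q" for q v w
    using gmod_D[OF that(1,2) D_T[OF that(1,3)]] preserving[OF that] by simp
qed

lemma ghat_conformal: "conformal_atlas Q g m D gmod F ghat"
proof -
  interpret gm: preserving_atlas Q g m D gmod F by (rule gmod_preserving)
  show ?thesis
    by unfold_locales (use ghat_riemannian in \<open>auto simp: riemannian_metric_def ghat_def dest: tangent_points\<close>)
qed

text \<open>In the frame-free forms of (A') and (B') the tensor \<open>gbar\<close> always has a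
  vector of \<open>D\<close> in one slot, where \<open>gmod\<close> agrees with it. So the
  conditions pass to \<open>gmod\<close>, for which the rescaled tensor is a metric and
  \<open>projective_iff\<close> applies.\<close>

lemma ghat_projective:
  assumes A: "condition_A Q g m D F gbar" and B: "condition_B Q g m D F gbar" and q: "q \<in> points Q" and v: "v \<in> D q"
  shows "nonholonomic_field Q g m D (q, v) = geodesic_spray Q ghat (q, v) + v F *\<^sub>R liouville Q (q, v)"
proof -
  interpret gm: conformal_atlas Q g m D gmod F ghat by (rule ghat_conformal)
  obtain U X where X: "adapted_frame Q g m D U X" "q \<in> U" using adapted_frame_ex[OF q] .
  note frame = X v
  have velocity_tangent: "v \<in> T q" using D_T[OF q v] .
  have "A_expr Q g m F gmod X q v c = A_expr Q g m F gbar X q v c" if c: "c < m" for c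
    using bracket_T[OF extension_field[OF frame] frame_field[OF frame] X(2)] af_le[OF X c] gmod_D[OF q v]
    unfolding A_expr_eq[OF frame c] gm.A_expr_eq[OF frame c] by simp
  moreover have "B_expr Q g m D F gmod X q v i = B_expr Q g m D F gbar X q v i" if i: "i \<in> {m..<DIM('e)}" for i
  proof -
    have i': "i < DIM('e)" using i by simp
    have n: "nabla (extension X q v) (extension X q v) q \<in> T q" using nabla_T[OF extension_field[OF frame] extension_field[OF frame] X(2)] .
    \<comment> \<open>The pairing is differentiated, so agreement is needed along the whole section
      near \<open>q\<close>; it holds because the section stays in \<open>D\<close>.\<close>
    have "v (\<lambda>p. gmod p (extension X q v p) (X i p)) = v (\<lambda>p. gbar p (extension X q v p) (X i p))"
      by (rule tangent_local[OF velocity_tangent lf_opn[OF af_lf[OF X(1)]] X(2)])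
         (rule gmod_D[OF af_points[OF X(1)] extension_D[OF frame] vf_T[OF frame_field[OF frame i']]])
    then show ?thesis
      using bracket_T[OF extension_field[OF frame] frame_field[OF frame i'] X(2)] gmod_D[OF q v] gmod_D[OF q riesz(1)[OF g_tensor n]]
        frame_tangent[OF frame i']
      unfolding B_expr_eq[OF frame i] gm.B_expr_eq[OF frame i] by simp
  qed
  ultimately show ?thesis
    using gm.projective_iff[OF frame] A B X v unfolding condition_A_iff condition_B_iff by simp
qed

end

section \<open>Both implications\<close>

theorem proposition1:
  fixes Q :: "('q, 'e::euclidean_space) atlas"
    and g :: "'q tensor2"
    and m :: nat
    and D :: "'q \<Rightarrow> 'q tvec set"
    and F :: "'q \<Rightarrow> real"
  assumes "smooth_manifold Q"
    and "riemannian_metric Q g"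
    and "distribution Q m D"
    and "smooth_fun Q (points Q) F"
  shows "(\<forall>gbar ghat P.
            preserving_modification Q g D gbar \<and>
            conformal_rescaling Q F gbar ghat \<and>
            riemannian_metric Q ghat \<and>
            projective_geodesic_extension Q g m D ghat P \<and>
            restricts_to_differential Q g m D F P \<longrightarrow>
            condition_A Q g m D F gbar \<and> condition_B Q g m D F gbar) \<and>
         (\<forall>gbar.
            pseudo_riemannian_metric Q gbar \<and>
            preserving_modification Q g D gbar \<and>
            condition_A Q g m D F gbar \<and> condition_B Q g m D F gbar \<longrightarrow>
            (\<exists>ghat P.
               projective_geodesic_extension Q g m D ghat P \<and>
               riemannian_metric Q ghat \<and>
               conformal_modification Q g D F ghat \<and>
               restricts_to_differential Q g m D F P))"
proof -
  interpret smooth_atlas Q using assms(1) by (rule smooth_manifold_imp_smooth_atlas)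
  interpret distribution_atlas Q g m D
    by unfold_locales (use assms(2,3) in \<open>auto simp: riemannian_metric_def dest: tangent_points\<close>)
  have pres: "preserving_atlas Q g m D gbar F" if "preserving_modification Q g D gbar" for gbar
    by unfold_locales (use that assms(4) in \<open>auto simp: preserving_modification_def\<close>)
  show ?thesis
  proof (intro conjI allI impI; elim conjE)
    fix gbar ghat P
    assume bar: "preserving_modification Q g D gbar" and resc: "conformal_rescaling Q F gbar ghat"
      and hat: "riemannian_metric Q ghat" and proj: "projective_geodesic_extension Q g m D ghat P"
      and P: "restricts_to_differential Q g m D F P"
    interpret pr: preserving_atlas Q g m D gbar F using pres[OF bar] .
    interpret hat: riemannian_atlas Q ghat using hat by (rule riemannian_atlasI)
    interpret conformal_atlas Q g m D gbar F ghat
      by unfold_locales (use resc in \<open>simp add: conformal_rescaling_def\<close>)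
    have "(\<forall>c<m. A_expr Q g m F gbar X q v c = 0) \<and> (\<forall>i\<in>{m..<DIM('e)}. B_expr Q g m D F gbar X q v i = 0)"
      if X: "adapted_frame Q g m D U X" and q: "q \<in> U" and v: "v \<in> D q" for U X q v
    proof -
      \<comment> \<open>The expression prescribed for \<open>P\<close> on \<open>D\<close> is the
        frame expansion of the derivative of \<open>F\<close> along \<open>v\<close>.\<close>
      have "P (q, v) = v F"
        using P X q v pr.v_apply[OF X q v, of F] unfolding restricts_to_differential_def by (simp add: mult.commute)
      then have "nonholonomic_field Q g m D (q, v) = geodesic_spray Q ghat (q, v) + v F *\<^sub>R liouville Q (q, v)"
        using proj af_points[OF X q] v unfolding projective_geodesic_extension_def by metis
      then show ?thesis using projective_iff[OF X q v] by blast
    qed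
    then show "condition_A Q g m D F gbar" "condition_B Q g m D F gbar"
      unfolding condition_A_iff condition_B_iff by blast+
  next
    fix gbar
    assume bar: "preserving_modification Q g D gbar"
      and A: "condition_A Q g m D F gbar" and B: "condition_B Q g m D F gbar"
    interpret pr: preserving_atlas Q g m D gbar F using pres[OF bar] .
    \<comment> \<open>The differential of \<open>F\<close>, defined on all of \<open>TQ\<close>:
      smooth, linear on fibres, and with the prescribed restriction to \<open>D\<close>.\<close>
    let ?P = "\<lambda>w. snd w F"
    have oQ: "opn (points Q)" unfolding points_eq using opn_chart by blast
    have "smooth_fibrewise_linear Q ?P"
      unfolding smooth_fibrewise_linear_def points_tangent_bundle
      using smooth_fun_eval[OF oQ assms(4)] by (simp add: plus_fun_def scaleR_fun_def)
    then have "projective_geodesic_extension Q g m D pr.ghat ?P"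
      unfolding projective_geodesic_extension_def
      using pr.ghat_riemannian pr.ghat_projective[OF A B] by simp
    moreover have "conformal_modification Q g D F pr.ghat"
    proof -
      have "preserving_modification Q g D pr.gmod"
        using pr.gmod_tensor preserving_atlas.preserving[OF pr.gmod_preserving]
        by (simp add: preserving_modification_def)
      moreover have "conformal_rescaling Q F pr.gmod pr.ghat"
        by (simp add: conformal_rescaling_def pr.ghat_def)
      ultimately show ?thesis
        using pr.ghat_riemannian unfolding conformal_modification_def riemannian_metric_def
        by (intro conjI exI[of _ pr.gmod]) simp_all
    qed
    moreover have "restricts_to_differential Q g m D F ?P"
      unfolding restricts_to_differential_def using pr.v_apply by (simp add: mult.commute)
    ultimately show "\<exists>ghat P. projective_geodesic_extension Q g m D ghat P \<and> riemannian_metric Q ghat \<and>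
        conformal_modification Q g D F ghat \<and> restricts_to_differential Q g m D F P"
      using pr.ghat_riemannian by (intro exI[of _ pr.ghat] exI[of _ ?P] conjI)
  qed
qed

end
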